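(* Let $(\mathscr{D},\mathbf{R}, T)$ be a localised regularised Brascamp-Lieb datum, with $\mathscr{D}=((\ell_j)_{j\in J},(q_j)_{j\in J})$, $\ell_j:H\to H_j$, and $\mathbf{R}=(R_j)_{j\in J}$. Let $\boldsymbol{\alpha}=(\alpha_j)_{j\in J} \in \mathbb{R}_{>0}^J$ and $\beta \in \mathbb{R}_{\geq 0}$. Assume that $\mathscr{D}$ is $(\boldsymbol{\alpha}, \beta)$-perceptive, i.e. $\sum_{j\in J} q_j \operatorname{rk}_{\alpha_j}(\ell_j\mid W)\ge \dim W-\beta$ for every linear subspace $W\subseteq H$, and that $\operatorname{rk}_{\alpha_j}(\ell_j) = \dim H_j$ for each $j \in J$. Then, writing $d=\dim H$, we have \[ \operatorname{BL}(\mathscr{D}, \mathbf{R}, T) \leq d^{\frac{\mathscr{A}(\mathscr{D})}{2}}\, \mathscr{E}(\mathscr{D}) \Bigl(\prod_{j \in J} \alpha_j^{-q_j \dim H_j}\Bigr) N(\mathscr{D}, \mathbf{R}, T)^{\frac{\mathscr{A}(\mathscr{D})-d+\beta}{2}}\, \|T^{-1}\|^{\frac{\beta}{2}}, \] where \[ \mathscr{A}(\mathscr{D})=\sum_{j\in J}q_j\dim H_j,\qquad \mathscr{E}(\mathscr{D})=\prod_{j\in J}q_j^{-q_j\dim H_j/2},\qquad N(\mathscr{D},\mathbf{R},T)=\Bigl\|T+\sum_{j\in J}q_j\,\ell_j^*R_j\ell_j\Bigr\|, \] $\|\cdot\|$ is the operator norm and $\ell_j^*:H_j\to H$ is the adjoint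 of $\ell_j$.
   Context: A Euclidean space is a finite-dimensional real Hilbert space, equipped with the Lebesgue measure induced by its inner product. A Brascamp-Lieb datum $\mathscr{D}=((\ell_j)_{j\in J},(q_j)_{j\in J})$ consists of a finite index set $J$, Euclidean spaces $H$ and $H_j$ ($j\in J$), linear maps $\ell_j:H\to H_j$, and real numbers $q_j>0$. A localised regularised Brascamp-Lieb datum is a triple $(\mathscr{D},\mathbf{R},T)$ where $\mathscr{D}$ is a Brascamp-Lieb datum, $\mathbf{R}=(R_j)_{j\in J}$ with each $R_j$ a positive definite symmetric endomorphism of $H_j$, and $T$ is a positive definite symmetric endomorphism of $H$. For a positive definite symmetric endomorphism $R$ of a Euclidean space $E$ and $x\in E$, set $\chi_R(x)=e^{-\pi\langle x,Rx\rangle}$ and $\mathscr{N}_R(x)=(\det R)^{1/2}\chi_R(x)$. A function $f:E\to\mathbb{R}_{\ge0}$ is of type $R$ if $f=\mathscr{N}_R*\mu$ for some finite (positive) Borel measure $\mu$ on $E$. $\operatorname{BL}(\mathscr{D},\mathbf{R},T)\in[0,+\infty]$ is the smallest number such that \[ \int_{H} \chi_T \prod_{j \in J} (f_{j}\circ \ell_{j})^{q_{j}} \leq \operatorname{BL}(\mathscr{D}, \mathbf{R}, T) \prod_{j \in J} \Bigl(\int_{H_{j}} f_{j} \Bigr)^{q_{j}} \] for all collections $(f_j)_{j\in J}$ such that $f_j:H_j\to\mathbb{R}_{\ge0}$ is of type $R_j$ for each $j\in J$. For a linear map $\ell:H\to H'$ between Euclidean spaces and $\alpha\ge0$, the $\alpha$-essential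 rank $\operatorname{rk}_\alpha(\ell)$ is the number (counted with multiplicity) of singular values of $\ell$ that are strictly greater than $\alpha$. For a subspace $W\subseteq H$, $\operatorname{rk}_\alpha(\ell\mid W):=\operatorname{rk}_\alpha(\ell_{|W})$, where $\ell_{|W}:W\to H'$ is the restriction. *)

theory Defs
  imports "HOL-Analysis.Analysis"
begin

text \<open>
  Conventions.  The Euclidean space \<open>H\<close> is a type \<open>'a\<close> of class \<open>euclidean_space\<close>.  The spaces
  \<open>H\<^sub>j\<close> may have different dimensions (including 0), so they are given as linear subspaces \<open>V j\<close>
  of one type \<open>'b\<close> of class \<open>euclidean_space\<close>, each with the induced inner product; any finite
  family of Euclidean spaces embeds isometrically in this way.  The type \<open>'b\<close> has no other role:
  all notions below for a subspace \<open>V\<close> are intrinsic to \<open>V\<close>.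
\<close>

subsection \<open>Lebesgue measure, determinants and positive definite endomorphisms of a subspace\<close>

definition is_onb :: "'b::euclidean_space set \<Rightarrow> 'b set \<Rightarrow> bool" where
  "is_onb V B \<longleftrightarrow> B \<subseteq> V \<and> pairwise orthogonal B \<and> (\<forall>b\<in>B. norm b = 1) \<and> span B = V"

definition onb :: "'b::euclidean_space set \<Rightarrow> 'b set" where
  "onb V = (SOME B. is_onb V B)"

lemma is_onb_onb:
  assumes "subspace V"
  shows "is_onb V (onb V)"
  unfolding onb_def
proof (rule someI_ex)
  show "\<exists>B. is_onb V B"
    using orthonormal_basis_subspace[OF assms] unfolding is_onb_def by metis
qed

text \<open>
  The same construction as \<open>lborel\<close>, with an orthonormal basis of \<open>V\<close> in place of \<open>Basis\<close>.
\<close>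

definition lborel_on :: "'b::euclidean_space set \<Rightarrow> 'b measure" where
  "lborel_on V =
     distr (\<Pi>\<^sub>M b\<in>onb V. lborel) (restrict_space borel V) (\<lambda>f. \<Sum>b\<in>onb V. f b *\<^sub>R b)"

text \<open>Determinant of the matrix of \<open>R : V \<rightarrow> V\<close> in an orthonormal basis of \<open>V\<close> (as in \<open>det\<close>).\<close>

definition det_on :: "'b::euclidean_space set \<Rightarrow> ('b \<Rightarrow> 'b) \<Rightarrow> real" where
  "det_on V R =
     (\<Sum>p | p permutes onb V. of_int (sign p) * (\<Prod>b\<in>onb V. b \<bullet> R (p b)))"

text \<open>
  An endomorphism of \<open>V\<close> is represented by a linear map of the ambient space preserving \<open>V\<close>;
  only its restriction to \<open>V\<close> is ever used, and every endomorphism of \<open>V\<close> arises this way.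
\<close>

definition pos_def_on :: "'b::euclidean_space set \<Rightarrow> ('b \<Rightarrow> 'b) \<Rightarrow> bool" where
  "pos_def_on V R \<longleftrightarrow> linear R \<and> R ` V \<subseteq> V \<and>
     (\<forall>x\<in>V. \<forall>y\<in>V. R x \<bullet> y = x \<bullet> R y) \<and> (\<forall>x\<in>V. x \<noteq> 0 \<longrightarrow> 0 < x \<bullet> R x)"

subsection \<open>Functions of Gaussian type\<close>

definition chi :: "('b::euclidean_space \<Rightarrow> 'b) \<Rightarrow> 'b \<Rightarrow> real" where
  "chi R x = exp (- pi * (x \<bullet> R x))"

definition gauss_on :: "'b::euclidean_space set \<Rightarrow> ('b \<Rightarrow> 'b) \<Rightarrow> 'b \<Rightarrow> real" where
  "gauss_on V R x = sqrt (det_on V R) * chi R x"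

definition of_type :: "'b::euclidean_space set \<Rightarrow> ('b \<Rightarrow> 'b) \<Rightarrow> ('b \<Rightarrow> real) \<Rightarrow> bool" where
  "of_type V R f \<longleftrightarrow>
     (\<exists>\<mu>. finite_measure \<mu> \<and> sets \<mu> = sets (restrict_space borel V) \<and>
          (\<forall>x\<in>V. f x = (\<integral>y. gauss_on V R (x - y) \<partial>\<mu>)))"

subsection \<open>Singular values and essential rank\<close>

text \<open>
  Adjoint of the restriction of \<open>f\<close> to \<open>W\<close>, with values in \<open>W\<close>; for \<open>W = UNIV\<close> this is \<open>adjoint f\<close>.
\<close>

definition adjoint_on :: "'a::euclidean_space set \<Rightarrow> ('a \<Rightarrow> 'b::euclidean_space) \<Rightarrow> 'b \<Rightarrow> 'a" where
  "adjoint_on W f y = (THE z. z \<in> W \<and> (\<forall>x\<in>W. f x \<bullet> y = x \<bullet> z))"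

text \<open>
  The singular values of \<open>f : W \<rightarrow> V\<close> are the numbers \<open>s \<ge> 0\<close> such that \<open>s\<^sup>2\<close> is an eigenvalue of
  \<open>f\<^sup>* f\<close>, with the dimension of the eigenspace as multiplicity.
\<close>

definition singular_space ::
    "'a::euclidean_space set \<Rightarrow> ('a \<Rightarrow> 'b::euclidean_space) \<Rightarrow> real \<Rightarrow> 'a set" where
  "singular_space W f s = {x \<in> W. adjoint_on W f (f x) = s\<^sup>2 *\<^sub>R x}"

definition singular_values ::
    "'a::euclidean_space set \<Rightarrow> ('a \<Rightarrow> 'b::euclidean_space) \<Rightarrow> real set" where
  "singular_values W f = {s. 0 \<le> s \<and> singular_space W f s \<noteq> {0}}"

definition ess_rank ::
    "real \<Rightarrow> 'a::euclidean_space set \<Rightarrow> ('a \<Rightarrow> 'b::euclidean_space) \<Rightarrow> nat" where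
  "ess_rank \<alpha> W f = (\<Sum>s | s \<in> singular_values W f \<and> \<alpha> < s. dim (singular_space W f s))"

lemma adjoint_on_works:
  fixes f :: "'a::euclidean_space \<Rightarrow> 'b::euclidean_space"
  assumes "subspace W" "linear f"
  shows "adjoint_on W f y \<in> W" and "x \<in> W \<Longrightarrow> f x \<bullet> y = x \<bullet> adjoint_on W f y"
proof -
  obtain B where B: "B \<subseteq> W" "pairwise orthogonal B" "\<And>b. b \<in> B \<Longrightarrow> norm b = 1"
      "independent B" "span B = W"
    using orthonormal_basis_subspace[OF \<open>subspace W\<close>] by metis
  have fin: "finite B"
    using B(4) by (rule finiteI_independent)
  let ?z = "\<Sum>b\<in>B. (f b \<bullet> y) *\<^sub>R b"
  have zW: "?z \<in> W"
    using B(1) assms(1) by (intro subspace_sum subspace_scale) auto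
  have onB: "f b \<bullet> y = b \<bullet> ?z" if "b \<in> B" for b
  proof -
    have "b \<bullet> ?z = (\<Sum>c\<in>B. (f c \<bullet> y) * (b \<bullet> c))"
      by (simp add: inner_sum_right)
    also have "\<dots> = (\<Sum>c\<in>B. if c = b then f b \<bullet> y else 0)"
      using B(2,3) that
      by (intro sum.cong) (auto simp: pairwise_def orthogonal_def norm_eq_1)
    finally show ?thesis
      using fin that by simp
  qed
  have zf: "f x \<bullet> y = x \<bullet> ?z" if "x \<in> W" for x
  proof -
    have "subspace {x. f x \<bullet> y = x \<bullet> ?z}"
      by (auto simp: subspace_def linear_add[OF assms(2)] linear_scale[OF assms(2)]
          linear_0[OF assms(2)] inner_add_left)
    moreover have "B \<subseteq> {x. f x \<bullet> y = x \<bullet> ?z}"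
      using onB by blast
    ultimately have "span B \<subseteq> {x. f x \<bullet> y = x \<bullet> ?z}"
      by (rule span_minimal[rotated])
    then show ?thesis
      using that B(5) by blast
  qed
  have ex1: "\<exists>!z. z \<in> W \<and> (\<forall>x\<in>W. f x \<bullet> y = x \<bullet> z)"
  proof (rule ex1I[of _ ?z])
    show "?z \<in> W \<and> (\<forall>x\<in>W. f x \<bullet> y = x \<bullet> ?z)"
      using zW zf by blast
  next
    fix z assume z: "z \<in> W \<and> (\<forall>x\<in>W. f x \<bullet> y = x \<bullet> z)"
    have "z - ?z \<in> W"
      using z zW assms(1) by (simp add: subspace_diff)
    then have "(z - ?z) \<bullet> z = (z - ?z) \<bullet> ?z"
      using z zf[of "z - ?z"] by auto
    then have "(z - ?z) \<bullet> (z - ?z) = 0"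
      unfolding inner_diff_right[of "z - ?z"] by simp
    then show "z = ?z"
      by simp
  qed
  from theI'[OF ex1] show "adjoint_on W f y \<in> W" "x \<in> W \<Longrightarrow> f x \<bullet> y = x \<bullet> adjoint_on W f y"
    unfolding adjoint_on_def by blast+
qed

lemma adjoint_on_UNIV:
  fixes f :: "'a::euclidean_space \<Rightarrow> 'b::euclidean_space"
  assumes "linear f"
  shows "adjoint_on UNIV f = adjoint f"
  by (rule adjoint_unique[symmetric]) (simp add: adjoint_on_works(2)[OF subspace_UNIV assms])

text \<open>In particular the sum defining \<open>ess_rank\<close> is finite.\<close>

lemma finite_singular_values:
  fixes f :: "'a::euclidean_space \<Rightarrow> 'b::euclidean_space"
  assumes W: "subspace W" and f: "linear f"
  shows "finite (singular_values W f)"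
proof -
  have "\<exists>x. x \<in> singular_space W f s \<and> x \<noteq> 0" if "s \<in> singular_values W f" for s
  proof -
    have "0 \<in> singular_space W f s"
    proof -
      have "adjoint_on W f 0 \<bullet> adjoint_on W f 0 = 0"
        using adjoint_on_works[OF W f, where y = 0] by (metis inner_zero_right)
      then show ?thesis
        using W by (simp add: singular_space_def subspace_0 linear_0[OF f])
    qed
    then show ?thesis
      using that unfolding singular_values_def by blast
  qed
  then obtain v where v: "\<And>s. s \<in> singular_values W f \<Longrightarrow> v s \<in> singular_space W f s \<and> v s \<noteq> 0"
    by metis
  have orth: "v s \<bullet> v t = 0"
    if "s \<in> singular_values W f" "t \<in> singular_values W f" "s \<noteq> t" for s t
  proof -
    have s: "v s \<in> W" "adjoint_on W f (f (v s)) = s\<^sup>2 *\<^sub>R v s"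
      and t: "v t \<in> W" "adjoint_on W f (f (v t)) = t\<^sup>2 *\<^sub>R v t"
      using v that by (auto simp: singular_space_def)
    have "f (v s) \<bullet> f (v t) = t\<^sup>2 * (v s \<bullet> v t)"
      using adjoint_on_works(2)[OF W f s(1), of "f (v t)"] t(2) by simp
    moreover have "f (v t) \<bullet> f (v s) = s\<^sup>2 * (v t \<bullet> v s)"
      using adjoint_on_works(2)[OF W f t(1), of "f (v s)"] s(2) by simp
    moreover have "s\<^sup>2 \<noteq> t\<^sup>2"
      using that by (auto simp: singular_values_def power2_eq_iff_nonneg)
    ultimately show ?thesis
      by (metis inner_commute mult_right_cancel)
  qed
  have inj: "inj_on v (singular_values W f)"
    using orth v by (metis inj_onI inner_eq_zero_iff)
  have "pairwise orthogonal (v ` singular_values W f)"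
    using orth by (auto simp: pairwise_def orthogonal_def)
  moreover have "0 \<notin> v ` singular_values W f"
    using v by force
  ultimately have "finite (v ` singular_values W f)"
    by (intro finiteI_independent pairwise_orthogonal_independent)
  then show ?thesis
    using inj by (rule finite_imageD)
qed

subsection \<open>Brascamp-Lieb data\<close>

definition BL_datum ::
    "'j set \<Rightarrow> ('j \<Rightarrow> 'b::euclidean_space set) \<Rightarrow> ('j \<Rightarrow> 'a::euclidean_space \<Rightarrow> 'b) \<Rightarrow> ('j \<Rightarrow> real) \<Rightarrow> bool"
  where "BL_datum J V l q \<longleftrightarrow> finite J \<and>
     (\<forall>j\<in>J. subspace (V j) \<and> linear (l j) \<and> range (l j) \<subseteq> V j \<and> 0 < q j)"

definition localised_regularised_BL_datum ::
    "'j set \<Rightarrow> ('j \<Rightarrow> 'b::euclidean_space set) \<Rightarrow> ('j \<Rightarrow> 'a::euclidean_space \<Rightarrow> 'b) \<Rightarrow> ('j \<Rightarrow> real) \<Rightarrow>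
     ('j \<Rightarrow> 'b \<Rightarrow> 'b) \<Rightarrow> ('a \<Rightarrow> 'a) \<Rightarrow> bool"
  where "localised_regularised_BL_datum J V l q R T \<longleftrightarrow>
     BL_datum J V l q \<and> (\<forall>j\<in>J. pos_def_on (V j) (R j)) \<and> pos_def_on UNIV T"

text \<open>
  The infimum is attained, hence is the smallest admissible constant.  Functions of type \<open>R j\<close> are
  integrable on \<open>V j\<close>, so the Bochner integrals on the right are the true (finite) integrals.
\<close>

definition BL ::
    "'j set \<Rightarrow> ('j \<Rightarrow> 'b::euclidean_space set) \<Rightarrow> ('j \<Rightarrow> 'a::euclidean_space \<Rightarrow> 'b) \<Rightarrow> ('j \<Rightarrow> real) \<Rightarrow>
     ('j \<Rightarrow> 'b \<Rightarrow> 'b) \<Rightarrow> ('a \<Rightarrow> 'a) \<Rightarrow> ennreal"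
  where "BL J V l q R T = Inf {C. \<forall>f. (\<forall>j\<in>J. of_type (V j) (R j) (f j)) \<longrightarrow>
     (\<integral>\<^sup>+x. ennreal (chi T x * (\<Prod>j\<in>J. f j (l j x) powr q j)) \<partial>lborel)
       \<le> C * ennreal (\<Prod>j\<in>J. (\<integral>y. f j y \<partial>lborel_on (V j)) powr q j)}"

definition perceptive ::
    "'j set \<Rightarrow> ('j \<Rightarrow> 'a::euclidean_space \<Rightarrow> 'b::euclidean_space) \<Rightarrow> ('j \<Rightarrow> real) \<Rightarrow>
     ('j \<Rightarrow> real) \<Rightarrow> real \<Rightarrow> bool"
  where "perceptive J l q \<alpha> \<beta> \<longleftrightarrow>
     (\<forall>W. subspace W \<longrightarrow> (\<Sum>j\<in>J. q j * real (ess_rank (\<alpha> j) W (l j))) \<ge> real (dim W) - \<beta>)"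

definition BL_A :: "'j set \<Rightarrow> ('j \<Rightarrow> 'b::euclidean_space set) \<Rightarrow> ('j \<Rightarrow> real) \<Rightarrow> real" where
  "BL_A J V q = (\<Sum>j\<in>J. q j * real (dim (V j)))"

definition BL_E :: "'j set \<Rightarrow> ('j \<Rightarrow> 'b::euclidean_space set) \<Rightarrow> ('j \<Rightarrow> real) \<Rightarrow> real" where
  "BL_E J V q = (\<Prod>j\<in>J. q j powr (- (q j * real (dim (V j)) / 2)))"

definition BL_N ::
    "'j set \<Rightarrow> ('j \<Rightarrow> 'a::euclidean_space \<Rightarrow> 'b::euclidean_space) \<Rightarrow> ('j \<Rightarrow> real) \<Rightarrow>
     ('j \<Rightarrow> 'b \<Rightarrow> 'b) \<Rightarrow> ('a \<Rightarrow> 'a) \<Rightarrow> real"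
  where "BL_N J l q R T = onorm (\<lambda>x. T x + (\<Sum>j\<in>J. q j *\<^sub>R adjoint (l j) (R j (l j x))))"

end

theory Submission
  imports Defs "HOL-Probability.Distributions"
begin

text \<open>
  Write \<open>M = T + \<Sum>j. q j * l\<^sub>j\<^sup>* A\<^sub>j l\<^sub>j\<close> for positive definite \<open>A\<^sub>j \<le> R\<^sub>j\<close>.  By compactness the quotient
  \<open>(\<Prod>j. det A\<^sub>j powr q j) / det M\<close> has a maximiser; its first-order conditions say that
  \<open>P\<^sub>j = A\<^sub>j\<^sup>-\<^sup>1 - l\<^sub>j M\<^sup>-\<^sup>1 l\<^sub>j\<^sup>*\<close> is nonnegative and that the trace of \<open>P\<^sub>j (R\<^sub>j - A\<^sub>j)\<close> vanishes.  These are exactly what makes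
  the Brascamp--Lieb integral monotone along the Ornstein--Uhlenbeck flow that takes Gaussian mixtures of type
  \<open>R\<^sub>j\<close> to centred Gaussians \<open>A\<^sub>j\<close>, so the constant is at most the square root of the maximal quotient.

  To bound the quotient, take an orthonormal eigenbasis \<open>e\<^sub>i\<close> of \<open>M\<close> with increasing eigenvalues \<open>\<Lambda>\<^sub>i\<close>.  For each \<open>j\<close>
  select greedily the indices \<open>i\<close> for which \<open>l\<^sub>j e\<^sub>i\<close> has distance at least \<open>\<alpha>\<^sub>j / sqrt d\<close> from the span of the vectors
  selected before.  Hadamard's inequality and \<open>q j * (l\<^sub>j e\<^sub>i \<bullet> A\<^sub>j (l\<^sub>j e\<^sub>i)) \<le> \<Lambda>\<^sub>i\<close> bound \<open>det A\<^sub>j\<close> by a product of selected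
  eigenvalues, perceptivity bounds from below how many of the first \<open>k\<close> indices are selected, and summation by
  parts finishes the estimate.
\<close>

section \<open>Determinants\<close>

text \<open>The square root appears because \<open>exp (- pi * (x \<bullet> M x))\<close> has
  integral \<open>1 / sqrt (det M)\<close>, while normalising the Gaussians of A j costs
  \<open>sqrt (det A j)\<close>. Admitting degenerate A j makes the domain compact; M stays
  invertible because M \<ge> T, and the maximiser is nondegenerate because A j = R j already gives a
  positive quotient. The constraint A j \<le> R j keeps the flow well defined: in coordinates where
  A j is the identity, the variances 1 / r with r \<ge> 1 only grow towards 1.

  Each factor of the constant has one source. A unit vector has coefficients in the eigenbasis of
  absolute sum at most sqrt d, so the selection threshold must be \<alpha> j / sqrt d; this gives
  the powers of d and \<alpha> j. Testing q j times the form of A j against M at eigenvectors gives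
  those of q j. Let c i be the total weight q j of the j that select i, minus 1 for det M.
  Perceptivity makes the partial sums of c at least -\<beta>, so the sum of c i * ln \<Lambda> i is
  at most (A - d + \<beta>) times the largest ln \<Lambda> i minus \<beta> times the smallest. The
  largest eigenvalue is at most N since A j \<le> R j, the smallest at least 1 / ||T^-1|| since M
  \<ge> T.\<close>

definition leibniz_det :: "nat \<Rightarrow> (nat \<Rightarrow> nat \<Rightarrow> real) \<Rightarrow> real" where
  "leibniz_det n A = (\<Sum>p | p permutes {..<n}. of_int (sign p) * (\<Prod>i<n. A i (p i)))"

lemma leibniz_det_cong:
  assumes "\<And>i k. i < n \<Longrightarrow> k < n \<Longrightarrow> A i k = B i k"
  shows "leibniz_det n A = leibniz_det n B"
  unfolding leibniz_det_def
proof (intro sum.cong refl arg_cong2[where f = "(*)"] prod.cong)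
  fix p i assume "p \<in> {p. p permutes {..<n}}" "i \<in> {..<n}"
  then show "A i (p i) = B i (p i)"
    using assms permutes_in_image[of p "{..<n}" i] by auto
qed

lemma leibniz_det_permute_rows:
  assumes q: "q permutes {..<n}"
  shows "leibniz_det n (\<lambda>i. A (q i)) = of_int (sign q) * leibniz_det n A"
proof -
  have "leibniz_det n (\<lambda>i. A (q i))
      = (\<Sum>p | p permutes {..<n}. of_int (sign (p \<circ> q)) * (\<Prod>i<n. A (q i) ((p \<circ> q) i)))"
    unfolding leibniz_det_def by (rule sum_permutations_compose_right[OF q])
  also have "\<dots> = (\<Sum>p | p permutes {..<n}. of_int (sign q) * (of_int (sign p) * (\<Prod>i<n. A i (p i))))"
  proof (intro sum.cong refl)
    fix p assume "p \<in> {p. p permutes {..<n}}"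
    then have p: "p permutes {..<n}" by simp
    have "sign (p \<circ> q) = sign p * sign q"
      using p q by (meson finite_lessThan permutation_permutes sign_compose)
    moreover have "(\<Prod>i<n. A (q i) ((p \<circ> q) i)) = (\<Prod>i<n. A i (p i))"
      using prod.permute[OF q, of "\<lambda>i. A i (p i)"] by (simp add: o_def)
    ultimately show "of_int (sign (p \<circ> q)) * (\<Prod>i<n. A (q i) ((p \<circ> q) i))
        = of_int (sign q) * (of_int (sign p) * (\<Prod>i<n. A i (p i)))" by simp
  qed
  finally show ?thesis by (simp add: leibniz_det_def sum_distrib_left)
qed

text \<open>Transposing the two rows leaves A unchanged but negates the determinant.\<close>

lemma leibniz_det_equal_rows:
  assumes "i < n" "k < n" "i \<noteq> k" "A i = A k"
  shows "leibniz_det n A = 0"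
proof -
  have "Transposition.transpose i k permutes {..<n}"
    using assms by (intro permutes_swap_id) auto
  from leibniz_det_permute_rows[OF this, of A]
  have "leibniz_det n (\<lambda>j. A (Transposition.transpose i k j)) = - leibniz_det n A"
    using assms by (simp add: sign_swap_id)
  moreover have "(\<lambda>j. A (Transposition.transpose i k j)) = A"
    using assms by (auto simp: Transposition.transpose_def)
  ultimately show ?thesis by simp
qed

text \<open>Expanding the product of sums gives a sum over all index maps f. A non-injective f
  produces two equal rows of B and drops out; the injective ones are the permutations.\<close>

lemma leibniz_det_mult:
  "leibniz_det n (\<lambda>i k. \<Sum>j<n. A i j * B j k) = leibniz_det n A * leibniz_det n B"
proof -
  let ?N = "{..<n}" and ?P = "{p. p permutes {..<n}}"
  let ?F = "PiE ?N (\<lambda>_. ?N)"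
  have "leibniz_det n (\<lambda>i k. \<Sum>j<n. A i j * B j k)
      = (\<Sum>p\<in>?P. of_int (sign p) * (\<Sum>f\<in>?F. \<Prod>i<n. A i (f i) * B (f i) (p i)))"
    unfolding leibniz_det_def by (simp add: prod_sum_PiE)
  also have "\<dots> = (\<Sum>f\<in>?F. (\<Prod>i<n. A i (f i)) * leibniz_det n (\<lambda>i. B (f i)))"
    unfolding leibniz_det_def sum_distrib_left prod.distrib
    by (subst sum.swap) (simp add: ac_simps)
  also have "\<dots> = (\<Sum>f\<in>{f\<in>?F. inj_on f ?N}. (\<Prod>i<n. A i (f i)) * leibniz_det n (\<lambda>i. B (f i)))"
  proof (rule sum.mono_neutral_right)
    show "finite ?F" by (auto intro: finite_PiE)
    show "\<forall>f\<in>?F - {f\<in>?F. inj_on f ?N}. (\<Prod>i<n. A i (f i)) * leibniz_det n (\<lambda>i. B (f i)) = 0"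
    proof
      fix f assume "f \<in> ?F - {f\<in>?F. inj_on f ?N}"
      then obtain i k where "i < n" "k < n" "i \<noteq> k" "f i = f k"
        by (auto simp: inj_on_def)
      then show "(\<Prod>i<n. A i (f i)) * leibniz_det n (\<lambda>i. B (f i)) = 0"
        using leibniz_det_equal_rows[of i n k "\<lambda>i. B (f i)"] by simp
    qed
  qed auto
  also have "\<dots> = (\<Sum>p\<in>?P. (\<Prod>i<n. A i (p i)) * leibniz_det n (\<lambda>i. B (p i)))"
  \<comment> \<open>Maps in \<open>PiE\<close> are undefined outside \<open>{..<n}\<close> while
    permutations are the identity there, so each direction adjusts the values outside.\<close>
  proof (rule sum.reindex_bij_witness[where i = "\<lambda>p. restrict p ?N" and j = "\<lambda>f i. if i < n then f i else i"])
    fix f assume f: "f \<in> {f\<in>?F. inj_on f ?N}"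
    then have im: "f ` ?N \<subseteq> ?N" and inj: "inj_on f ?N" by auto
    have "bij_betw f ?N ?N"
      using endo_inj_surj[OF _ im inj] inj by (simp add: bij_betw_def)
    then have "bij_betw (\<lambda>i. if i < n then f i else i) ?N ?N"
      by (subst bij_betw_cong[where g = f]) auto
    then show "(\<lambda>i. if i < n then f i else i) \<in> ?P"
      using bij_imp_permutes[of "\<lambda>i. if i < n then f i else i" ?N] by simp
    show "(\<lambda>i\<in>?N. if i < n then f i else i) = f"
      using f by (auto simp: fun_eq_iff PiE_def extensional_def)
  next
    fix p assume "p \<in> ?P"
    then have p: "p permutes ?N" by simp
    show "(\<lambda>i. if i < n then restrict p ?N i else i) = p"
      using p by (auto simp: fun_eq_iff permutes_def)
    show "restrict p ?N \<in> {f\<in>?F. inj_on f ?N}"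
      using permutes_in_image[OF p] permutes_inj[OF p] by (auto simp: inj_on_def)
  qed (auto simp: leibniz_det_def intro!: sum.cong arg_cong2[where f = "(*)"] prod.cong)
  also have "\<dots> = (\<Sum>p\<in>?P. of_int (sign p) * (\<Prod>i<n. A i (p i)) * leibniz_det n B)"
    by (intro sum.cong) (auto simp: leibniz_det_permute_rows)
  finally show ?thesis
    by (simp add: leibniz_det_def[of n A] sum_distrib_right)
qed

text \<open>A permutation other than the identity moves some i upwards and so meets a zero entry
  above the diagonal.\<close>

lemma leibniz_det_lower_triangular:
  assumes "\<And>i k. i < k \<Longrightarrow> k < n \<Longrightarrow> A i k = 0"
  shows "leibniz_det n A = (\<Prod>i<n. A i i)"
proof -
  have "leibniz_det n A = (\<Sum>p\<in>{id}. of_int (sign p) * (\<Prod>i<n. A i (p i)))"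
    unfolding leibniz_det_def
  proof (rule sum.mono_neutral_right)
    show "\<forall>p\<in>{p. p permutes {..<n}} - {id}. of_int (sign p) * (\<Prod>i<n. A i (p i)) = 0"
    proof
      fix p assume "p \<in> {p. p permutes {..<n}} - {id}"
      then have p: "p permutes {..<n}" "p \<noteq> id" by auto
      have "\<exists>i<n. i < p i"
      proof (rule ccontr)
        assume "\<not> (\<exists>i<n. i < p i)"
        then have "p i \<le> i" if "i \<in> {..<n}" for i
          using that by (meson lessThan_iff linorder_not_less)
        then show False using permutes_natset_le[of p "{..<n}"] p by auto
      qed
      then obtain i where i: "i < n" "i < p i" by blast
      have "p i < n" using permutes_in_image[OF p(1), of i] i by simp
      then have "A i (p i) = 0" using assms i by blast
      then have "(\<Prod>i<n. A i (p i)) = 0"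
        using i by (intro prod_zero) auto
      then show "of_int (sign p) * (\<Prod>i<n. A i (p i)) = 0" by simp
    qed
  qed (auto simp: finite_permutations permutes_id)
  then show ?thesis by simp
qed

lemma leibniz_det_transpose: "leibniz_det n (\<lambda>i k. A k i) = leibniz_det n A"
proof -
  have "leibniz_det n (\<lambda>i k. A k i)
      = (\<Sum>p | p permutes {..<n}. of_int (sign (inv p)) * (\<Prod>i<n. A (inv p i) i))"
    unfolding leibniz_det_def by (rule sum_permutations_inverse)
  also have "\<dots> = leibniz_det n A"
    unfolding leibniz_det_def
  proof (intro sum.cong refl)
    fix p assume "p \<in> {p. p permutes {..<n}}"
    then have p: "p permutes {..<n}" by simp
    have "sign (inv p) = sign p"
      using p by (meson finite_lessThan permutation_permutes sign_inverse)
    moreover have "(\<Prod>i<n. A (inv p i) i) = (\<Prod>i<n. A i (p i))"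
      using prod.permute[OF p, of "\<lambda>i. A (inv p i) i"] by (simp add: permutes_inverses[OF p] o_def)
    ultimately show "of_int (sign (inv p)) * (\<Prod>i<n. A (inv p i) i)
        = of_int (sign p) * (\<Prod>i<n. A i (p i))" by simp
  qed
  finally show ?thesis .
qed

section \<open>Bases orthonormal for a quadratic form\<close>

text \<open>Unlike \<open>pos_def_on\<close>, this speaks only of the bilinear form
  \<open>x \<bullet> A y\<close> on V, so it passes to every subspace and the inductions below can
  descend.\<close>

definition pos_form :: "'b::euclidean_space set \<Rightarrow> ('b \<Rightarrow> 'b) \<Rightarrow> bool" where
  "pos_form V A \<longleftrightarrow> linear A \<and> (\<forall>x\<in>V. \<forall>y\<in>V. x \<bullet> A y = y \<bullet> A x) \<and> (\<forall>x\<in>V. x \<noteq> 0 \<longrightarrow> 0 < x \<bullet> A x)"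

text \<open>For A the identity this is an ordinary orthonormal basis. That the \<open>dim V\<close>
  vectors span V is derived in \<open>form_onb_expand\<close>.\<close>

definition form_onb :: "'b::euclidean_space set \<Rightarrow> ('b \<Rightarrow> 'b) \<Rightarrow> (nat \<Rightarrow> 'b) \<Rightarrow> bool" where
  "form_onb V A b \<longleftrightarrow> (\<forall>i<dim V. b i \<in> V) \<and>
     (\<forall>i<dim V. \<forall>k<dim V. b i \<bullet> A (b k) = (if i = k then 1 else 0))"

lemma pos_form_subset: "pos_form V A \<Longrightarrow> U \<subseteq> V \<Longrightarrow> pos_form U A"
  by (auto simp: pos_form_def)

lemma pos_form_id: "pos_form V (\<lambda>x. x)"
  by (auto simp: pos_form_def inner_commute linear_iff)

lemma pos_def_on_imp_pos_form: "pos_def_on V A \<Longrightarrow> pos_form V A"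
  unfolding pos_def_on_def pos_form_def by (metis inner_commute)

text \<open>Stated for semidefinite forms, where \<open>y \<bullet> A y\<close> may vanish: then the
  quadratic is affine in t, and a nonzero slope would make it negative. Otherwise s = c and t = - b
  give the inequality times c.\<close>

lemma form_Cauchy_Schwarz:
  fixes A :: "'b::euclidean_space \<Rightarrow> 'b"
  assumes "linear A" "x \<bullet> A y = y \<bullet> A x" and nonneg: "\<And>s t. 0 \<le> (s *\<^sub>R x + t *\<^sub>R y) \<bullet> A (s *\<^sub>R x + t *\<^sub>R y)"
  shows "(x \<bullet> A y)\<^sup>2 \<le> (x \<bullet> A x) * (y \<bullet> A y)"
proof -
  have eq: "(s *\<^sub>R x + t *\<^sub>R y) \<bullet> A (s *\<^sub>R x + t *\<^sub>R y) = s\<^sup>2 * (x \<bullet> A x) + 2 * s * t * (x \<bullet> A y) + t\<^sup>2 * (y \<bullet> A y)" for s t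
    using assms(2) by (simp add: linear_add[OF assms(1)] linear_scale[OF assms(1)] inner_add algebra_simps power2_eq_square)
  let ?a = "x \<bullet> A x" and ?b = "x \<bullet> A y" and ?c = "y \<bullet> A y"
  have Q: "0 \<le> s\<^sup>2 * ?a + 2 * s * t * ?b + t\<^sup>2 * ?c" for s t
    using nonneg[of s t] unfolding eq .
  show ?thesis
  proof (cases "?c = 0")
    case True
    have "?b = 0"
    proof (rule ccontr)
      assume b: "?b \<noteq> 0"
      have "0 \<le> ?a + 2 * (- (?a + 1) / (2 * ?b)) * ?b" using Q[of 1 "- (?a + 1) / (2 * ?b)"] True by simp
      also have "\<dots> = - 1" using b by (simp add: field_simps)
      finally show False by simp
    qed
    then show ?thesis using True by simp
  next
    case False
    then have c: "0 < ?c" using Q[of 0 1] by simp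
    have "0 \<le> ?c\<^sup>2 * ?a + 2 * ?c * (- ?b) * ?b + (- ?b)\<^sup>2 * ?c" by (rule Q)
    then have "0 \<le> ?c * (?a * ?c - ?b\<^sup>2)" by (simp add: algebra_simps power2_eq_square)
    then show ?thesis using c by (simp add: zero_le_mult_iff)
  qed
qed

lemma pos_form_nonneg: "pos_form V A \<Longrightarrow> x \<in> V \<Longrightarrow> 0 \<le> x \<bullet> A x"
  by (cases "x = 0") (auto simp: pos_form_def less_imp_le)

lemma pos_form_Cauchy_Schwarz:
  assumes "subspace V" "pos_form V A" "x \<in> V" "y \<in> V"
  shows "(x \<bullet> A y)\<^sup>2 \<le> (x \<bullet> A x) * (y \<bullet> A y)"
proof (rule form_Cauchy_Schwarz)
  show "linear A" "x \<bullet> A y = y \<bullet> A x" using assms by (auto simp: pos_form_def)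
  show "0 \<le> (s *\<^sub>R x + t *\<^sub>R y) \<bullet> A (s *\<^sub>R x + t *\<^sub>R y)" for s t
    using assms by (intro pos_form_nonneg[OF assms(2)] subspace_add subspace_scale)
qed

text \<open>The b i are independent by form-orthogonality, hence span V by their number. The
  remainder of the expansion is then form-orthogonal to all of V, in particular to itself.\<close>

lemma form_onb_expand:
  assumes V: "subspace V" and A: "pos_form V A" and b: "form_onb V A b" and x: "x \<in> V"
  shows "x = (\<Sum>i<dim V. (b i \<bullet> A x) *\<^sub>R b i)"
proof -
  let ?n = "dim V"
  have lin: "linear A" using A by (simp add: pos_form_def)
  have bV: "b i \<in> V" if "i < ?n" for i using b that by (simp add: form_onb_def)
  have bb: "b i \<bullet> A (b k) = (if i = k then 1 else 0)" if "i < ?n" "k < ?n" for i k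
    using b that by (simp add: form_onb_def)
  have sub: "subspace {z. y \<bullet> A z = 0}" for y
    by (auto simp: subspace_def linear_0[OF lin] linear_add[OF lin] linear_scale[OF lin] inner_add_right)
  have inj: "inj_on b {..<?n}"
  proof (rule inj_onI)
    fix i k assume "i \<in> {..<?n}" "k \<in> {..<?n}" "b i = b k"
    then show "i = k" using bb[of i k] bb[of i i] by (simp split: if_splits)
  qed
  have "independent (b ` {..<?n})"
    unfolding dependent_def
  proof (rule notI, elim bexE)
    fix a assume a: "a \<in> b ` {..<?n}" "a \<in> span (b ` {..<?n} - {a})"
    then obtain i where i: "i < ?n" "a = b i" by auto
    have "b ` {..<?n} - {a} \<subseteq> {z. b i \<bullet> A z = 0}"
      using bb i by auto
    then have "span (b ` {..<?n} - {a}) \<subseteq> {z. b i \<bullet> A z = 0}"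
      using sub by (rule span_minimal)
    then show False using a(2) i bb[of i i] by auto
  qed
  moreover have "card (b ` {..<?n}) = ?n" using inj by (simp add: card_image)
  ultimately have VS: "V \<subseteq> span (b ` {..<?n})"
    using bV by (intro card_ge_dim_independent) auto
  define y where "y = x - (\<Sum>i<?n. (b i \<bullet> A x) *\<^sub>R b i)"
  have yV: "y \<in> V"
    unfolding y_def using V bV x by (intro subspace_diff subspace_sum subspace_scale) auto
  have "b i \<bullet> A y = 0" if "i < ?n" for i
    using that by (simp add: y_def linear_diff[OF lin] linear_sum[OF lin] linear_scale[OF lin]
        inner_diff_right inner_sum_right bb if_distrib[of "\<lambda>u. _ * u"] cong: if_cong)
  then have "b ` {..<?n} \<subseteq> {z. z \<bullet> A y = 0}" by auto
  moreover have "subspace {z. z \<bullet> A y = 0}" by (auto simp: subspace_def inner_add_left)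
  ultimately have "span (b ` {..<?n}) \<subseteq> {z. z \<bullet> A y = 0}" by (rule span_minimal)
  then have "y \<bullet> A y = 0" using VS yV by auto
  then have "y = 0" using A yV unfolding pos_form_def by (metis less_irrefl)
  then show ?thesis by (simp add: y_def)
qed

lemma form_onb_Parseval:
  assumes V: "subspace V" and A: "pos_form V A" and b: "form_onb V A b" and "x \<in> V"
  shows "z \<bullet> x = (\<Sum>i<dim V. (b i \<bullet> A x) * (z \<bullet> b i))"
  by (subst form_onb_expand[OF assms]) (simp add: inner_sum_right)

section \<open>Simultaneous diagonalisation of two quadratic forms\<close>

lemma inverse_sqrt_mult: "0 < a \<Longrightarrow> inverse (sqrt a) * (inverse (sqrt a) * a) = 1"
  by (simp add: field_simps)

text \<open>Near t = 0 a quadratic term cannot dominate a nonzero linear one. This turns maximality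
  into orthogonality in the next lemma.\<close>

lemma linear_term_vanishes:
  fixes \<beta> c :: real
  assumes "\<And>t. 2 * t * \<beta> \<le> t\<^sup>2 * c"
  shows "\<beta> = 0"
proof (rule ccontr)
  assume \<beta>: "\<beta> \<noteq> 0"
  define K where "K = \<bar>c\<bar> + 1"
  have K: "0 < K" "c < K" unfolding K_def by auto
  have "2 * (\<beta> / K) * \<beta> \<le> (\<beta> / K)\<^sup>2 * c" by (rule assms)
  then have "2 * \<beta>\<^sup>2 * K \<le> \<beta>\<^sup>2 * c" using K by (simp add: field_simps power2_eq_square)
  then have "2 * K \<le> c" using \<beta> by (simp add: mult.assoc mult_le_cancel_left_pos)
  then show False using K by linarith
qed

text \<open>A maximiser of the Rayleigh quotient of B relative to A is the first basis vector; the
  induction continues on its A-orthogonal complement, to which it is also B-orthogonal.\<close>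

lemma simultaneous_diagonalisation_aux:
  fixes A B :: "'b::euclidean_space \<Rightarrow> 'b"
  assumes linB: "linear B"
  shows "\<lbrakk>subspace U; dim U = n; pos_form U A; \<forall>x\<in>U. \<forall>y\<in>U. x \<bullet> B y = y \<bullet> B x\<rbrakk> \<Longrightarrow>
    \<exists>b. form_onb U A b \<and> (\<forall>i<n. \<forall>k<n. i \<noteq> k \<longrightarrow> b i \<bullet> B (b k) = 0)"
proof (induction n arbitrary: U)
  case 0
  then show ?case by (simp add: form_onb_def del: dim_eq_0)
next
  case (Suc n)
  note U = Suc.prems(1)
  have linA: "linear A" and symA: "\<And>x y. x \<in> U \<Longrightarrow> y \<in> U \<Longrightarrow> x \<bullet> A y = y \<bullet> A x"
    and posA: "\<And>x. x \<in> U \<Longrightarrow> x \<noteq> 0 \<Longrightarrow> 0 < x \<bullet> A x"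
    using Suc.prems(3) unfolding pos_form_def by blast+
  have symB: "x \<bullet> B y = y \<bullet> B x" if "x \<in> U" "y \<in> U" for x y using Suc.prems(4) that by blast
  let ?S = "U \<inter> sphere 0 1"
  have "compact ?S" using U by (intro closed_Int_compact closed_subspace) auto
  moreover have "?S \<noteq> {}"
  proof -
    have "U \<noteq> {0}" using Suc.prems(2) by auto
    then obtain x where x: "x \<in> U" "x \<noteq> 0" using U subspace_0 by blast
    then have "x /\<^sub>R norm x \<in> ?S" using U by (simp add: subspace_scale)
    then show ?thesis by blast
  qed
  moreover have "continuous_on ?S (\<lambda>x. (x \<bullet> B x) / (x \<bullet> A x))"
  proof -
    have "continuous_on ?S A" "continuous_on ?S B" using linA linB by (auto intro: linear_continuous_on simp: linear_conv_bounded_linear)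
    moreover have "\<forall>x\<in>?S. x \<bullet> A x \<noteq> 0" using posA by force
    ultimately show ?thesis by (intro continuous_intros) auto
  qed
  ultimately obtain u where u: "u \<in> ?S" and "\<forall>x\<in>?S. (x \<bullet> B x) / (x \<bullet> A x) \<le> (u \<bullet> B u) / (u \<bullet> A u)"
    using continuous_attains_sup[of ?S "\<lambda>x. (x \<bullet> B x) / (x \<bullet> A x)"] by blast
  then have umax: "\<And>x. x \<in> ?S \<Longrightarrow> (x \<bullet> B x) / (x \<bullet> A x) \<le> (u \<bullet> B u) / (u \<bullet> A u)" by blast
  define \<mu> where "\<mu> = (u \<bullet> B u) / (u \<bullet> A u)"
  have uU: "u \<in> U" and uA: "0 < u \<bullet> A u" using u posA by force+
  have le: "x \<bullet> B x \<le> \<mu> * (x \<bullet> A x)" if x: "x \<in> U" for x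
  proof (cases "x = 0")
    case False
    have "x /\<^sub>R norm x \<in> ?S" using x False U by (simp add: subspace_scale)
    then have "((x /\<^sub>R norm x) \<bullet> B (x /\<^sub>R norm x)) / ((x /\<^sub>R norm x) \<bullet> A (x /\<^sub>R norm x)) \<le> \<mu>"
      using umax unfolding \<mu>_def by blast
    then have "(x \<bullet> B x) / (x \<bullet> A x) \<le> \<mu>"
      using False by (simp add: linear_scale[OF linA] linear_scale[OF linB])
    then show ?thesis using posA[OF x False] by (simp add: field_simps)
  qed (simp add: linear_0[OF linB])
  define b0 where "b0 = u /\<^sub>R sqrt (u \<bullet> A u)"
  have b0U: "b0 \<in> U" using uU U by (simp add: b0_def subspace_scale)
  have b0A: "b0 \<bullet> A b0 = 1"
  proof -
    show ?thesis
      unfolding b0_def linear_scale[OF linA] inner_scaleR_left inner_scaleR_right using inverse_sqrt_mult[OF uA] by simp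
  qed
  have b0B: "b0 \<bullet> B b0 = \<mu>"
  proof -
    have "b0 \<bullet> B b0 = (inverse (sqrt (u \<bullet> A u)) * (inverse (sqrt (u \<bullet> A u)) * (u \<bullet> A u))) * \<mu>"
      unfolding b0_def linear_scale[OF linB] inner_scaleR_left inner_scaleR_right \<mu>_def using uA by (simp add: field_simps)
    then show ?thesis unfolding inverse_sqrt_mult[OF uA] by simp
  qed
  \<comment> \<open>\<open>b0 + t *\<^sub>R y\<close> competes for the maximum \<mu> with A-value
    \<open>1 + t\<^sup>2 * (y \<bullet> A y)\<close>, so the term of first order in t must
    vanish.\<close>
  have orthB: "b0 \<bullet> B y = 0" if y: "y \<in> U" "b0 \<bullet> A y = 0" for y
  proof (rule linear_term_vanishes)
    fix t
    have "b0 + t *\<^sub>R y \<in> U" using b0U y U by (simp add: subspace_add subspace_scale)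
    from le[OF this] show "2 * t * (b0 \<bullet> B y) \<le> t\<^sup>2 * (\<mu> * (y \<bullet> A y) - y \<bullet> B y)"
      using symA[OF y(1) b0U] symB[OF y(1) b0U] y(2) b0A b0B
      by (simp add: linear_add[OF linA] linear_scale[OF linA] linear_add[OF linB] linear_scale[OF linB]
          inner_add algebra_simps power2_eq_square)
  qed
  define U' where "U' = {x \<in> U. b0 \<bullet> A x = 0}"
  have U': "subspace U'"
    using U by (auto simp: U'_def subspace_def linear_0[OF linA] linear_add[OF linA] linear_scale[OF linA] inner_add_right)
  have "U' \<subseteq> U" by (auto simp: U'_def)
  have "span (insert b0 U') = U"
  proof
    show "span (insert b0 U') \<subseteq> U" using b0U U \<open>U' \<subseteq> U\<close> by (intro span_minimal) auto
    show "U \<subseteq> span (insert b0 U')"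
    proof
      fix x assume x: "x \<in> U"
      have "x - (b0 \<bullet> A x) *\<^sub>R b0 \<in> U'"
        using x b0U U b0A by (simp add: U'_def subspace_diff subspace_scale linear_diff[OF linA] linear_scale[OF linA] inner_diff_right)
      then show "x \<in> span (insert b0 U')" using span_base span_breakdown_eq by blast
    qed
  qed
  moreover have "b0 \<notin> span U'" unfolding span_eq_iff[THEN iffD2, OF U'] using b0A by (simp add: U'_def)
  ultimately have "dim U = Suc (dim U')" by (metis dim_insert dim_span Suc_eq_plus1)
  then have dimU': "dim U' = n" using Suc.prems(2) by simp
  obtain b where b: "form_onb U' A b" and bB: "\<forall>i<n. \<forall>k<n. i \<noteq> k \<longrightarrow> b i \<bullet> B (b k) = 0"
    using Suc.IH[OF U' dimU' pos_form_subset[OF Suc.prems(3) \<open>U' \<subseteq> U\<close>]] Suc.prems(4) \<open>U' \<subseteq> U\<close> by blast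
  have bU': "b i \<in> U'" if "i < n" for i using b that dimU' by (simp add: form_onb_def)
  define c where "c = case_nat b0 b"
  have c0: "c 0 = b0" "\<And>i. c (Suc i) = b i" by (simp_all add: c_def)
  have "form_onb U A c"
    unfolding form_onb_def Suc.prems(2)
  proof (intro conjI allI impI)
    fix i assume i: "i < Suc n"
    show "c i \<in> U" using i b0U bU' \<open>U' \<subseteq> U\<close> by (cases i) (auto simp: c0)
    fix k assume k: "k < Suc n"
    show "c i \<bullet> A (c k) = (if i = k then 1 else 0)"
      using i k b b0A bU' symA[OF b0U] dimU'
      by (cases i; cases k) (auto simp: c0 form_onb_def U'_def)
  qed
  moreover have "\<forall>i<Suc n. \<forall>k<Suc n. i \<noteq> k \<longrightarrow> c i \<bullet> B (c k) = 0"
  proof (intro allI impI)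
    fix i k assume "i < Suc n" "k < Suc n" "i \<noteq> k"
    then show "c i \<bullet> B (c k) = 0"
      using bB bU' orthB symB[OF b0U] by (cases i; cases k) (auto simp: c0 U'_def)
  qed
  ultimately show ?case by blast
qed

lemma simultaneous_diagonalisation:
  fixes A B :: "'b::euclidean_space \<Rightarrow> 'b"
  assumes "subspace V" "pos_form V A" "linear B" "\<And>x y. x \<in> V \<Longrightarrow> y \<in> V \<Longrightarrow> x \<bullet> B y = y \<bullet> B x"
  obtains b where "form_onb V A b" "\<And>i k. i < dim V \<Longrightarrow> k < dim V \<Longrightarrow> i \<noteq> k \<Longrightarrow> b i \<bullet> B (b k) = 0"
proof -
  have "\<forall>x\<in>V. \<forall>y\<in>V. x \<bullet> B y = y \<bullet> B x" using assms(4) by blast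
  from simultaneous_diagonalisation_aux[OF assms(3,1) refl assms(2) this] that show thesis by blast
qed

text \<open>Both sides are the trace of B relative to the form A. The optimality conditions are such
  traces, computed in a basis diagonalising the direction and used in another.\<close>

lemma form_onb_trace:
  assumes V: "subspace V" and A: "pos_form V A" and b: "form_onb V A b" and c: "form_onb V A c"
    and B: "linear B"
  shows "(\<Sum>i<dim V. b i \<bullet> B (b i)) = (\<Sum>i<dim V. c i \<bullet> B (c i))"
proof -
  have sym: "x \<bullet> A y = y \<bullet> A x" if "x \<in> V" "y \<in> V" for x y using A that by (simp add: pos_form_def)
  have bV: "i < dim V \<Longrightarrow> b i \<in> V" and cV: "i < dim V \<Longrightarrow> c i \<in> V" for i
    using b c by (auto simp: form_onb_def)
  have "(\<Sum>i<dim V. b i \<bullet> B (b i)) = (\<Sum>i<dim V. \<Sum>k<dim V. (c k \<bullet> A (b i)) * (b i \<bullet> B (c k)))"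
  proof (rule sum.cong)
    fix i assume i: "i \<in> {..<dim V}"
    have "b i = (\<Sum>k<dim V. (c k \<bullet> A (b i)) *\<^sub>R c k)"
      using i bV by (intro form_onb_expand[OF V A c]) auto
    from arg_cong[OF this, of B]
    have "B (b i) = (\<Sum>k<dim V. (c k \<bullet> A (b i)) *\<^sub>R B (c k))"
      by (simp add: linear_sum[OF B] linear_scale[OF B])
    then show "b i \<bullet> B (b i) = (\<Sum>k<dim V. (c k \<bullet> A (b i)) * (b i \<bullet> B (c k)))"
      by (simp add: inner_sum_right)
  qed simp
  also have "\<dots> = (\<Sum>k<dim V. \<Sum>i<dim V. (b i \<bullet> A (c k)) * (B (c k) \<bullet> b i))"
    by (subst sum.swap) (auto intro!: sum.cong simp: sym bV cV inner_commute)
  also have "\<dots> = (\<Sum>k<dim V. c k \<bullet> B (c k))"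
  proof (rule sum.cong)
    fix k assume "k \<in> {..<dim V}"
    then have "c k \<in> V" using cV by simp
    from form_onb_Parseval[OF V A b this, of "B (c k)"]
    show "(\<Sum>i<dim V. (b i \<bullet> A (c k)) * (B (c k) \<bullet> b i)) = c k \<bullet> B (c k)"
      by (simp only: inner_commute)
  qed simp
  finally show ?thesis .
qed

text \<open>With C the matrix of the \<open>h i \<bullet> g k\<close>, the matrix of R in h is C G
  C^T, where G is its matrix in g.\<close>

lemma leibniz_det_gram:
  assumes V: "subspace V" and g: "form_onb V (\<lambda>x. x) g"
    and h: "\<And>i. i < dim V \<Longrightarrow> h i \<in> V" and R: "linear R"
  shows "leibniz_det (dim V) (\<lambda>i k. h i \<bullet> R (h k))
    = (leibniz_det (dim V) (\<lambda>i k. h i \<bullet> g k))\<^sup>2 * leibniz_det (dim V) (\<lambda>i k. g i \<bullet> R (g k))"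
proof -
  let ?n = "dim V"
  note ex = form_onb_expand[OF V pos_form_id g]
  have "leibniz_det ?n (\<lambda>i k. h i \<bullet> R (h k)) =
      leibniz_det ?n (\<lambda>i k. \<Sum>a<?n. (h i \<bullet> g a) * (\<Sum>c<?n. (g a \<bullet> R (g c)) * (h k \<bullet> g c)))"
  proof (rule leibniz_det_cong)
    fix i k assume ik: "i < ?n" "k < ?n"
    have "R (h k) = (\<Sum>c<?n. (g c \<bullet> h k) *\<^sub>R R (g c))"
      using arg_cong[OF ex[OF h[OF ik(2)]], of R] by (simp add: linear_sum[OF R] linear_scale[OF R])
    then have *: "y \<bullet> R (h k) = (\<Sum>c<?n. (y \<bullet> R (g c)) * (h k \<bullet> g c))" for y
      by (simp add: inner_sum_right inner_commute mult.commute)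
    have "h i \<bullet> R (h k) = (\<Sum>a<?n. (h i \<bullet> g a) * (g a \<bullet> R (h k)))"
      using form_onb_Parseval[OF V pos_form_id g h[OF ik(1)], of "R (h k)"]
      by (simp add: inner_commute)
    then show "h i \<bullet> R (h k) = (\<Sum>a<?n. (h i \<bullet> g a) * (\<Sum>c<?n. (g a \<bullet> R (g c)) * (h k \<bullet> g c)))"
      by (simp add: *)
  qed
  then show ?thesis
    using leibniz_det_transpose[of ?n "\<lambda>i k. h i \<bullet> g k"]
    by (simp add: leibniz_det_mult power2_eq_square)
qed

lemma leibniz_det_diag:
  assumes "\<And>i k. i < n \<Longrightarrow> k < n \<Longrightarrow> i \<noteq> k \<Longrightarrow> A i k = 0"
  shows "leibniz_det n A = (\<Prod>i<n. A i i)"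
  using assms by (intro leibniz_det_lower_triangular) auto

text \<open>An enumeration of \<open>onb V\<close> transports permutations of the indices to
  permutations of the basis vectors without changing the sign.\<close>

lemma det_on_eq_leibniz_det:
  assumes V: "subspace V"
  obtains g where "form_onb V (\<lambda>x. x) g" "\<And>R. det_on V R = leibniz_det (dim V) (\<lambda>i k. g i \<bullet> R (g k))"
proof -
  let ?B = "onb V" and ?n = "dim V"
  have B: "?B \<subseteq> V" "pairwise orthogonal ?B" "\<And>b. b \<in> ?B \<Longrightarrow> norm b = 1" "span ?B = V"
    using is_onb_onb[OF V] by (auto simp: is_onb_def)
  have ind: "independent ?B"
    using B(2) B(3)[of 0] by (intro pairwise_orthogonal_independent) auto
  then have fin: "finite ?B" by (rule finiteI_independent)
  have card: "card ?B = ?n" using ind B(4) dim_eq_card_independent dim_span by metis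
  obtain g where "bij_betw g {0..<?n} ?B" using ex_bij_betw_nat_finite[OF fin] card by auto
  then have g: "bij_betw g {..<?n} ?B" by (simp add: atLeast0LessThan)
  have inj: "inj_on g {..<?n}" and im: "g ` {..<?n} = ?B" using g by (auto simp: bij_betw_def)
  have onb: "form_onb V (\<lambda>x. x) g"
    unfolding form_onb_def
  proof (intro conjI allI impI)
    fix i assume i: "i < ?n"
    then have gi: "g i \<in> ?B" using im by auto
    then show "g i \<in> V" using B by auto
    fix k assume k: "k < ?n"
    then have gk: "g k \<in> ?B" using im by auto
    show "g i \<bullet> g k = (if i = k then 1 else 0)"
    proof (cases "i = k")
      case True then show ?thesis using B(3)[OF gi] by (simp add: norm_eq_1)
    next
      case False
      then have "g i \<noteq> g k" using inj i k by (auto simp: inj_on_def)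
      then show ?thesis using False B(2) gi gk by (auto simp: pairwise_def orthogonal_def)
    qed
  qed
  moreover have "det_on V R = leibniz_det ?n (\<lambda>i k. g i \<bullet> R (g k))" for R
  proof -
    define f where "f = inv_into {..<?n} g"
    have f: "bij_betw f ?B {..<?n}" unfolding f_def by (rule bij_betw_inv_into[OF g])
    have fg: "f (g i) = i" if "i < ?n" for i using inj that by (simp add: f_def)
    have gf: "g (f b) = b" if "b \<in> ?B" for b using that im by (simp add: f_def f_inv_into_f)
    have "leibniz_det ?n (\<lambda>i k. g i \<bullet> R (g k)) = det_on V R"
      unfolding leibniz_det_def det_on_def
    proof (rule sum.reindex_bij_witness[where j = "map_permutation {..<?n} g" and i = "map_permutation ?B f"])
      fix p assume "p \<in> {p. p permutes {..<?n}}"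
      then have p: "p permutes {..<?n}" by simp
      show "map_permutation ?B f (map_permutation {..<?n} g p) = p"
        by (rule map_permutation_compose_inv[OF g p]) (simp add: fg)
      show "map_permutation {..<?n} g p \<in> {p. p permutes ?B}"
        using map_permutation_permutes[OF g p] by simp
      have "(\<Prod>b\<in>?B. b \<bullet> R (map_permutation {..<?n} g p b)) = (\<Prod>i<?n. g i \<bullet> R (map_permutation {..<?n} g p (g i)))"
        using prod.reindex_bij_betw[OF g, of "\<lambda>b. b \<bullet> R (map_permutation {..<?n} g p b)"] by simp
      also have "\<dots> = (\<Prod>i<?n. g i \<bullet> R (g (p i)))"
        by (intro prod.cong) (auto simp: map_permutation_apply[OF inj])
      finally show "of_int (sign (map_permutation {..<?n} g p)) * (\<Prod>b\<in>?B. b \<bullet> R (map_permutation {..<?n} g p b))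
          = of_int (sign p) * (\<Prod>i<?n. g i \<bullet> R (g (p i)))"
        using sign_map_permutation[OF inj p] by simp
    next
      fix p assume "p \<in> {p. p permutes ?B}"
      then have p: "p permutes ?B" by simp
      show "map_permutation {..<?n} g (map_permutation ?B f p) = p"
        by (rule map_permutation_compose_inv[OF f p]) (simp add: gf)
      show "map_permutation ?B f p \<in> {p. p permutes {..<?n}}"
        using map_permutation_permutes[OF f p] by simp
    qed
    then show ?thesis by simp
  qed
  ultimately show ?thesis using that by blast
qed

text \<open>The transition matrix between two orthonormal bases has squared determinant 1, so the
  arbitrary choice in \<open>onb\<close> is immaterial.\<close>

lemma det_on_onb:
  assumes V: "subspace V" and g: "form_onb V (\<lambda>x. x) g" and R: "linear R"
  shows "det_on V R = leibniz_det (dim V) (\<lambda>i k. g i \<bullet> R (g k))"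
proof -
  obtain g' where g': "form_onb V (\<lambda>x. x) g'"
    and d: "\<And>R. det_on V R = leibniz_det (dim V) (\<lambda>i k. g' i \<bullet> R (g' k))"
    using det_on_eq_leibniz_det[OF V] by blast
  have gV: "i < dim V \<Longrightarrow> g i \<in> V" for i using g by (simp add: form_onb_def)
  have one: "leibniz_det (dim V) (\<lambda>i k. f i \<bullet> f k) = 1" if "form_onb V (\<lambda>x. x) f" for f
    using that by (subst leibniz_det_diag) (auto simp: form_onb_def)
  have "(leibniz_det (dim V) (\<lambda>i k. g i \<bullet> g' k))\<^sup>2 = 1"
    using leibniz_det_gram[where h = g, OF V g' gV linear_id[unfolded id_def]] one[OF g] one[OF g'] by simp
  then show ?thesis using leibniz_det_gram[where h = g, OF V g' gV R] d[of R] by simp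
qed

lemma det_on_id: assumes "subspace V" shows "det_on V (\<lambda>x. x) = 1"
proof -
  obtain g where g: "form_onb V (\<lambda>x. x) g" using det_on_eq_leibniz_det[OF assms] by blast
  show ?thesis
    using g by (subst det_on_onb[OF assms g linear_id[unfolded id_def]], subst leibniz_det_diag) (auto simp: form_onb_def)
qed

text \<open>In b the matrices of A and R have determinants 1 and the product of the diagonal
  entries. Both differ from the values in an orthonormal basis by the same square, which
  cancels.\<close>

lemma det_on_diag:
  assumes V: "subspace V" and b: "form_onb V A b" and A: "linear A" and R: "linear R"
    and diag: "\<And>i k. i < dim V \<Longrightarrow> k < dim V \<Longrightarrow> i \<noteq> k \<Longrightarrow> b i \<bullet> R (b k) = 0"
  shows "det_on V R = (\<Prod>i<dim V. b i \<bullet> R (b i)) * det_on V A"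
proof -
  obtain g where g: "form_onb V (\<lambda>x. x) g" using det_on_eq_leibniz_det[OF V] by blast
  have bV: "i < dim V \<Longrightarrow> b i \<in> V" for i using b by (simp add: form_onb_def)
  let ?c = "leibniz_det (dim V) (\<lambda>i k. b i \<bullet> g k)"
  have "1 = leibniz_det (dim V) (\<lambda>i k. b i \<bullet> A (b k))"
    using b by (subst leibniz_det_diag) (auto simp: form_onb_def)
  then have "?c\<^sup>2 * det_on V A = 1"
    using leibniz_det_gram[where h = b, OF V g bV A] det_on_onb[OF V g A] by simp
  have "leibniz_det (dim V) (\<lambda>i k. b i \<bullet> R (b k)) = (\<Prod>i<dim V. b i \<bullet> R (b i))"
    by (intro leibniz_det_diag diag)
  moreover have "leibniz_det (dim V) (\<lambda>i k. b i \<bullet> R (b k)) = ?c\<^sup>2 * det_on V R"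
    unfolding det_on_onb[OF V g R] by (rule leibniz_det_gram[OF V g bV R])
  ultimately have "(\<Prod>i<dim V. b i \<bullet> R (b i)) * det_on V A = (?c\<^sup>2 * det_on V A) * det_on V R"
    by simp
  then show ?thesis using \<open>?c\<^sup>2 * det_on V A = 1\<close> by simp
qed

text \<open>In a diagonalising orthonormal basis the determinant is a product of nonnegative
  entries. A nonzero determinant thus recognises definiteness, which is how the maximiser is shown
  to be nondegenerate.\<close>

lemma det_on_semidefinite:
  assumes V: "subspace V" and R: "linear R" and sym: "\<And>x y. x \<in> V \<Longrightarrow> y \<in> V \<Longrightarrow> x \<bullet> R y = y \<bullet> R x"
    and nn: "\<And>x. x \<in> V \<Longrightarrow> 0 \<le> x \<bullet> R x"
  shows "0 \<le> det_on V R"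
    and "0 < det_on V R \<Longrightarrow> pos_form V R"
    and "pos_form V R \<Longrightarrow> 0 < det_on V R"
proof -
  obtain b where b: "form_onb V (\<lambda>x. x) b"
    and diag: "\<And>i k. i < dim V \<Longrightarrow> k < dim V \<Longrightarrow> i \<noteq> k \<Longrightarrow> b i \<bullet> R (b k) = 0"
    using simultaneous_diagonalisation[OF V pos_form_id R sym] by blast
  have det: "det_on V R = (\<Prod>i<dim V. b i \<bullet> R (b i))"
    using det_on_diag[OF V b linear_id[unfolded id_def] R diag] det_on_id[OF V] by simp
  have bV: "i < dim V \<Longrightarrow> b i \<in> V" for i using b by (simp add: form_onb_def)
  show "0 \<le> det_on V R" unfolding det using bV nn by (auto intro!: prod_nonneg)
  show "0 < det_on V R" if "pos_form V R"
  proof -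
    have "0 < b i \<bullet> R (b i)" if "i < dim V" for i
    proof -
      have "b i \<noteq> 0" using b that by (force simp: form_onb_def)
      then show ?thesis using \<open>pos_form V R\<close> bV[OF that] by (simp add: pos_form_def)
    qed
    then show ?thesis unfolding det by (auto intro!: prod_pos)
  qed
  show "pos_form V R" if pos: "0 < det_on V R"
    unfolding pos_form_def
  proof (intro conjI ballI impI R sym)
    fix x assume x: "x \<in> V" "x \<noteq> 0"
    have bp: "0 < b i \<bullet> R (b i)" if "i < dim V" for i
    proof -
      have "b i \<bullet> R (b i) \<noteq> 0" using pos that unfolding det by (metis finite_lessThan lessThan_iff less_irrefl prod_zero)
      then show ?thesis using nn[OF bV[OF that]] by simp
    qed
    have ex: "x = (\<Sum>i<dim V. (b i \<bullet> x) *\<^sub>R b i)" by (rule form_onb_expand[OF V pos_form_id b x(1)])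
    have "R x = (\<Sum>k<dim V. (b k \<bullet> x) *\<^sub>R R (b k))"
      by (subst (1) ex) (simp add: linear_sum[OF R] linear_scale[OF R])
    then have "x \<bullet> R x = (\<Sum>k<dim V. (b k \<bullet> x) * (x \<bullet> R (b k)))" by (simp add: inner_sum_right)
    also have "\<dots> = (\<Sum>k<dim V. (b k \<bullet> x)\<^sup>2 * (b k \<bullet> R (b k)))"
    proof (rule sum.cong)
      fix k assume k: "k \<in> {..<dim V}"
      have "x \<bullet> R (b k) = (\<Sum>i<dim V. (b i \<bullet> x) * (b i \<bullet> R (b k)))"
        by (subst (1) ex) (simp add: inner_sum_left)
      also have "\<dots> = (\<Sum>i<dim V. if i = k then (b k \<bullet> x) * (b k \<bullet> R (b k)) else 0)"
        using k diag by (intro sum.cong) auto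
      finally show "(b k \<bullet> x) * (x \<bullet> R (b k)) = (b k \<bullet> x)\<^sup>2 * (b k \<bullet> R (b k))"
        using k by (simp add: power2_eq_square)
    qed simp
    finally have eq: "x \<bullet> R x = (\<Sum>k<dim V. (b k \<bullet> x)\<^sup>2 * (b k \<bullet> R (b k)))" .
    have "\<exists>k<dim V. b k \<bullet> x \<noteq> 0"
    proof (rule ccontr)
      assume "\<not> (\<exists>k<dim V. b k \<bullet> x \<noteq> 0)"
      then have "(\<Sum>i<dim V. (b i \<bullet> x) *\<^sub>R b i) = 0" by (intro sum.neutral) auto
      then show False using ex x(2) by simp
    qed
    then obtain k where k: "k < dim V" "b k \<bullet> x \<noteq> 0" by blast
    show "0 < x \<bullet> R x" unfolding eq
      using k bp by (intro sum_pos2[of _ k]) (simp_all add: less_imp_le)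
  qed
qed

section \<open>Gram-Schmidt orthogonalisation and Hadamard's inequality\<close>

lemma gram_schmidt_step:
  assumes V: "subspace V" and A: "pos_form V A" and S: "subspace S" "S \<subseteq> V" and w: "w \<in> V" "w \<notin> S"
  shows "\<exists>h. h \<in> V \<and> h \<in> span (insert w S) \<and> h \<bullet> A h = 1 \<and> (\<forall>x\<in>S. h \<bullet> A x = 0) \<and> w - (h \<bullet> A w) *\<^sub>R h \<in> S"
proof -
  have lin: "linear A" and sym: "\<And>x y. x \<in> V \<Longrightarrow> y \<in> V \<Longrightarrow> x \<bullet> A y = y \<bullet> A x"
    using A by (auto simp: pos_form_def)
  have AS: "pos_form S A" using pos_form_subset[OF A S(2)] .
  obtain c where c: "form_onb S A c"
    using simultaneous_diagonalisation[OF S(1) AS lin] AS by (metis pos_form_def)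
  have cS: "i < dim S \<Longrightarrow> c i \<in> S" for i using c by (simp add: form_onb_def)
  define p where "p = (\<Sum>k<dim S. (c k \<bullet> A w) *\<^sub>R c k)"
  define u where "u = w - p"
  have pS: "p \<in> S" unfolding p_def using S(1) cS by (intro subspace_sum subspace_scale) auto
  have uV: "u \<in> V" unfolding u_def using V w pS S by (intro subspace_diff) auto
  have "u \<noteq> 0" using w pS by (auto simp: u_def)
  then have uu: "0 < u \<bullet> A u" using A uV by (simp add: pos_form_def)
  have cu: "c i \<bullet> A u = 0" if "i < dim S" for i
    using that c by (simp add: u_def p_def linear_diff[OF lin] linear_sum[OF lin] linear_scale[OF lin]
        inner_diff_right inner_sum_right form_onb_def if_distrib[of "\<lambda>u. _ * u"] cong: if_cong)
  have xu: "u \<bullet> A x = 0" if x: "x \<in> S" for x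
  proof -
    have "x \<bullet> A u = (\<Sum>i<dim S. (c i \<bullet> A x) * (c i \<bullet> A u))"
      using form_onb_Parseval[OF S(1) AS c x, of "A u"] by (simp add: inner_commute)
    then show ?thesis using cu sym[OF uV] x S(2) by auto
  qed
  define h where "h = u /\<^sub>R sqrt (u \<bullet> A u)"
  have uAw: "u \<bullet> A w = u \<bullet> A u"
    using xu[OF pS] by (simp add: u_def linear_diff[OF lin] inner_diff_right inner_diff_left)
  have hh: "(h \<bullet> A w) *\<^sub>R h = u"
  proof -
    have "(h \<bullet> A w) *\<^sub>R h = (inverse (sqrt (u \<bullet> A u)) * (inverse (sqrt (u \<bullet> A u)) * (u \<bullet> A u))) *\<^sub>R u"
      unfolding h_def inner_scaleR_left scaleR_scaleR uAw by (simp only: ac_simps)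
    then show ?thesis unfolding inverse_sqrt_mult[OF uu] by simp
  qed
  show ?thesis
  proof (intro exI[of _ h] conjI ballI)
    show "h \<in> V" using uV V by (simp add: h_def subspace_scale)
    have "u \<in> span (insert w S)" unfolding u_def using pS by (intro span_diff) (auto intro: span_base)
    then show "h \<in> span (insert w S)" by (simp add: h_def span_scale)
    show "h \<bullet> A h = 1"
      unfolding h_def linear_scale[OF lin] inner_scaleR_left inner_scaleR_right using inverse_sqrt_mult[OF uu] by simp
    show "h \<bullet> A x = 0" if "x \<in> S" for x using xu[OF that] by (simp add: h_def)
    show "w - (h \<bullet> A w) *\<^sub>R h \<in> S" using hh pS by (simp add: u_def)
  qed
qed

lemma gram_schmidt:
  assumes V: "subspace V" and A: "pos_form V A" and w: "\<And>i. i < dim V \<Longrightarrow> w i \<in> V"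
    "\<And>i. i < dim V \<Longrightarrow> w i \<notin> span (w ` {..<i})"
  shows "\<exists>h. form_onb V A h \<and> (\<forall>i<dim V. h i \<in> span (w ` {..i}) \<and>
    (\<forall>x\<in>span (w ` {..<i}). h i \<bullet> A x = 0) \<and> w i - (h i \<bullet> A (w i)) *\<^sub>R h i \<in> span (w ` {..<i}))"
proof -
  have "\<forall>i\<in>{..<dim V}. \<exists>h. h \<in> V \<and> h \<in> span (w ` {..i}) \<and> h \<bullet> A h = 1 \<and> (\<forall>x\<in>span (w ` {..<i}). h \<bullet> A x = 0)
      \<and> w i - (h \<bullet> A (w i)) *\<^sub>R h \<in> span (w ` {..<i})"
  proof
    fix i assume "i \<in> {..<dim V}"
    then have i: "i < dim V" by simp
    have sub: "span (w ` {..<i}) \<subseteq> V" using V w(1) i by (intro span_minimal) auto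
    have "w i \<in> span (w ` {..i})" by (intro span_base) auto
    moreover have "span (w ` {..<i}) \<subseteq> span (w ` {..i})" by (intro span_mono) auto
    ultimately have sub': "span (insert (w i) (span (w ` {..<i}))) \<subseteq> span (w ` {..i})"
      by (intro span_minimal) auto
    have "\<exists>h. h \<in> V \<and> h \<in> span (insert (w i) (span (w ` {..<i}))) \<and> h \<bullet> A h = 1 \<and>
        (\<forall>x\<in>span (w ` {..<i}). h \<bullet> A x = 0) \<and> w i - (h \<bullet> A (w i)) *\<^sub>R h \<in> span (w ` {..<i})"
      using w i by (intro gram_schmidt_step[OF V A subspace_span sub]) auto
    then obtain h where h: "h \<in> V" "h \<in> span (insert (w i) (span (w ` {..<i})))" "h \<bullet> A h = 1"
        "\<forall>x\<in>span (w ` {..<i}). h \<bullet> A x = 0" "w i - (h \<bullet> A (w i)) *\<^sub>R h \<in> span (w ` {..<i})"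
      by (elim exE conjE) (rule that)
    have "h \<in> span (w ` {..i})" using h(2) sub' by (rule subsetD[rotated])
    with h show "\<exists>h. h \<in> V \<and> h \<in> span (w ` {..i}) \<and> h \<bullet> A h = 1 \<and> (\<forall>x\<in>span (w ` {..<i}). h \<bullet> A x = 0)
      \<and> w i - (h \<bullet> A (w i)) *\<^sub>R h \<in> span (w ` {..<i})"
      by (intro exI[of _ h] conjI)
  qed
  from bchoice[OF this] obtain h where h: "\<forall>i\<in>{..<dim V}. h i \<in> V \<and> h i \<in> span (w ` {..i}) \<and> h i \<bullet> A (h i) = 1
      \<and> (\<forall>x\<in>span (w ` {..<i}). h i \<bullet> A x = 0) \<and> w i - (h i \<bullet> A (w i)) *\<^sub>R h i \<in> span (w ` {..<i})" ..
  have lt: "h i \<bullet> A (h k) = 0" if "k < i" "i < dim V" for i k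
  proof -
    have "h k \<in> span (w ` {..k})" using h that by simp
    moreover have "span (w ` {..k}) \<subseteq> span (w ` {..<i})" using that by (intro span_mono) auto
    ultimately show ?thesis using h that by blast
  qed
  have sym: "h i \<bullet> A (h k) = h k \<bullet> A (h i)" if "i < dim V" "k < dim V" for i k
    using A h that by (simp add: pos_form_def)
  have "form_onb V A h"
    unfolding form_onb_def
  proof (intro conjI allI impI)
    fix i k assume ik: "i < dim V" "k < dim V"
    show "h i \<bullet> A (h k) = (if i = k then 1 else 0)"
    proof (cases i k rule: linorder_cases)
      case less then show ?thesis using lt[of i k] ik sym[of i k] by simp
    next
      case equal then show ?thesis using h ik by simp
    next
      case greater then show ?thesis using lt[of k i] ik by simp
    qed
  qed (use h in auto)
  then show ?thesis using h by (intro exI[of _ h]) simp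
qed

text \<open>The same vectors are orthogonalised twice, to h for the form A and to g for the inner
  product. The transition matrix between h and g is triangular, so \<open>det_on V A\<close> is the
  inverse of the product of the \<open>(h i \<bullet> g i)\<^sup>2\<close>, while
  \<open>\<bar>g i \<bullet> w i\<bar>\<close> is the distance of \<open>w i\<close> from the
  earlier span.\<close>

lemma det_on_le_prod:
  assumes V: "subspace V" and A: "pos_form V A" and w: "\<And>i. i < dim V \<Longrightarrow> w i \<in> V"
    and \<delta>: "0 < \<delta>" and dist: "\<And>i u. i < dim V \<Longrightarrow> u \<in> span (w ` {..<i}) \<Longrightarrow> \<delta> \<le> norm (w i - u)"
  shows "\<delta> ^ (2 * dim V) * det_on V A \<le> (\<Prod>i<dim V. w i \<bullet> A (w i))"
proof -
  let ?n = "dim V"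
  have lin: "linear A" using A by (simp add: pos_form_def)
  have w2: "w i \<notin> span (w ` {..<i})" if "i < ?n" for i using dist[OF that, of "w i"] \<delta> by auto
  obtain h where h: "form_onb V A h" and "\<forall>i<?n. h i \<in> span (w ` {..i}) \<and> w i - (h i \<bullet> A (w i)) *\<^sub>R h i \<in> span (w ` {..<i})"
    using gram_schmidt[where w = w, OF V A w w2] by blast
  then have h1: "\<And>i. i < ?n \<Longrightarrow> h i \<in> span (w ` {..i})"
    and h3: "\<And>i. i < ?n \<Longrightarrow> w i - (h i \<bullet> A (w i)) *\<^sub>R h i \<in> span (w ` {..<i})" by blast+
  obtain g where g: "form_onb V (\<lambda>x. x) g"
    and "\<forall>i<?n. (\<forall>x\<in>span (w ` {..<i}). g i \<bullet> x = 0) \<and> w i - (g i \<bullet> w i) *\<^sub>R g i \<in> span (w ` {..<i})"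
    using gram_schmidt[where w = w, OF V pos_form_id w w2] by blast
  then have g2: "\<And>i x. i < ?n \<Longrightarrow> x \<in> span (w ` {..<i}) \<Longrightarrow> g i \<bullet> x = 0"
    and g3: "\<And>i. i < ?n \<Longrightarrow> w i - (g i \<bullet> w i) *\<^sub>R g i \<in> span (w ` {..<i})" by blast+
  have hV: "i < ?n \<Longrightarrow> h i \<in> V" for i using h by (simp add: form_onb_def)
  have "h i \<bullet> g k = 0" if "i < k" "k < ?n" for i k
  proof -
    have "span (w ` {..i}) \<subseteq> span (w ` {..<k})" using that by (intro span_mono) auto
    moreover have "h i \<in> span (w ` {..i})" using h1 that by simp
    ultimately have "g k \<bullet> h i = 0" by (intro g2[OF that(2)]) (rule subsetD)
    then show ?thesis by (simp add: inner_commute)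
  qed
  then have tri: "leibniz_det ?n (\<lambda>i k. h i \<bullet> g k) = (\<Prod>i<?n. h i \<bullet> g i)"
    by (rule leibniz_det_lower_triangular)
  have "leibniz_det ?n (\<lambda>i k. h i \<bullet> A (h k)) = 1"
    using h by (subst leibniz_det_diag) (auto simp: form_onb_def)
  then have one: "(\<Prod>i<?n. (h i \<bullet> g i)\<^sup>2) * det_on V A = 1"
    using leibniz_det_gram[where h = h, OF V g hV lin] det_on_onb[OF V g lin] tri by (simp add: prod_power_distrib)
  have dp: "0 < det_on V A"
    using det_on_semidefinite(3)[OF V lin] A pos_form_nonneg[OF A] by (simp add: pos_form_def)
  have "\<delta>\<^sup>2 \<le> (w i \<bullet> A (w i)) * (h i \<bullet> g i)\<^sup>2" if i: "i < ?n" for i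
  proof -
    have gg: "g i \<bullet> g i = 1" using g i by (simp add: form_onb_def)
    then have "norm (g i) = 1" by (simp add: norm_eq_1)
    have "\<delta> \<le> norm (w i - (w i - (g i \<bullet> w i) *\<^sub>R g i))" by (rule dist[OF i g3[OF i]])
    then have "\<delta> \<le> \<bar>g i \<bullet> w i\<bar>" using \<open>norm (g i) = 1\<close> by simp
    \<comment> \<open>\<open>w i\<close> minus its \<open>h i\<close> component lies in the span of
      the earlier vectors, to which \<open>g i\<close> is orthogonal.\<close>
    moreover have "g i \<bullet> w i = (h i \<bullet> A (w i)) * (h i \<bullet> g i)"
      using g2[OF i h3[OF i]] by (simp add: inner_diff_right inner_commute)
    ultimately have "\<delta>\<^sup>2 \<le> ((h i \<bullet> A (w i)) * (h i \<bullet> g i))\<^sup>2"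
      using \<delta> by (metis abs_le_square_iff abs_of_pos)
    also have "\<dots> = (h i \<bullet> A (w i))\<^sup>2 * (h i \<bullet> g i)\<^sup>2" by (simp add: power_mult_distrib)
    also have "\<dots> \<le> (w i \<bullet> A (w i)) * (h i \<bullet> g i)\<^sup>2"
    proof (rule mult_right_mono)
      show "(h i \<bullet> A (w i))\<^sup>2 \<le> w i \<bullet> A (w i)"
        using pos_form_Cauchy_Schwarz[OF V A hV[OF i] w[OF i]] h i by (simp add: form_onb_def)
    qed simp
    finally show ?thesis .
  qed
  then have "(\<Prod>i<?n. \<delta>\<^sup>2) \<le> (\<Prod>i<?n. (w i \<bullet> A (w i)) * (h i \<bullet> g i)\<^sup>2)"
    by (intro prod_mono) auto
  then have "\<delta> ^ (2 * ?n) \<le> (\<Prod>i<?n. w i \<bullet> A (w i)) * (\<Prod>i<?n. (h i \<bullet> g i)\<^sup>2)"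
    by (simp add: prod.distrib power_mult)
  then have "\<delta> ^ (2 * ?n) * det_on V A \<le> (\<Prod>i<?n. w i \<bullet> A (w i)) * (\<Prod>i<?n. (h i \<bullet> g i)\<^sup>2) * det_on V A"
    using dp by (intro mult_right_mono) auto
  also have "\<dots> = (\<Prod>i<?n. w i \<bullet> A (w i))" using one by (simp add: mult.assoc)
  finally show ?thesis .
qed

section \<open>Gaussian integrals on subspaces\<close>

text \<open>Sets instead of indexed families, because the product measure behind
  \<open>lborel_on\<close> is indexed by the basis vectors themselves.\<close>

definition onset :: "'b::euclidean_space set \<Rightarrow> bool" where
  "onset B \<longleftrightarrow> finite B \<and> (\<forall>b\<in>B. \<forall>c\<in>B. b \<bullet> c = (if b = c then 1 else 0))"

definition synth :: "'b::euclidean_space set \<Rightarrow> ('b \<Rightarrow> real) \<Rightarrow> 'b" where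
  "synth B f = (\<Sum>b\<in>B. f b *\<^sub>R b)"

lemma synth_measurable [measurable]: "synth B \<in> borel_measurable (\<Pi>\<^sub>M b\<in>B. lborel)"
  unfolding synth_def[abs_def] by measurable

lemma synth_in_span: "synth B f \<in> span B"
  unfolding synth_def by (intro span_sum span_scale span_base)

lemma onset_expand:
  assumes "onset B" "y \<in> span B"
  shows "(\<Sum>b\<in>B. (b \<bullet> y) *\<^sub>R b) = y"
proof -
  have B: "finite B" "\<And>b c. b \<in> B \<Longrightarrow> c \<in> B \<Longrightarrow> b \<bullet> c = (if b = c then 1 else 0)"
    using assms(1) by (auto simp: onset_def)
  have "subspace {y. (\<Sum>b\<in>B. (b \<bullet> y) *\<^sub>R b) = y}"
    by (auto simp: subspace_def inner_add_right scaleR_add_left sum.distrib scaleR_sum_right[symmetric] simp flip: scaleR_scaleR)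
  moreover have "B \<subseteq> {y. (\<Sum>b\<in>B. (b \<bullet> y) *\<^sub>R b) = y}"
  proof
    fix c assume c: "c \<in> B"
    have "(\<Sum>b\<in>B. (b \<bullet> c) *\<^sub>R b) = (\<Sum>b\<in>B. if b = c then c else 0)"
      using B c by (intro sum.cong) auto
    then show "c \<in> {y. (\<Sum>b\<in>B. (b \<bullet> y) *\<^sub>R b) = y}" using B c by simp
  qed
  ultimately have "span B \<subseteq> {y. (\<Sum>b\<in>B. (b \<bullet> y) *\<^sub>R b) = y}" by (rule span_minimal[rotated])
  then show ?thesis using assms(2) by blast
qed

lemma distr_PiM_lborel_translate:
  assumes "finite B"
  shows "distr (\<Pi>\<^sub>M b\<in>B. lborel) (\<Pi>\<^sub>M b\<in>B. lborel) (\<lambda>f. \<lambda>b\<in>B. f b + c b) = (\<Pi>\<^sub>M b\<in>B. lborel::real measure)"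
proof -
  interpret product_sigma_finite "\<lambda>_. lborel::real measure" by standard
  have meas: "(\<lambda>f. \<lambda>b\<in>B. f b + c b) \<in> (\<Pi>\<^sub>M b\<in>B. lborel) \<rightarrow>\<^sub>M (\<Pi>\<^sub>M b\<in>B. lborel::real measure)"
    by measurable
  show ?thesis
  proof (rule PiM_eqI[OF assms])
    fix A :: "'a \<Rightarrow> real set" assume A: "\<And>i. i \<in> B \<Longrightarrow> A i \<in> sets lborel"
    have A': "(\<lambda>t. t + c i) -` A i \<in> sets lborel" if "i \<in> B" for i
    proof -
      have "(\<lambda>t. t + c i) \<in> borel_measurable borel" by measurable
      from measurable_sets[OF this, of "A i"] show ?thesis using A[OF that] by simp
    qed
    have "(\<lambda>f. \<lambda>b\<in>B. f b + c b) -` Pi\<^sub>E B A \<inter> space (\<Pi>\<^sub>M b\<in>B. lborel) = Pi\<^sub>E B (\<lambda>i. (\<lambda>t. t + c i) -` A i)"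
      by (auto simp: space_PiM PiE_iff)
    then have "emeasure (distr (\<Pi>\<^sub>M b\<in>B. lborel) (\<Pi>\<^sub>M b\<in>B. lborel) (\<lambda>f. \<lambda>b\<in>B. f b + c b)) (Pi\<^sub>E B A)
        = emeasure (\<Pi>\<^sub>M b\<in>B. lborel) (Pi\<^sub>E B (\<lambda>i. (\<lambda>t. t + c i) -` A i))"
      using A by (subst emeasure_distr[OF meas]) (auto intro!: sets_PiM_I_finite assms)
    also have "\<dots> = (\<Prod>i\<in>B. emeasure lborel ((\<lambda>t. t + c i) -` A i))"
      using A' by (intro emeasure_PiM assms) auto
    also have "\<dots> = (\<Prod>i\<in>B. emeasure lborel (A i))"
    proof (rule prod.cong)
      fix i assume i: "i \<in> B"
      have "emeasure lborel (A i) = emeasure (distr lborel borel ((+) (c i))) (A i)"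
        using lborel_distr_plus[of "c i"] by simp
      also have "\<dots> = emeasure lborel ((\<lambda>t. t + c i) -` A i)"
        using A[OF i] by (subst emeasure_distr) (auto simp: add.commute[of _ "c i"] intro!: arg_cong[where f = "emeasure lborel"])
      finally show "emeasure lborel ((\<lambda>t. t + c i) -` A i) = emeasure lborel (A i)" ..
    qed simp
    finally show "emeasure (distr (\<Pi>\<^sub>M b\<in>B. lborel) (\<Pi>\<^sub>M b\<in>B. lborel) (\<lambda>f. \<lambda>b\<in>B. f b + c b)) (Pi\<^sub>E B A)
        = (\<Prod>i\<in>B. emeasure lborel (A i))" .
  qed simp
qed

lemma nn_integral_synth_translate:
  fixes h :: "'b::euclidean_space \<Rightarrow> ennreal"
  assumes B: "onset B" and y: "y \<in> span B" and [measurable]: "h \<in> borel_measurable borel"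
  shows "(\<integral>\<^sup>+f. h (synth B f + y) \<partial>(\<Pi>\<^sub>M b\<in>B. lborel)) = (\<integral>\<^sup>+f. h (synth B f) \<partial>(\<Pi>\<^sub>M b\<in>B. lborel))"
proof -
  have fin: "finite B" using B by (simp add: onset_def)
  have eq: "synth B (\<lambda>b\<in>B. f b + b \<bullet> y) = synth B f + y" for f
    using onset_expand[OF B y] by (simp add: synth_def scaleR_add_left sum.distrib)
  have meas: "(\<lambda>f. \<lambda>b\<in>B. f b + b \<bullet> y) \<in> (\<Pi>\<^sub>M b\<in>B. lborel) \<rightarrow>\<^sub>M (\<Pi>\<^sub>M b\<in>B. lborel::real measure)"
    by measurable
  have "(\<integral>\<^sup>+f. h (synth B f) \<partial>(\<Pi>\<^sub>M b\<in>B. lborel))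
      = (\<integral>\<^sup>+f. h (synth B f) \<partial>distr (\<Pi>\<^sub>M b\<in>B. lborel) (\<Pi>\<^sub>M b\<in>B. lborel) (\<lambda>f. \<lambda>b\<in>B. f b + b \<bullet> y))"
    by (simp add: distr_PiM_lborel_translate[OF fin])
  also have "\<dots> = (\<integral>\<^sup>+f. h (synth B (\<lambda>b\<in>B. f b + b \<bullet> y)) \<partial>(\<Pi>\<^sub>M b\<in>B. lborel))"
    by (rule nn_integral_distr[OF meas]) measurable
  finally show ?thesis by (simp add: eq)
qed

lemma nn_integral_exp_square:
  fixes r :: real
  assumes "0 < r"
  shows "(\<integral>\<^sup>+t. ennreal (exp (- pi * (r * t\<^sup>2))) \<partial>lborel) = ennreal (1 / sqrt r)"
proof -
  \<comment> \<open>Chosen so that the normal density has exponent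
    \<open>- pi * (r * t\<^sup>2)\<close>.\<close>
  define \<sigma> where "\<sigma> = sqrt (1 / (2 * pi * r))"
  have \<sigma>: "0 < \<sigma>" "\<sigma>\<^sup>2 = 1 / (2 * pi * r)" using assms by (simp_all add: \<sigma>_def)
  have "exp (- pi * (r * t\<^sup>2)) = (1 / sqrt r) * normal_density 0 \<sigma> t" for t
    using assms by (simp add: normal_density_def \<sigma>(2) real_sqrt_divide field_simps)
  then have "(\<integral>\<^sup>+t. ennreal (exp (- pi * (r * t\<^sup>2))) \<partial>lborel)
      = (\<integral>\<^sup>+t. ennreal (1 / sqrt r) * ennreal (normal_density 0 \<sigma> t) \<partial>lborel)"
    using assms by (simp add: ennreal_mult[symmetric])
  also have "\<dots> = ennreal (1 / sqrt r) * (\<integral>\<^sup>+t. ennreal (normal_density 0 \<sigma> t) \<partial>lborel)"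
    by (rule nn_integral_cmult) simp
  also have "(\<integral>\<^sup>+t. ennreal (normal_density 0 \<sigma> t) \<partial>lborel) = 1"
    using \<sigma>(1) by (subst nn_integral_eq_integral) (auto simp: integrable_normal_density)
  finally show ?thesis by simp
qed

lemma sqrt_prod: "sqrt (\<Prod>i\<in>A. f i) = (\<Prod>i\<in>A. sqrt (f i))"
  by (induction A rule: infinite_finite_induct) (auto simp: real_sqrt_mult)

lemma nn_integral_gauss_diag:
  assumes B: "onset B" and R: "linear R" and diag: "\<And>b c. b \<in> B \<Longrightarrow> c \<in> B \<Longrightarrow> b \<noteq> c \<Longrightarrow> b \<bullet> R c = 0"
    and pos: "\<And>b. b \<in> B \<Longrightarrow> 0 < b \<bullet> R b"
  shows "(\<integral>\<^sup>+f. ennreal (exp (- pi * (synth B f \<bullet> R (synth B f)))) \<partial>(\<Pi>\<^sub>M b\<in>B. lborel))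
    = ennreal (1 / sqrt (\<Prod>b\<in>B. b \<bullet> R b))"
proof -
  interpret product_sigma_finite "\<lambda>_. lborel::real measure" by standard
  have fin: "finite B" using B by (simp add: onset_def)
  have "synth B f \<bullet> R (synth B f) = (\<Sum>b\<in>B. (b \<bullet> R b) * (f b)\<^sup>2)" for f
  proof -
    have *: "synth B f \<bullet> y = (\<Sum>b\<in>B. f b * (b \<bullet> y))" for y
      by (simp add: synth_def inner_sum_left)
    have **: "b \<bullet> R (synth B f) = (\<Sum>c\<in>B. f c * (b \<bullet> R c))" for b
      by (simp add: synth_def linear_sum[OF R] linear_scale[OF R] inner_sum_right)
    have "synth B f \<bullet> R (synth B f) = (\<Sum>b\<in>B. f b * (\<Sum>c\<in>B. f c * (b \<bullet> R c)))"
      by (rule trans[OF *]) (simp only: **)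
    also have "\<dots> = (\<Sum>b\<in>B. f b * (\<Sum>c\<in>B. if c = b then f b * (b \<bullet> R b) else 0))"
      using diag by (intro sum.cong arg_cong2[where f = "(*)"]) auto
    finally show ?thesis using fin by (simp add: power2_eq_square ac_simps)
  qed
  then have "(\<integral>\<^sup>+f. ennreal (exp (- pi * (synth B f \<bullet> R (synth B f)))) \<partial>(\<Pi>\<^sub>M b\<in>B. lborel))
      = (\<integral>\<^sup>+f. (\<Prod>b\<in>B. ennreal (exp (- pi * ((b \<bullet> R b) * (f b)\<^sup>2)))) \<partial>(\<Pi>\<^sub>M b\<in>B. lborel))"
    using fin by (simp add: sum_distrib_left exp_sum prod_ennreal flip: sum_negf)
  also have "\<dots> = (\<Prod>b\<in>B. \<integral>\<^sup>+t. ennreal (exp (- pi * ((b \<bullet> R b) * t\<^sup>2))) \<partial>lborel)"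
    by (rule product_nn_integral_prod[OF fin]) simp
  also have "\<dots> = (\<Prod>b\<in>B. ennreal (1 / sqrt (b \<bullet> R b)))"
    using pos by (intro prod.cong refl nn_integral_exp_square) auto
  also have "\<dots> = ennreal (1 / sqrt (\<Prod>b\<in>B. b \<bullet> R b))"
    using pos by (subst prod_ennreal) (auto simp: less_imp_le prod_dividef sqrt_prod)
  finally show ?thesis .
qed

text \<open>Fubini and translation invariance exchange the integrals of \<open>g\<close> and of a Gaussian \<open>h\<close> between the two
  coordinate systems; the rotation invariant \<open>h\<close> has integral 1 in both.\<close>

lemma nn_integral_synth_indep:
  fixes g :: "'b::euclidean_space \<Rightarrow> ennreal"
  assumes B: "onset B" and C: "onset C" and span: "span B = span C" and g[measurable]: "g \<in> borel_measurable borel"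
  shows "(\<integral>\<^sup>+f. g (synth B f) \<partial>(\<Pi>\<^sub>M b\<in>B. lborel)) = (\<integral>\<^sup>+f. g (synth C f) \<partial>(\<Pi>\<^sub>M b\<in>C. lborel))"
proof -
  interpret product_sigma_finite "\<lambda>_. lborel::real measure" by standard
  have fin: "finite B" "finite C" using B C by (auto simp: onset_def)
  let ?M = "\<Pi>\<^sub>M b\<in>B. lborel :: real measure" and ?N = "\<Pi>\<^sub>M b\<in>C. lborel :: real measure"
  interpret pair_sigma_finite ?M ?N
    using sigma_finite[OF fin(1)] sigma_finite[OF fin(2)] by (rule pair_sigma_finite.intro)
  define h where "h x = ennreal (exp (- pi * (x \<bullet> x)))" for x :: 'b
  have h[measurable]: "h \<in> borel_measurable borel" unfolding h_def[abs_def] by measurable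
  have unit: "(\<integral>\<^sup>+f. h (synth A f) \<partial>(\<Pi>\<^sub>M b\<in>A. lborel)) = 1" if "onset A" for A
  proof -
    have A: "b \<bullet> c = (if b = c then 1 else 0)" if "b \<in> A" "c \<in> A" for b c
      using that \<open>onset A\<close> by (simp add: onset_def)
    have "(\<Prod>b\<in>A. b \<bullet> b) = 1" using A by (intro prod.neutral) auto
    moreover have "0 < b \<bullet> b" if "b \<in> A" for b using A[OF that that] by simp
    ultimately show ?thesis
      using nn_integral_gauss_diag[OF that linear_id[unfolded id_def]] A unfolding h_def by simp
  qed
  have BC: "synth B f \<in> span C" "synth C f' \<in> span B" for f f'
    using synth_in_span span by blast+
  have tr: "(\<integral>\<^sup>+f. k (synth A f + y) \<partial>(\<Pi>\<^sub>M b\<in>A. lborel)) = (\<integral>\<^sup>+f. k (synth A f) \<partial>(\<Pi>\<^sub>M b\<in>A. lborel))"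
    if "onset A" "y \<in> span A" "k \<in> borel_measurable borel" for A y and k :: "'b \<Rightarrow> ennreal"
    using nn_integral_synth_translate that by blast
  have "(\<integral>\<^sup>+f'. g (synth C f') \<partial>?N) = (\<integral>\<^sup>+f. h (synth B f) \<partial>?M) * (\<integral>\<^sup>+f'. g (synth C f') \<partial>?N)"
    by (simp add: unit[OF B])
  also have "\<dots> = (\<integral>\<^sup>+f. h (synth B f) * (\<integral>\<^sup>+f'. g (synth C f') \<partial>?N) \<partial>?M)"
    by (rule nn_integral_multc[symmetric]) measurable
  also have "\<dots> = (\<integral>\<^sup>+f. h (synth B f) * (\<integral>\<^sup>+f'. g (synth C f' + synth B f) \<partial>?N) \<partial>?M)"
    by (simp add: tr[OF C] BC)
  also have "\<dots> = (\<integral>\<^sup>+f. (\<integral>\<^sup>+f'. h (synth B f) * g (synth C f' + synth B f) \<partial>?N) \<partial>?M)"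
    by (simp add: nn_integral_cmult)
  also have "\<dots> = (\<integral>\<^sup>+f'. (\<integral>\<^sup>+f. h (synth B f) * g (synth C f' + synth B f) \<partial>?M) \<partial>?N)"
    by (rule Fubini'[symmetric]) measurable
  also have "\<dots> = (\<integral>\<^sup>+f'. (\<integral>\<^sup>+f. h (synth B f - synth C f') * g (synth B f) \<partial>?M) \<partial>?N)"
  proof (rule nn_integral_cong)
    fix f'
    have "(\<integral>\<^sup>+f. h (synth B f - synth C f') * g (synth B f) \<partial>?M)
       = (\<integral>\<^sup>+f. h ((synth B f + synth C f') - synth C f') * g (synth B f + synth C f') \<partial>?M)"
      by (rule tr[OF B BC(2), of "\<lambda>x. h (x - synth C f') * g x", symmetric]) measurable
    then show "(\<integral>\<^sup>+f. h (synth B f) * g (synth C f' + synth B f) \<partial>?M)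
      = (\<integral>\<^sup>+f. h (synth B f - synth C f') * g (synth B f) \<partial>?M)" by (simp add: add.commute)
  qed
  also have "\<dots> = (\<integral>\<^sup>+f. (\<integral>\<^sup>+f'. h (synth B f - synth C f') * g (synth B f) \<partial>?N) \<partial>?M)"
    by (rule Fubini') measurable
  also have "\<dots> = (\<integral>\<^sup>+f. (\<integral>\<^sup>+f'. h (synth C f' + (- synth B f)) \<partial>?N) * g (synth B f) \<partial>?M)"
  proof (rule nn_integral_cong)
    fix f
    have sym: "h (synth B f - synth C f') = h (synth C f' + (- synth B f))" for f'
      by (simp add: h_def inner_diff_left inner_diff_right inner_commute algebra_simps)
    show "(\<integral>\<^sup>+f'. h (synth B f - synth C f') * g (synth B f) \<partial>?N) = (\<integral>\<^sup>+f'. h (synth C f' + (- synth B f)) \<partial>?N) * g (synth B f)"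
      unfolding sym by (rule nn_integral_multc) measurable
  qed
  also have "\<dots> = (\<integral>\<^sup>+f. g (synth B f) \<partial>?M)"
    by (simp only: tr[OF C span_neg[OF BC(1)] h] unit[OF C] mult_1)
  finally show ?thesis ..
qed

lemma borel_measurable_exp_form:
  fixes R :: "'b::euclidean_space \<Rightarrow> 'b"
  assumes "linear R"
  shows "(\<lambda>x. ennreal (exp (- pi * ((x - y) \<bullet> R (x - y))))) \<in> borel_measurable borel"
proof -
  have "R \<in> borel_measurable borel"
    using assms by (intro borel_measurable_continuous_onI linear_continuous_on) (simp add: linear_conv_bounded_linear)
  then show ?thesis by measurable
qed

text \<open>By independence of the basis one may pass to an orthonormal basis diagonalising R, where
  the integral is a product of one-dimensional ones.\<close>

lemma nn_integral_gauss_synth: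
  assumes B: "onset B" and V: "subspace V" "span B = V" and R: "pos_form V R"
  shows "(\<integral>\<^sup>+f. ennreal (exp (- pi * (synth B f \<bullet> R (synth B f)))) \<partial>(\<Pi>\<^sub>M b\<in>B. lborel)) = ennreal (1 / sqrt (det_on V R))"
proof -
  have lin: "linear R" and sym: "\<And>x y. x \<in> V \<Longrightarrow> y \<in> V \<Longrightarrow> x \<bullet> R y = y \<bullet> R x"
    and pos: "\<And>x. x \<in> V \<Longrightarrow> x \<noteq> 0 \<Longrightarrow> 0 < x \<bullet> R x"
    using R by (auto simp: pos_form_def)
  obtain b where b: "form_onb V (\<lambda>x. x) b"
    and diag: "\<And>i k. i < dim V \<Longrightarrow> k < dim V \<Longrightarrow> i \<noteq> k \<Longrightarrow> b i \<bullet> R (b k) = 0"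
    using simultaneous_diagonalisation[OF V(1) pos_form_id lin sym] by blast
  have bV: "i < dim V \<Longrightarrow> b i \<in> V" and bb: "i < dim V \<Longrightarrow> k < dim V \<Longrightarrow> b i \<bullet> b k = (if i = k then 1 else 0)" for i k
    using b by (auto simp: form_onb_def)
  have inj: "inj_on b {..<dim V}"
  proof (rule inj_onI)
    fix i k assume "i \<in> {..<dim V}" "k \<in> {..<dim V}" "b i = b k"
    then show "i = k" using bb[of i k] bb[of i i] by (simp split: if_splits)
  qed
  let ?C = "b ` {..<dim V}"
  have C: "onset ?C" unfolding onset_def using bb inj by (auto simp: inj_on_def)
  have spC: "span ?C = V"
  proof
    show "span ?C \<subseteq> V" using V(1) bV by (intro span_minimal) auto
    show "V \<subseteq> span ?C"
    proof
      fix x assume "x \<in> V"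
      then have "x = (\<Sum>i<dim V. (b i \<bullet> x) *\<^sub>R b i)" by (rule form_onb_expand[OF V(1) pos_form_id b])
      then show "x \<in> span ?C" by (metis (no_types, lifting) imageI span_base span_scale span_sum)
    qed
  qed
  have meas: "(\<lambda>x. ennreal (exp (- pi * (x \<bullet> R x)))) \<in> borel_measurable borel"
    using borel_measurable_exp_form[OF lin, of 0] by simp
  have "(\<integral>\<^sup>+f. ennreal (exp (- pi * (synth B f \<bullet> R (synth B f)))) \<partial>(\<Pi>\<^sub>M b\<in>B. lborel))
      = (\<integral>\<^sup>+f. ennreal (exp (- pi * (synth ?C f \<bullet> R (synth ?C f)))) \<partial>(\<Pi>\<^sub>M b\<in>?C. lborel))"
    using V(2) spC by (intro nn_integral_synth_indep[OF B C _ meas]) simp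
  also have "\<dots> = ennreal (1 / sqrt (\<Prod>c\<in>?C. c \<bullet> R c))"
  proof (rule nn_integral_gauss_diag[OF C lin])
    show "0 < c \<bullet> R c" if "c \<in> ?C" for c
    proof -
      have "c \<in> V" "c \<bullet> c = 1" using that bV bb by auto
      then show ?thesis using pos[of c] by force
    qed
  qed (use diag in auto)
  also have "(\<Prod>c\<in>?C. c \<bullet> R c) = (\<Prod>i<dim V. b i \<bullet> R (b i))" using inj by (simp add: prod.reindex)
  also have "\<dots> = det_on V R"
    using det_on_diag[OF V(1) b linear_id[unfolded id_def] lin diag] det_on_id[OF V(1)] by simp
  finally show ?thesis .
qed

lemma onset_onb: assumes "subspace V" shows "onset (onb V)"
proof -
  have B: "onb V \<subseteq> V" "pairwise orthogonal (onb V)" "\<And>b. b \<in> onb V \<Longrightarrow> norm b = 1"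
    using is_onb_onb[OF assms] by (auto simp: is_onb_def)
  have "independent (onb V)" using B(2) B(3)[of 0] by (intro pairwise_orthogonal_independent) auto
  then show ?thesis using B finiteI_independent[of "onb V"]
    by (auto simp: onset_def pairwise_def orthogonal_def norm_eq_1)
qed

lemma span_onb: "subspace V \<Longrightarrow> span (onb V) = V"
  using is_onb_onb by (auto simp: is_onb_def)

lemma space_lborel_on [simp]: "space (lborel_on V) = V"
  and sets_lborel_on [measurable_cong]: "sets (lborel_on V) = sets (restrict_space borel V)"
  by (simp_all add: lborel_on_def space_restrict_space)

lemma nn_integral_lborel_on:
  fixes h :: "'b::euclidean_space \<Rightarrow> ennreal"
  assumes V: "subspace V" and [measurable]: "h \<in> borel_measurable borel"
  shows "(\<integral>\<^sup>+x. h x \<partial>lborel_on V) = (\<integral>\<^sup>+f. h (synth (onb V) f) \<partial>(\<Pi>\<^sub>M b\<in>onb V. lborel))"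
proof -
  have "synth (onb V) f \<in> V" for f using synth_in_span span_onb[OF V] by blast
  then have "synth (onb V) \<in> (\<Pi>\<^sub>M b\<in>onb V. lborel) \<rightarrow>\<^sub>M restrict_space borel V"
    by (intro measurable_restrict_space2) auto
  moreover have "h \<in> borel_measurable (restrict_space borel V)" by (rule measurable_restrict_space1) simp
  ultimately show ?thesis
    unfolding lborel_on_def synth_def[symmetric] by (intro nn_integral_distr) simp_all
qed

lemma nn_integral_gauss_lborel_on:
  assumes V: "subspace V" and R: "pos_form V R" and y: "y \<in> V"
  shows "(\<integral>\<^sup>+x. ennreal (exp (- pi * ((x - y) \<bullet> R (x - y)))) \<partial>lborel_on V) = ennreal (1 / sqrt (det_on V R))"
proof -
  have lin: "linear R" using R by (simp add: pos_form_def)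
  have "(\<integral>\<^sup>+x. ennreal (exp (- pi * ((x - y) \<bullet> R (x - y)))) \<partial>lborel_on V)
      = (\<integral>\<^sup>+f. ennreal (exp (- pi * ((synth (onb V) f + - y) \<bullet> R (synth (onb V) f + - y)))) \<partial>(\<Pi>\<^sub>M b\<in>onb V. lborel))"
    using nn_integral_lborel_on[OF V borel_measurable_exp_form[OF lin]] by simp
  also have "\<dots> = (\<integral>\<^sup>+f. ennreal (exp (- pi * (synth (onb V) f \<bullet> R (synth (onb V) f)))) \<partial>(\<Pi>\<^sub>M b\<in>onb V. lborel))"
    using borel_measurable_exp_form[OF lin, of 0] y span_onb[OF V] V
    by (intro nn_integral_synth_translate[where h = "\<lambda>x. ennreal (exp (- pi * (x \<bullet> R x)))"] onset_onb) (auto simp: subspace_neg)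
  also have "\<dots> = ennreal (1 / sqrt (det_on V R))"
    by (rule nn_integral_gauss_synth[OF onset_onb[OF V] V span_onb[OF V] R])
  finally show ?thesis .
qed

lemma nn_integral_gauss_lborel:
  fixes M :: "'a::euclidean_space \<Rightarrow> 'a"
  assumes M: "pos_form UNIV M"
  shows "(\<integral>\<^sup>+x. ennreal (exp (- pi * (x \<bullet> M x))) \<partial>lborel) = ennreal (1 / sqrt (det_on UNIV M))"
proof -
  have lin: "linear M" using M by (simp add: pos_form_def)
  have "(\<integral>\<^sup>+x. ennreal (exp (- pi * (x \<bullet> M x))) \<partial>lborel)
      = (\<integral>\<^sup>+f. ennreal (exp (- pi * (synth Basis f \<bullet> M (synth Basis f)))) \<partial>(\<Pi>\<^sub>M b\<in>Basis. lborel))"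
    using borel_measurable_exp_form[OF lin, of 0] synth_measurable[of "Basis :: 'a set"]
    by (subst lborel_eq, subst nn_integral_distr) (simp_all add: synth_def[abs_def])
  also have "\<dots> = ennreal (1 / sqrt (det_on UNIV M))"
    by (rule nn_integral_gauss_synth[OF _ subspace_UNIV _ M]) (auto simp: onset_def inner_Basis)
  finally show ?thesis .
qed

section \<open>Heat flow\<close>

text \<open>Dominated convergence for difference quotients, which the mean value inequality on the
  convex set S bounds by B. Derivatives within S include the one-sided ones at the ends of the time
  interval.\<close>

lemma has_real_derivative_integral:
  fixes f :: "real \<Rightarrow> 'x \<Rightarrow> real"
  assumes S: "convex S" "t0 \<in> S"
    and deriv: "\<And>t x. t \<in> S \<Longrightarrow> ((\<lambda>t. f t x) has_real_derivative f' t x) (at t within S)"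
    and int: "\<And>t. t \<in> S \<Longrightarrow> integrable M (f t)"
    and bound: "\<And>t x. t \<in> S \<Longrightarrow> \<bar>f' t x\<bar> \<le> B x" and B: "integrable M B"
    and meas: "f' t0 \<in> borel_measurable M"
  shows "((\<lambda>t. \<integral>x. f t x \<partial>M) has_real_derivative (\<integral>x. f' t0 x \<partial>M)) (at t0 within S)"
  unfolding has_field_derivative_iff tendsto_at_iff_sequentially
proof (intro allI impI)
  fix X assume X: "\<forall>i. X i \<in> S - {t0}" "X \<longlonglongrightarrow> t0"
  let ?D = "\<lambda>i x. (f (X i) x - f t0 x) / (X i - t0)"
  have "(\<lambda>i. \<integral>x. ?D i x \<partial>M) \<longlonglongrightarrow> (\<integral>x. f' t0 x \<partial>M)"
  proof (rule integral_dominated_convergence[OF meas _ B])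
    show "?D i \<in> borel_measurable M" for i
      using int X S by (intro borel_measurable_divide borel_measurable_diff borel_measurable_integrable) auto
    show "AE x in M. (\<lambda>i. ?D i x) \<longlonglongrightarrow> f' t0 x"
    proof (rule AE_I2)
      fix x
      show "(\<lambda>i. ?D i x) \<longlonglongrightarrow> f' t0 x"
        using deriv[OF S(2), of x] X unfolding has_field_derivative_iff tendsto_at_iff_sequentially
        by (auto simp: o_def)
    qed
    show "AE x in M. norm (?D i x) \<le> B x" for i
    proof (rule AE_I2)
      fix x
      have "norm (f (X i) x - f t0 x) \<le> B x * norm (X i - t0)"
        using X S by (intro field_differentiable_bound[OF S(1) deriv]) (auto simp: bound)
      then show "norm (?D i x) \<le> B x"
        using X by (auto simp: divide_le_eq)
    qed
  qed
  moreover have "(\<lambda>i. \<integral>x. ?D i x \<partial>M) = (\<lambda>i. ((\<integral>x. f (X i) x \<partial>M) - (\<integral>x. f t0 x \<partial>M)) / (X i - t0))"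
  proof
    fix i
    have "integrable M (f (X i))" "integrable M (f t0)" using int X S by auto
    then show "(\<integral>x. ?D i x \<partial>M) = ((\<integral>x. f (X i) x \<partial>M) - (\<integral>x. f t0 x \<partial>M)) / (X i - t0)"
      by simp
  qed
  ultimately show "((\<lambda>y. ((\<integral>x. f y x \<partial>M) - (\<integral>x. f t0 x \<partial>M)) / (y - t0)) \<circ> X) \<longlonglongrightarrow> (\<integral>x. f' t0 x \<partial>M)"
    by (simp add: o_def)
qed

lemma integrable_gauss:
  assumes "0 < c"
  shows "integrable lborel (\<lambda>x::'a::euclidean_space. exp (- c * (norm x)\<^sup>2))"
proof (rule integrableI_bounded)
  have M: "pos_form UNIV (\<lambda>x::'a. (c / pi) *\<^sub>R x)"
    using assms by (auto simp: pos_form_def inner_commute linear_iff scaleR_add_right)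
  have "(\<integral>\<^sup>+x. ennreal (norm (exp (- c * (norm (x::'a))\<^sup>2))) \<partial>lborel)
      = (\<integral>\<^sup>+x. ennreal (exp (- pi * ((x::'a) \<bullet> ((c / pi) *\<^sub>R x)))) \<partial>lborel)"
    by (simp add: power2_norm_eq_inner)
  then show "(\<integral>\<^sup>+x. ennreal (norm (exp (- c * (norm (x::'a))\<^sup>2))) \<partial>lborel) < \<infinity>"
    using nn_integral_gauss_lborel[OF M] by simp
qed measurable

lemma integrable_gauss_bounded:
  fixes f :: "'a::euclidean_space \<Rightarrow> real"
  assumes "f \<in> borel_measurable borel" "0 < c" "\<And>x. \<bar>f x\<bar> \<le> C * exp (- c * (norm x)\<^sup>2)"
  shows "integrable lborel f"
proof (rule Bochner_Integration.integrable_bound[where f = "\<lambda>x. C * exp (- c * (norm x)\<^sup>2)"])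
  show "integrable lborel (\<lambda>x::'a. C * exp (- c * (norm x)\<^sup>2))"
    by (intro integrable_mult_right integrable_gauss assms(2))
  show "f \<in> borel_measurable lborel" using assms(1) by simp
  show "AE x in lborel. norm (f x) \<le> norm (C * exp (- c * (norm x)\<^sup>2))"
    using assms(3) by (auto intro: order_trans[OF _ abs_ge_self])
qed

lemma integral_lborel_translate:
  fixes f :: "'a::euclidean_space \<Rightarrow> real"
  assumes "f \<in> borel_measurable borel"
  shows "(\<integral>x. f (x + c) \<partial>lborel) = (\<integral>x. f x \<partial>lborel)"
proof -
  have "(\<integral>x. f x \<partial>lborel) = (\<integral>x. f x \<partial>distr lborel borel ((+) c))"
    by (simp add: lborel_distr_plus)
  also have "\<dots> = (\<integral>x. f (c + x) \<partial>lborel)"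
    using assms by (intro integral_distr) auto
  finally show ?thesis by (simp add: add.commute)
qed

text \<open>By translation invariance \<open>t \<mapsto> \<integral>x. f (x + t *\<^sub>R v)\<close>
  is constant; differentiating under the integral at t = 0 gives the claim.\<close>

lemma integral_directional_derivative:
  fixes f :: "'a::euclidean_space \<Rightarrow> real"
  assumes deriv: "\<And>x. ((\<lambda>t. f (x + t *\<^sub>R v)) has_real_derivative f' x) (at 0)"
    and meas: "f \<in> borel_measurable borel" "f' \<in> borel_measurable borel"
    and c: "0 < c" and bf: "\<And>x. \<bar>f x\<bar> \<le> C * exp (- c * (norm x)\<^sup>2)" and bf': "\<And>x. \<bar>f' x\<bar> \<le> C * exp (- c * (norm x)\<^sup>2)"
  shows "(\<integral>x. f' x \<partial>lborel) = 0"
proof -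
  have "0 \<le> C * exp (- c * (norm (0::'a))\<^sup>2)" using bf[of 0] by (meson abs_ge_zero order_trans)
  then have C: "0 \<le> C" by simp
  let ?S = "{-1..1::real}"
  let ?C = "C * exp (c * (norm v)\<^sup>2)"
  \<comment> \<open>Giving up half of the rate c absorbs all translations with
    \<open>\<bar>t\<bar> \<le> 1\<close>, so one integrable function dominates them.\<close>
  have shift: "exp (- c * (norm (x + t *\<^sub>R v))\<^sup>2) \<le> exp (c * (norm v)\<^sup>2) * exp (- (c / 2) * (norm x)\<^sup>2)"
    if "t \<in> ?S" for x t
  proof -
    have "(norm x)\<^sup>2 \<le> 2 * (norm (x + t *\<^sub>R v))\<^sup>2 + 2 * (norm v)\<^sup>2"
    proof -
      have "norm x \<le> norm (x + t *\<^sub>R v) + norm (t *\<^sub>R v)" by (metis add_diff_cancel_right' norm_triangle_ineq4)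
      also have "norm (t *\<^sub>R v) \<le> norm v" using that by (auto intro!: mult_left_le_one_le)
      finally have "(norm x)\<^sup>2 \<le> (norm (x + t *\<^sub>R v) + norm v)\<^sup>2" by (intro power_mono) auto
      also have "\<dots> \<le> 2 * (norm (x + t *\<^sub>R v))\<^sup>2 + 2 * (norm v)\<^sup>2"
        using sum_squares_bound[of "norm (x + t *\<^sub>R v)" "norm v"] by (simp add: power2_sum)
      finally show ?thesis .
    qed
    then have "(c / 2) * (norm x)\<^sup>2 \<le> (c / 2) * (2 * (norm (x + t *\<^sub>R v))\<^sup>2 + 2 * (norm v)\<^sup>2)"
      using c by (intro mult_left_mono) auto
    then have "- c * (norm (x + t *\<^sub>R v))\<^sup>2 \<le> c * (norm v)\<^sup>2 + - (c / 2) * (norm x)\<^sup>2"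
      by (simp add: field_simps)
    then show ?thesis by (simp flip: exp_add)
  qed
  have "((\<lambda>t. \<integral>x. f (x + t *\<^sub>R v) \<partial>lborel) has_real_derivative (\<integral>x. f' (x + 0 *\<^sub>R v) \<partial>lborel)) (at 0 within ?S)"
  proof (rule has_real_derivative_integral[where B = "\<lambda>x. ?C * exp (- (c / 2) * (norm x)\<^sup>2)"])
    show "((\<lambda>t. f (x + t *\<^sub>R v)) has_real_derivative f' (x + t *\<^sub>R v)) (at t within ?S)" if "t \<in> ?S" for t x
    proof -
      have "((\<lambda>s. f ((x + t *\<^sub>R v) + (s - t) *\<^sub>R v)) has_real_derivative f' (x + t *\<^sub>R v)) (at t)"
        using DERIV_shift[of "\<lambda>s. f ((x + t *\<^sub>R v) + s *\<^sub>R v)" "f' (x + t *\<^sub>R v)" t "- t"] deriv[of "x + t *\<^sub>R v"] by simp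
      then show ?thesis by (simp add: algebra_simps has_field_derivative_at_within)
    qed
    show "integrable lborel (\<lambda>x. f (x + t *\<^sub>R v))" if "t \<in> ?S" for t
    proof (rule integrable_gauss_bounded[where c = "c / 2" and C = ?C])
      show "(\<lambda>x. f (x + t *\<^sub>R v)) \<in> borel_measurable borel" using meas(1) by measurable
      show "\<bar>f (x + t *\<^sub>R v)\<bar> \<le> ?C * exp (- (c / 2) * (norm x)\<^sup>2)" for x
        using order_trans[OF bf mult_left_mono[OF shift[OF that] C]] by (simp add: mult.assoc)
    qed (use c in auto)
    show "\<bar>f' (x + t *\<^sub>R v)\<bar> \<le> ?C * exp (- (c / 2) * (norm x)\<^sup>2)" if "t \<in> ?S" for t x
      using order_trans[OF bf' mult_left_mono[OF shift[OF that] C]] by (simp add: mult.assoc)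
    show "integrable lborel (\<lambda>x. ?C * exp (- (c / 2) * (norm x)\<^sup>2))"
      using c by (intro integrable_mult_right integrable_gauss) simp
    show "(\<lambda>x. f' (x + 0 *\<^sub>R v)) \<in> borel_measurable lborel" using meas(2) by simp
  qed auto
  then have "((\<lambda>t. \<integral>x. f x \<partial>lborel) has_real_derivative (\<integral>x. f' x \<partial>lborel)) (at 0)"
    by (simp add: integral_lborel_translate[OF meas(1)] at_within_Icc_at)
  then show ?thesis using DERIV_const DERIV_unique by blast
qed

text \<open>The map \<open>l j\<close> followed by the coordinates of \<open>V j\<close> in a basis diagonalising both \<open>A j\<close> and \<open>R j\<close> is
  \<open>x \<mapsto> (\<theta> j i \<bullet> x)\<^sub>i\<close>, with \<open>A j\<close> becoming the identity and \<open>R j\<close> the diagonal matrix \<open>r j\<close>; \<open>v\<close> is an orthonormal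
  basis for the form \<open>M = \<Sum>j. q j * l\<^sub>j\<^sup>* A\<^sub>j l\<^sub>j\<close>.  Here \<open>C1\<close> is \<open>l\<^sub>j M\<^sup>-\<^sup>1 l\<^sub>j\<^sup>* \<le> A\<^sub>j\<^sup>-\<^sup>1\<close> and \<open>C2\<close> is the complementary slackness
  between this inequality and \<open>A\<^sub>j \<le> R\<^sub>j\<close>.\<close>

locale gaussian_flow =
  fixes J :: "'j set" and q :: "'j \<Rightarrow> real" and n :: "'j \<Rightarrow> nat" and \<theta> :: "'j \<Rightarrow> nat \<Rightarrow> 'a::euclidean_space"
    and r :: "'j \<Rightarrow> nat \<Rightarrow> real" and K :: "'j \<Rightarrow> 'k set" and a :: "'j \<Rightarrow> 'k \<Rightarrow> real" and y :: "'j \<Rightarrow> 'k \<Rightarrow> nat \<Rightarrow> real"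
    and v :: "nat \<Rightarrow> 'a" and d :: nat
  assumes finJ: "finite J" and q: "\<And>j. j \<in> J \<Longrightarrow> 0 < q j" and r: "\<And>j i. j \<in> J \<Longrightarrow> i < n j \<Longrightarrow> 1 \<le> r j i"
    and K: "\<And>j. j \<in> J \<Longrightarrow> finite (K j)" "\<And>j. j \<in> J \<Longrightarrow> K j \<noteq> {}" and a: "\<And>j k. j \<in> J \<Longrightarrow> k \<in> K j \<Longrightarrow> 0 < a j k"
    and C1: "\<And>j c. j \<in> J \<Longrightarrow> (\<Sum>m<d. (\<Sum>i<n j. c i * (\<theta> j i \<bullet> v m))\<^sup>2) \<le> (\<Sum>i<n j. (c i)\<^sup>2)"
    and C2: "\<And>j i. j \<in> J \<Longrightarrow> i < n j \<Longrightarrow> (r j i - 1) * (1 - (\<Sum>m<d. (\<theta> j i \<bullet> v m)\<^sup>2)) = 0"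
    and C3: "\<And>m m'. m < d \<Longrightarrow> m' < d \<Longrightarrow>
      (\<Sum>j\<in>J. q j * (\<Sum>i<n j. (\<theta> j i \<bullet> v m) * (\<theta> j i \<bullet> v m'))) = (if m = m' then 1 else 0)"
    and C4: "\<And>x. x = (\<Sum>m<d. (\<Sum>j\<in>J. q j * (\<Sum>i<n j. (\<theta> j i \<bullet> x) * (\<theta> j i \<bullet> v m))) *\<^sub>R v m)"
begin

text \<open>The variance of s X + sqrt (1 - s^2) G for X of variance 1 / r and an independent G of
  variance 1, up to a common factor: 1 / r at s = 1 and 1 at s = 0.\<close>

definition den :: "'j \<Rightarrow> nat \<Rightarrow> real \<Rightarrow> real" where
  "den j i s = s\<^sup>2 / r j i + 1 - s\<^sup>2"

text \<open>Ornstein--Uhlenbeck interpolation between the given mixture (\<open>s = 1\<close>) and a centred Gaussian (\<open>s = 0\<close>):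
  the centres move to \<open>s * y\<close> and the inverse variances are \<open>1 / den\<close>.\<close>

definition mix :: "'j \<Rightarrow> 'k \<Rightarrow> real \<Rightarrow> 'a \<Rightarrow> real" where
  "mix j k s x = a j k * exp (\<Sum>i<n j. - ln (den j i s) / 2 - pi * (\<theta> j i \<bullet> x - s * y j k i)\<^sup>2 / den j i s)"

definition U :: "'j \<Rightarrow> real \<Rightarrow> 'a \<Rightarrow> real" where
  "U j s x = (\<Sum>k\<in>K j. mix j k s x)"

definition W :: "real \<Rightarrow> 'a \<Rightarrow> real" where
  "W s x = exp (\<Sum>j\<in>J. q j * ln (U j s x))"

text \<open>The mean of f over the components, weighted by their posterior probabilities at
  x.\<close>

definition avg :: "'j \<Rightarrow> real \<Rightarrow> 'a \<Rightarrow> ('k \<Rightarrow> real) \<Rightarrow> real" where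
  "avg j s x f = (\<Sum>k\<in>K j. mix j k s x * f k) / U j s x"

text \<open>The derivative of \<open>ln (mix j k s x)\<close> in the i-th coordinate is
  \<open>- 2 * pi * N\<close>; its derivative along \<open>v m\<close> is
  \<open>- 2 * pi * Z\<close>.\<close>

definition N :: "'j \<Rightarrow> 'k \<Rightarrow> nat \<Rightarrow> real \<Rightarrow> 'a \<Rightarrow> real" where
  "N j k i s x = (\<theta> j i \<bullet> x - s * y j k i) / den j i s"

definition Z :: "'j \<Rightarrow> 'k \<Rightarrow> nat \<Rightarrow> real \<Rightarrow> 'a \<Rightarrow> real" where
  "Z j k m s x = (\<Sum>i<n j. N j k i s x * (\<theta> j i \<bullet> v m))"

text \<open>This is \<open>x \<bullet> M (v m)\<close>, the m-th coordinate of x in the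
  M-orthonormal basis v.\<close>

definition coord :: "nat \<Rightarrow> 'a \<Rightarrow> real" where
  "coord m x = (\<Sum>j\<in>J. q j * (\<Sum>i<n j. (\<theta> j i \<bullet> x) * (\<theta> j i \<bullet> v m)))"

text \<open>\<open>W * flux m\<close> is a component of the Ornstein--Uhlenbeck current,
  \<open>W * coord m\<close> plus \<open>1 / (2 * pi)\<close> times the derivative of W along
  \<open>v m\<close>. It vanishes for multiples of
  \<open>exp (- pi * (x \<bullet> M x))\<close>.\<close>

definition flux :: "nat \<Rightarrow> real \<Rightarrow> 'a \<Rightarrow> real" where
  "flux m s x = coord m x - (\<Sum>j\<in>J. q j * avg j s x (\<lambda>k. Z j k m s x))"

text \<open>The derivative of \<open>W * flux m\<close> along \<open>v m\<close>, divided by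
  W.\<close>

definition dflux :: "nat \<Rightarrow> real \<Rightarrow> 'a \<Rightarrow> real" where
  "dflux m s x = - 2 * pi * (\<Sum>j\<in>J. q j * avg j s x (\<lambda>k. Z j k m s x)) * flux m s x + coord m (v m)
     - (\<Sum>j\<in>J. q j * ((\<Sum>i<n j. (\<theta> j i \<bullet> v m)\<^sup>2 / den j i s)
          - 2 * pi * (avg j s x (\<lambda>k. (Z j k m s x)\<^sup>2) - (avg j s x (\<lambda>k. Z j k m s x))\<^sup>2)))"

text \<open>The derivative of \<open>ln (mix j k s x)\<close> in s.\<close>

definition dtime :: "'j \<Rightarrow> 'k \<Rightarrow> real \<Rightarrow> 'a \<Rightarrow> real" where
  "dtime j k s x = (\<Sum>i<n j. s * (1 - 1 / r j i) / den j i s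
     - 2 * pi * s * (1 - 1 / r j i) * (N j k i s x)\<^sup>2 + 2 * pi * N j k i s x * y j k i)"

section \<open>Positivity, measurability and averages along the flow\<close>

lemma den_bounds:
  assumes "j \<in> J" "i < n j" "s \<in> {0..1}"
  shows "1 / r j i \<le> den j i s" "den j i s \<le> 1" "0 < den j i s"
proof -
  have r1: "1 \<le> r j i" using assms r by blast
  have s: "0 \<le> s\<^sup>2" "s\<^sup>2 \<le> 1" using assms(3) by (auto simp: power_le_one)
  have eq: "den j i s = 1 - s\<^sup>2 * (1 - 1 / r j i)" by (simp add: den_def algebra_simps)
  have "0 \<le> 1 - 1 / r j i" using r1 by simp
  then show "den j i s \<le> 1" unfolding eq using s by simp
  have "s\<^sup>2 * (1 - 1 / r j i) \<le> 1 * (1 - 1 / r j i)"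
    using s \<open>0 \<le> 1 - 1 / r j i\<close> by (intro mult_right_mono) auto
  then show "1 / r j i \<le> den j i s" unfolding eq by simp
  moreover have "0 < 1 / r j i" using r1 by simp
  ultimately show "0 < den j i s" by linarith
qed

lemma mix_pos: "j \<in> J \<Longrightarrow> k \<in> K j \<Longrightarrow> 0 < mix j k s x"
  by (simp add: mix_def a)

lemma U_pos: "j \<in> J \<Longrightarrow> 0 < U j s x"
  unfolding U_def using K by (intro sum_pos mix_pos) auto

lemma W_pos: "0 < W s x"
  by (simp add: W_def)

lemma mix_measurable [measurable]: "mix j k s \<in> borel_measurable borel"
  unfolding mix_def[abs_def] by measurable

lemma U_measurable [measurable]: "U j s \<in> borel_measurable borel"
  unfolding U_def[abs_def] by measurable

lemma W_measurable [measurable]: "W s \<in> borel_measurable borel"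
  unfolding W_def[abs_def] by measurable

lemma N_measurable [measurable]: "N j k i s \<in> borel_measurable borel"
  unfolding N_def[abs_def] by measurable

lemma Z_measurable [measurable]: "Z j k m s \<in> borel_measurable borel"
  unfolding Z_def[abs_def] by measurable

lemma avg_measurable [measurable]:
  assumes [measurable]: "\<And>k. f k \<in> borel_measurable borel"
  shows "(\<lambda>x. avg j s x (\<lambda>k. f k x)) \<in> borel_measurable borel"
  unfolding avg_def by measurable

lemma coord_measurable [measurable]: "coord m \<in> borel_measurable borel"
  unfolding coord_def[abs_def] by measurable

lemma flux_measurable [measurable]: "flux m s \<in> borel_measurable borel"
  unfolding flux_def[abs_def] by measurable

lemma dflux_measurable [measurable]: "dflux m s \<in> borel_measurable borel"
  unfolding dflux_def[abs_def] by measurable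

lemma dtime_measurable [measurable]: "dtime j k s \<in> borel_measurable borel"
  unfolding dtime_def[abs_def] by measurable

lemma avg_cmult: "avg j s x (\<lambda>k. c * f k) = c * avg j s x f"
  by (simp add: avg_def sum_distrib_left mult.left_commute)

lemma avg_add: "avg j s x (\<lambda>k. f k + g k) = avg j s x f + avg j s x g"
  by (simp add: avg_def distrib_left sum.distrib add_divide_distrib)

lemma avg_diff: "avg j s x (\<lambda>k. f k - g k) = avg j s x f - avg j s x g"
  by (simp add: avg_def right_diff_distrib sum_subtractf diff_divide_distrib)

lemma avg_sum: "avg j s x (\<lambda>k. \<Sum>i\<in>I. f i k) = (\<Sum>i\<in>I. avg j s x (f i))"
  by (simp add: avg_def sum_distrib_left sum.swap[of _ _ I] sum_divide_distrib)

lemma avg_const: "j \<in> J \<Longrightarrow> avg j s x (\<lambda>k. c) = c"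
  using U_pos[of j s x] by (simp add: avg_def U_def flip: sum_distrib_right)

subsection \<open>Derivatives\<close>

text \<open>With paths \<sigma> and \<xi> in time and space, one rule serves both derivatives: one
  path moves while the other rests. The function e holds the logarithmic derivatives of the
  components.\<close>

lemma U_derivative:
  assumes j: "j \<in> J"
    and "\<And>k. k \<in> K j \<Longrightarrow> ((\<lambda>t. mix j k (\<sigma> t) (\<xi> t)) has_real_derivative mix j k (\<sigma> t0) (\<xi> t0) * e k) (at t0 within S)"
  shows "((\<lambda>t. U j (\<sigma> t) (\<xi> t)) has_real_derivative U j (\<sigma> t0) (\<xi> t0) * avg j (\<sigma> t0) (\<xi> t0) e) (at t0 within S)"
proof -
  have "((\<lambda>t. U j (\<sigma> t) (\<xi> t)) has_real_derivative (\<Sum>k\<in>K j. mix j k (\<sigma> t0) (\<xi> t0) * e k)) (at t0 within S)"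
    unfolding U_def using assms(2) by (rule DERIV_sum)
  then show ?thesis using U_pos[OF j, of "\<sigma> t0" "\<xi> t0"] by (simp add: avg_def)
qed

lemma W_derivative:
  assumes "\<And>j k. j \<in> J \<Longrightarrow> k \<in> K j \<Longrightarrow>
    ((\<lambda>t. mix j k (\<sigma> t) (\<xi> t)) has_real_derivative mix j k (\<sigma> t0) (\<xi> t0) * e j k) (at t0 within S)"
  shows "((\<lambda>t. W (\<sigma> t) (\<xi> t)) has_real_derivative
    W (\<sigma> t0) (\<xi> t0) * (\<Sum>j\<in>J. q j * avg j (\<sigma> t0) (\<xi> t0) (e j))) (at t0 within S)"
proof -
  have "((\<lambda>t. q j * ln (U j (\<sigma> t) (\<xi> t))) has_real_derivative q j * avg j (\<sigma> t0) (\<xi> t0) (e j)) (at t0 within S)"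
    if j: "j \<in> J" for j
  proof -
    have U: "0 < U j (\<sigma> t0) (\<xi> t0)" by (rule U_pos[OF j])
    have "((\<lambda>t. U j (\<sigma> t) (\<xi> t)) has_real_derivative U j (\<sigma> t0) (\<xi> t0) * avg j (\<sigma> t0) (\<xi> t0) (e j)) (at t0 within S)"
      by (rule U_derivative[OF j]) (rule assms[OF j])
    from DERIV_cmult[OF DERIV_chain2[OF DERIV_ln_divide[OF U] this], of "q j"] show ?thesis
      using U by simp
  qed
  then have "((\<lambda>t. \<Sum>j\<in>J. q j * ln (U j (\<sigma> t) (\<xi> t))) has_real_derivative
      (\<Sum>j\<in>J. q j * avg j (\<sigma> t0) (\<xi> t0) (e j))) (at t0 within S)"
    by (rule DERIV_sum)
  from DERIV_chain2[OF DERIV_exp this] show ?thesis unfolding W_def .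
qed

text \<open>The weights move too, so the mean of the derivative is corrected by the covariance of f
  with the logarithmic derivative e.\<close>

lemma avg_derivative:
  assumes j: "j \<in> J"
    and mix: "\<And>k. k \<in> K j \<Longrightarrow> ((\<lambda>t. mix j k (\<sigma> t) (\<xi> t)) has_real_derivative mix j k (\<sigma> t0) (\<xi> t0) * e k) (at t0 within S)"
    and f: "\<And>k. k \<in> K j \<Longrightarrow> ((\<lambda>t. f t k) has_real_derivative f' k) (at t0 within S)"
  shows "((\<lambda>t. avg j (\<sigma> t) (\<xi> t) (f t)) has_real_derivative
    avg j (\<sigma> t0) (\<xi> t0) f' + avg j (\<sigma> t0) (\<xi> t0) (\<lambda>k. f t0 k * e k)
      - avg j (\<sigma> t0) (\<xi> t0) (f t0) * avg j (\<sigma> t0) (\<xi> t0) e) (at t0 within S)"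
proof -
  let ?g = "\<lambda>k. mix j k (\<sigma> t0) (\<xi> t0)" and ?U = "U j (\<sigma> t0) (\<xi> t0)"
  have Up: "0 < ?U" by (rule U_pos[OF j])
  have "((\<lambda>t. \<Sum>k\<in>K j. mix j k (\<sigma> t) (\<xi> t) * f t k) has_real_derivative
      (\<Sum>k\<in>K j. ?g k * e k * f t0 k + f' k * ?g k)) (at t0 within S)"
    using mix f by (intro DERIV_sum DERIV_mult) auto
  then have "((\<lambda>t. avg j (\<sigma> t) (\<xi> t) (f t)) has_real_derivative
      ((\<Sum>k\<in>K j. ?g k * e k * f t0 k + f' k * ?g k) * ?U - (\<Sum>k\<in>K j. ?g k * f t0 k) * (?U * avg j (\<sigma> t0) (\<xi> t0) e)) / (?U * ?U)) (at t0 within S)"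
    unfolding avg_def[of j "\<sigma> _"] using U_derivative[OF j mix] Up
    by (intro DERIV_divide) (auto simp: avg_def)
  moreover have "((\<Sum>k\<in>K j. ?g k * e k * f t0 k + f' k * ?g k) * ?U - (\<Sum>k\<in>K j. ?g k * f t0 k) * (?U * avg j (\<sigma> t0) (\<xi> t0) e)) / (?U * ?U)
     = avg j (\<sigma> t0) (\<xi> t0) f' + avg j (\<sigma> t0) (\<xi> t0) (\<lambda>k. f t0 k * e k)
      - avg j (\<sigma> t0) (\<xi> t0) (f t0) * avg j (\<sigma> t0) (\<xi> t0) e"
    unfolding avg_def[of j _ _ f'] avg_def[of j _ _ "\<lambda>k. f t0 k * e k"] avg_def[of j _ _ "f t0"] using Up
    by (simp add: field_simps sum.distrib power2_eq_square)
  ultimately show ?thesis by simp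
qed

lemma mix_derivative_space:
  "((\<lambda>t. mix j k s (x + t *\<^sub>R v m)) has_real_derivative mix j k s x * (- 2 * pi * Z j k m s x)) (at 0)"
proof -
  have "((\<lambda>t. \<Sum>i<n j. - ln (den j i s) / 2 - pi * (\<theta> j i \<bullet> (x + t *\<^sub>R v m) - s * y j k i)\<^sup>2 / den j i s)
     has_real_derivative (\<Sum>i<n j. - 2 * pi * N j k i s x * (\<theta> j i \<bullet> v m))) (at 0)"
  proof (rule DERIV_sum)
    fix i
    have "((\<lambda>t. (\<theta> j i \<bullet> (x + t *\<^sub>R v m) - s * y j k i)\<^sup>2) has_real_derivative
        2 * (\<theta> j i \<bullet> x - s * y j k i) * (\<theta> j i \<bullet> v m)) (at 0)"
      by (auto intro!: derivative_eq_intros simp: inner_add_right)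
    from DERIV_diff[OF DERIV_const[of "- ln (den j i s) / 2"] DERIV_cdivide[OF DERIV_cmult[OF this, of pi], of "den j i s"]]
    show "((\<lambda>t. - ln (den j i s) / 2 - pi * (\<theta> j i \<bullet> (x + t *\<^sub>R v m) - s * y j k i)\<^sup>2 / den j i s)
        has_real_derivative - 2 * pi * N j k i s x * (\<theta> j i \<bullet> v m)) (at 0)"
      by (simp add: N_def ac_simps)
  qed
  from DERIV_cmult[OF DERIV_chain2[OF DERIV_exp this], of "a j k"]
  have "((\<lambda>t. mix j k s (x + t *\<^sub>R v m)) has_real_derivative
     mix j k s x * (\<Sum>i<n j. - 2 * pi * N j k i s x * (\<theta> j i \<bullet> v m))) (at 0)"
    unfolding mix_def mult.assoc by simp
  moreover have "(\<Sum>i<n j. - 2 * pi * N j k i s x * (\<theta> j i \<bullet> v m)) = - 2 * pi * Z j k m s x"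
    unfolding Z_def sum_distrib_left by (intro sum.cong) auto
  ultimately show ?thesis by simp
qed

lemma mix_derivative_time:
  assumes "j \<in> J" "s \<in> {0..1}"
  shows "((\<lambda>s. mix j k s x) has_real_derivative mix j k s x * dtime j k s x) (at s within {0..1})"
proof -
  have "((\<lambda>s. - ln (den j i s) / 2 - pi * (\<theta> j i \<bullet> x - s * y j k i)\<^sup>2 / den j i s) has_real_derivative
      s * (1 - 1 / r j i) / den j i s - 2 * pi * s * (1 - 1 / r j i) * (N j k i s x)\<^sup>2 + 2 * pi * N j k i s x * y j k i)
      (at s within {0..1})" if i: "i < n j" for i
  proof -
    have p: "0 < den j i s" using den_bounds[OF assms(1) i assms(2)] by blast
    have d: "((\<lambda>s. den j i s) has_real_derivative - (2 * s * (1 - 1 / r j i))) (at s within {0..1})"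
      unfolding den_def using r[OF assms(1) i] by (auto intro!: derivative_eq_intros simp: algebra_simps)
    show ?thesis
      using p by (auto intro!: derivative_eq_intros d simp: N_def field_simps power2_eq_square)
  qed
  then have "((\<lambda>s. \<Sum>i<n j. - ln (den j i s) / 2 - pi * (\<theta> j i \<bullet> x - s * y j k i)\<^sup>2 / den j i s)
     has_real_derivative dtime j k s x) (at s within {0..1})"
    unfolding dtime_def by (intro DERIV_sum) auto
  from DERIV_cmult[OF DERIV_chain2[OF DERIV_exp this], of "a j k"] show ?thesis
    unfolding mix_def mult.assoc .
qed

lemma W_derivative_time:
  assumes "s \<in> {0..1}"
  shows "((\<lambda>s. W s x) has_real_derivative W s x * (\<Sum>j\<in>J. q j * avg j s x (\<lambda>k. dtime j k s x))) (at s within {0..1})"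
  using W_derivative[where \<sigma> = "\<lambda>s. s" and \<xi> = "\<lambda>_. x", OF mix_derivative_time[OF _ assms]] by simp

text \<open>Since the logarithmic derivative along \<open>v m\<close> is
  \<open>- 2 * pi * Z\<close>, the covariance from \<open>avg_derivative\<close> becomes the
  variance of Z that appears in \<open>dflux\<close>.\<close>

lemma flux_derivative:
  "((\<lambda>t. W s (x + t *\<^sub>R v m) * flux m s (x + t *\<^sub>R v m)) has_real_derivative W s x * dflux m s x) (at 0)"
proof -
  have dW: "((\<lambda>t. W s (x + t *\<^sub>R v m)) has_real_derivative
      W s x * (\<Sum>j\<in>J. q j * avg j s x (\<lambda>k. - 2 * pi * Z j k m s x))) (at 0)"
    using W_derivative[where \<sigma> = "\<lambda>_. s" and \<xi> = "\<lambda>t. x + t *\<^sub>R v m" and ?t0.0 = 0 and S = UNIV and e = "\<lambda>j k. - 2 * pi * Z j k m s x"]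
      mix_derivative_space by simp
  have dZ: "((\<lambda>t. Z j k m s (x + t *\<^sub>R v m)) has_real_derivative (\<Sum>i<n j. (\<theta> j i \<bullet> v m)\<^sup>2 / den j i s)) (at 0)" for j k
    unfolding Z_def
  proof (rule DERIV_sum)
    fix i
    define c where "c = (\<theta> j i \<bullet> v m) / den j i s"
    have "N j k i s (x + t *\<^sub>R v m) = N j k i s x + t * c" for t
      by (simp add: N_def c_def inner_add_right add_divide_distrib diff_divide_distrib)
    then have "((\<lambda>t. N j k i s (x + t *\<^sub>R v m) * (\<theta> j i \<bullet> v m)) has_real_derivative c * (\<theta> j i \<bullet> v m)) (at 0)"
      by (auto intro!: derivative_eq_intros)
    then show "((\<lambda>t. N j k i s (x + t *\<^sub>R v m) * (\<theta> j i \<bullet> v m)) has_real_derivative (\<theta> j i \<bullet> v m)\<^sup>2 / den j i s) (at 0)"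
      by (simp add: c_def power2_eq_square)
  qed
  have dA: "((\<lambda>t. avg j s (x + t *\<^sub>R v m) (\<lambda>k. Z j k m s (x + t *\<^sub>R v m))) has_real_derivative
      avg j s x (\<lambda>k. \<Sum>i<n j. (\<theta> j i \<bullet> v m)\<^sup>2 / den j i s) + avg j s x (\<lambda>k. Z j k m s x * (- 2 * pi * Z j k m s x))
       - avg j s x (\<lambda>k. Z j k m s x) * avg j s x (\<lambda>k. - 2 * pi * Z j k m s x)) (at 0)" if j: "j \<in> J" for j
    using avg_derivative[OF j, where \<sigma> = "\<lambda>_. s" and \<xi> = "\<lambda>t. x + t *\<^sub>R v m" and ?t0.0 = 0 and S = UNIV
        and e = "\<lambda>k. - 2 * pi * Z j k m s x" and f = "\<lambda>t k. Z j k m s (x + t *\<^sub>R v m)" and f' = "\<lambda>k. \<Sum>i<n j. (\<theta> j i \<bullet> v m)\<^sup>2 / den j i s"]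
      mix_derivative_space dZ by simp
  have dA': "((\<lambda>t. avg j s (x + t *\<^sub>R v m) (\<lambda>k. Z j k m s (x + t *\<^sub>R v m))) has_real_derivative
      (\<Sum>i<n j. (\<theta> j i \<bullet> v m)\<^sup>2 / den j i s) - 2 * pi * (avg j s x (\<lambda>k. (Z j k m s x)\<^sup>2) - (avg j s x (\<lambda>k. Z j k m s x))\<^sup>2)) (at 0)"
    if j: "j \<in> J" for j
  proof -
    have "avg j s x (\<lambda>k. Z j k m s x * (- 2 * pi * Z j k m s x)) = - 2 * pi * avg j s x (\<lambda>k. (Z j k m s x)\<^sup>2)"
      unfolding avg_cmult[symmetric] by (simp add: power2_eq_square ac_simps)
    then show ?thesis
      using dA[OF j] unfolding avg_cmult avg_const[OF j] by (simp add: algebra_simps power2_eq_square)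
  qed
  have dC: "((\<lambda>t. coord m (x + t *\<^sub>R v m)) has_real_derivative coord m (v m)) (at 0)"
  proof -
    have "coord m (x + t *\<^sub>R v m) = coord m x + t * coord m (v m)" for t
      by (simp add: coord_def inner_add_right algebra_simps sum.distrib sum_distrib_left)
    then show ?thesis by (auto intro!: derivative_eq_intros)
  qed
  have "((\<lambda>t. flux m s (x + t *\<^sub>R v m)) has_real_derivative coord m (v m) -
      (\<Sum>j\<in>J. q j * ((\<Sum>i<n j. (\<theta> j i \<bullet> v m)\<^sup>2 / den j i s)
          - 2 * pi * (avg j s x (\<lambda>k. (Z j k m s x)\<^sup>2) - (avg j s x (\<lambda>k. Z j k m s x))\<^sup>2)))) (at 0)"
    unfolding flux_def using dA' by (intro DERIV_diff dC DERIV_sum DERIV_cmult)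
  note dflux' = this
  have "(\<Sum>j\<in>J. q j * avg j s x (\<lambda>k. - 2 * pi * Z j k m s x)) = - 2 * pi * (\<Sum>j\<in>J. q j * avg j s x (\<lambda>k. Z j k m s x))"
    unfolding avg_cmult by (simp add: sum_distrib_left ac_simps)
  with dW have "((\<lambda>t. W s (x + t *\<^sub>R v m)) has_real_derivative
      W s x * (- 2 * pi * (\<Sum>j\<in>J. q j * avg j s x (\<lambda>k. Z j k m s x)))) (at 0)" by metis
  from DERIV_mult[OF this dflux'] show ?thesis
    by (rule DERIV_cong) (simp add: dflux_def algebra_simps)
qed

subsection \<open>The differential inequality\<close>

lemma avg_mono:
  assumes "j \<in> J" "\<And>k. f k \<le> g k"
  shows "avg j s x f \<le> avg j s x g"
  unfolding avg_def using assms U_pos[of j s x] mix_pos[of j _ s x]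
  by (intro divide_right_mono sum_mono mult_left_mono) (auto simp: less_imp_le)

lemma avg_variance:
  assumes "j \<in> J"
  shows "avg j s x (\<lambda>k. (f k - avg j s x f)\<^sup>2) = avg j s x (\<lambda>k. (f k)\<^sup>2) - (avg j s x f)\<^sup>2"
proof -
  have "(\<lambda>k. (f k - avg j s x f)\<^sup>2) = (\<lambda>k. (f k)\<^sup>2 - (2 * avg j s x f) * f k + (avg j s x f)\<^sup>2)"
    by (simp add: power2_diff fun_eq_iff)
  then show ?thesis
    by (simp only: avg_add avg_diff avg_cmult avg_const[OF assms]) (simp add: power2_eq_square)
qed

text \<open>The factor s makes y occur only as \<open>s * y\<close> and r only through den; both are
  then expressed by N, den and \<open>\<theta> j i \<bullet> x\<close>, the quantities that also
  occur in the flux.\<close>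

lemma dtime_identity:
  assumes "j \<in> J" "s \<in> {0..1}"
  shows "s * dtime j k s x = (\<Sum>i<n j. - 2 * pi * (N j k i s x)\<^sup>2 + (1 / den j i s - 1) + 2 * pi * (N j k i s x * (\<theta> j i \<bullet> x)))"
  unfolding dtime_def sum_distrib_left
proof (rule sum.cong)
  fix i assume "i \<in> {..<n j}"
  then have i: "i < n j" by simp
  let ?D = "den j i s" and ?N = "N j k i s x" and ?t = "\<theta> j i \<bullet> x"
  have D: "?D \<noteq> 0" using den_bounds[OF assms(1) i assms(2)] by simp
  have c: "s * (s * (1 - 1 / r j i)) = 1 - ?D" by (simp add: den_def algebra_simps power2_eq_square)
  have N: "s * y j k i = ?t - ?N * ?D" using D by (simp add: N_def)
  have "s * (s * (1 - 1 / r j i) / ?D - 2 * pi * s * (1 - 1 / r j i) * ?N\<^sup>2 + 2 * pi * ?N * y j k i)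
      = (s * (s * (1 - 1 / r j i))) / ?D - 2 * pi * (s * (s * (1 - 1 / r j i))) * ?N\<^sup>2 + 2 * pi * ?N * (s * y j k i)"
    by (simp add: algebra_simps)
  also have "\<dots> = (1 - ?D) / ?D - 2 * pi * (1 - ?D) * ?N\<^sup>2 + 2 * pi * ?N * (?t - ?N * ?D)"
    unfolding c N ..
  also have "\<dots> = - 2 * pi * ?N\<^sup>2 + (1 / ?D - 1) + 2 * pi * (?N * ?t)"
    using D by (simp add: diff_divide_distrib algebra_simps power2_eq_square)
  finally show "s * (s * (1 - 1 / r j i) / ?D - 2 * pi * s * (1 - 1 / r j i) * ?N\<^sup>2 + 2 * pi * ?N * y j k i)
      = - 2 * pi * ?N\<^sup>2 + (1 / ?D - 1) + 2 * pi * (?N * ?t)" .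
qed simp

lemma expand_inner: "z \<bullet> x = (\<Sum>m<d. coord m x * (z \<bullet> v m))"
  by (subst C4[of x]) (simp add: inner_sum_right coord_def)

lemma sum_swap3:
  "(\<Sum>j\<in>J. q j * (\<Sum>i<n j. \<Sum>m<d. f j i m)) = (\<Sum>m<d. \<Sum>j\<in>J. q j * (\<Sum>i<n j. f j i m))"
proof -
  have "(\<Sum>j\<in>J. q j * (\<Sum>i<n j. \<Sum>m<d. f j i m)) = (\<Sum>j\<in>J. q j * (\<Sum>m<d. \<Sum>i<n j. f j i m))"
    by (intro sum.cong refl arg_cong2[where f = "(*)"] sum.swap)
  also have "\<dots> = (\<Sum>j\<in>J. \<Sum>m<d. q j * (\<Sum>i<n j. f j i m))"
    by (intro sum.cong refl sum_distrib_left)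
  finally show ?thesis by (simp only: sum.swap[of _ "{..<d}" J])
qed

lemma sum_frame:
  "(\<Sum>j\<in>J. q j * (\<Sum>i<n j. c j i * (\<Sum>m<d. z m * (\<theta> j i \<bullet> v m))))
    = (\<Sum>m<d. z m * (\<Sum>j\<in>J. q j * (\<Sum>i<n j. c j i * (\<theta> j i \<bullet> v m))))"
  unfolding sum_distrib_left[of "c _ _"] sum_swap3 by (simp add: sum_distrib_left ac_simps)

text \<open>By C3 the map from z to its coefficients p is isometric for the weights q, and z is its
  adjoint applied to c. Hence p is the orthogonal projection of c onto the range, and the claim is
  that the squared distance from c to p is nonnegative.\<close>

lemma bessel:
  assumes z: "\<And>m. m < d \<Longrightarrow> z m = (\<Sum>j\<in>J. q j * (\<Sum>i<n j. c j i * (\<theta> j i \<bullet> v m)))"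
  shows "(\<Sum>m<d. (z m)\<^sup>2) \<le> (\<Sum>j\<in>J. q j * (\<Sum>i<n j. (c j i)\<^sup>2))"
proof -
  define p where "p j i = (\<Sum>m<d. z m * (\<theta> j i \<bullet> v m))" for j i
  have "0 \<le> (\<Sum>j\<in>J. q j * (\<Sum>i<n j. (c j i - p j i)\<^sup>2))"
    using q by (intro sum_nonneg mult_nonneg_nonneg) (auto simp: less_imp_le)
  also have "\<dots> = (\<Sum>j\<in>J. q j * (\<Sum>i<n j. (c j i)\<^sup>2)) - 2 * (\<Sum>j\<in>J. q j * (\<Sum>i<n j. c j i * p j i))
      + (\<Sum>j\<in>J. q j * (\<Sum>i<n j. p j i * p j i))"
    by (simp add: power2_diff sum.distrib sum_subtractf algebra_simps sum_distrib_left power2_eq_square)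
  also have "(\<Sum>j\<in>J. q j * (\<Sum>i<n j. c j i * p j i)) = (\<Sum>m<d. (z m)\<^sup>2)"
    unfolding p_def sum_frame using z by (simp add: power2_eq_square)
  also have "(\<Sum>j\<in>J. q j * (\<Sum>i<n j. p j i * p j i)) = (\<Sum>m<d. (z m)\<^sup>2)"
  proof -
    have "(\<Sum>j\<in>J. q j * (\<Sum>i<n j. p j i * (\<theta> j i \<bullet> v m))) = z m" if m: "m < d" for m
    proof -
      have "(\<Sum>j\<in>J. q j * (\<Sum>i<n j. p j i * (\<theta> j i \<bullet> v m)))
          = (\<Sum>j\<in>J. q j * (\<Sum>i<n j. (\<theta> j i \<bullet> v m) * (\<Sum>m'<d. z m' * (\<theta> j i \<bullet> v m'))))"
        unfolding p_def by (simp only: mult.commute)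
      also have "\<dots> = (\<Sum>m'<d. z m' * (if m = m' then 1 else 0))"
        unfolding sum_frame by (intro sum.cong refl arg_cong2[where f = "(*)"] C3[OF m]) auto
      finally show ?thesis using m by (simp add: if_distrib[of "\<lambda>u. _ * u"] cong: if_cong)
    qed
    then have "(\<Sum>m<d. z m * (\<Sum>j\<in>J. q j * (\<Sum>i<n j. p j i * (\<theta> j i \<bullet> v m)))) = (\<Sum>m<d. (z m)\<^sup>2)"
      by (simp add: power2_eq_square)
    then show ?thesis using sum_frame[of p z] unfolding p_def[symmetric] by simp
  qed
  finally show ?thesis by simp
qed

text \<open>The terms linear in \<open>\<theta> j i \<bullet> x\<close> cancel by \<open>C4\<close>, the first-order terms by \<open>C2\<close>; what remains is a variance
  controlled by \<open>C1\<close> plus a quadratic form in the means controlled by the Bessel inequality.\<close>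

lemma differential_inequality:
  assumes s: "s \<in> {0..1}"
  shows "s * (\<Sum>j\<in>J. q j * avg j s x (\<lambda>k. dtime j k s x)) + (\<Sum>m<d. dflux m s x) \<le> 0"
proof -
  define N1 where "N1 j i = avg j s x (\<lambda>k. N j k i s x)" for j i
  define N2 where "N2 j i = avg j s x (\<lambda>k. (N j k i s x)\<^sup>2)" for j i
  define Z1 where "Z1 j m = avg j s x (\<lambda>k. Z j k m s x)" for j m
  define Z2 where "Z2 j m = avg j s x (\<lambda>k. (Z j k m s x)\<^sup>2)" for j m
  define z where "z m = (\<Sum>j\<in>J. q j * Z1 j m)" for m
  define \<kappa> where "\<kappa> j i = (\<Sum>m<d. (\<theta> j i \<bullet> v m)\<^sup>2)" for j i
  let ?sum = "\<lambda>f. \<Sum>j\<in>J. q j * (\<Sum>i<n j. f j i)"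
  let ?summ = "\<lambda>f. \<Sum>j\<in>J. q j * (\<Sum>m<d. f j m)"
  have Z1: "Z1 j m = (\<Sum>i<n j. N1 j i * (\<theta> j i \<bullet> v m))" for j m
    unfolding Z1_def Z_def N1_def avg_sum by (simp add: mult.commute[of _ "\<theta> j _ \<bullet> v m"] avg_cmult)
  have time: "s * (\<Sum>j\<in>J. q j * avg j s x (\<lambda>k. dtime j k s x)) =
      ?sum (\<lambda>j i. - 2 * pi * N2 j i + (1 / den j i s - 1) + 2 * pi * (N1 j i * (\<theta> j i \<bullet> x)))"
    unfolding sum_distrib_left
  proof (rule sum.cong)
    fix j assume j: "j \<in> J"
    have "s * avg j s x (\<lambda>k. dtime j k s x) = avg j s x (\<lambda>k. s * dtime j k s x)" by (simp add: avg_cmult)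
    also have "\<dots> = (\<Sum>i<n j. - 2 * pi * N2 j i + (1 / den j i s - 1) + 2 * pi * (N1 j i * (\<theta> j i \<bullet> x)))"
      unfolding dtime_identity[OF j s] avg_sum avg_add avg_cmult N1_def N2_def avg_const[OF j]
      by (simp add: mult.commute[of _ "\<theta> j _ \<bullet> x"] avg_cmult)
    finally have *: "s * avg j s x (\<lambda>k. dtime j k s x) =
        (\<Sum>i<n j. - 2 * pi * N2 j i + (1 / den j i s - 1) + 2 * pi * (N1 j i * (\<theta> j i \<bullet> x)))" .
    show "s * (q j * avg j s x (\<lambda>k. dtime j k s x)) =
        (\<Sum>i<n j. q j * (- 2 * pi * N2 j i + (1 / den j i s - 1) + 2 * pi * (N1 j i * (\<theta> j i \<bullet> x))))"
      unfolding sum_distrib_left[symmetric] *[symmetric] by (rule mult.left_commute)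
  qed simp
  have cross: "(\<Sum>m<d. z m * coord m x) = ?sum (\<lambda>j i. N1 j i * (\<theta> j i \<bullet> x))"
  proof -
    have "?sum (\<lambda>j i. N1 j i * (\<theta> j i \<bullet> x)) = ?sum (\<lambda>j i. N1 j i * (\<Sum>m<d. coord m x * (\<theta> j i \<bullet> v m)))"
      using expand_inner[where x = x] by simp
    also have "\<dots> = (\<Sum>m<d. z m * coord m x)"
      unfolding sum_frame by (simp add: z_def Z1 mult.commute)
    finally show ?thesis ..
  qed
  have k1: "(\<Sum>m<d. coord m (v m)) = ?sum \<kappa>"
    unfolding coord_def \<kappa>_def sum_swap3 by (simp add: power2_eq_square)
  have k2: "(\<Sum>m<d. \<Sum>j\<in>J. q j * (\<Sum>i<n j. (\<theta> j i \<bullet> v m)\<^sup>2 / den j i s)) = ?sum (\<lambda>j i. \<kappa> j i / den j i s)"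
    unfolding \<kappa>_def sum_divide_distrib sum_swap3 ..
  have k3: "(\<Sum>m<d. \<Sum>j\<in>J. q j * (2 * pi * (Z2 j m - (Z1 j m)\<^sup>2))) = 2 * pi * ?summ (\<lambda>j m. Z2 j m - (Z1 j m)\<^sup>2)"
    by (subst sum.swap) (simp add: sum_distrib_left ac_simps)
  have "(\<Sum>m<d. dflux m s x) = (\<Sum>m<d. - 2 * pi * (z m * coord m x) + 2 * pi * (z m)\<^sup>2 + coord m (v m)
      - (\<Sum>j\<in>J. q j * (\<Sum>i<n j. (\<theta> j i \<bullet> v m)\<^sup>2 / den j i s)) + (\<Sum>j\<in>J. q j * (2 * pi * (Z2 j m - (Z1 j m)\<^sup>2))))"
    unfolding dflux_def flux_def z_def[symmetric] Z1_def[symmetric] Z2_def[symmetric]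
    by (intro sum.cong refl) (simp add: right_diff_distrib sum_subtractf power2_eq_square algebra_simps sum.distrib)
  also have "\<dots> = - 2 * pi * (\<Sum>m<d. z m * coord m x) + 2 * pi * (\<Sum>m<d. (z m)\<^sup>2) + ?sum \<kappa>
      - ?sum (\<lambda>j i. \<kappa> j i / den j i s) + 2 * pi * ?summ (\<lambda>j m. Z2 j m - (Z1 j m)\<^sup>2)"
    unfolding k1[symmetric] k2[symmetric] k3[symmetric] by (simp add: sum.distrib sum_subtractf sum_distrib_left sum_negf)
  finally have space: "(\<Sum>m<d. dflux m s x) = - 2 * pi * ?sum (\<lambda>j i. N1 j i * (\<theta> j i \<bullet> x)) + 2 * pi * (\<Sum>m<d. (z m)\<^sup>2) + ?sum \<kappa>
      - ?sum (\<lambda>j i. \<kappa> j i / den j i s) + 2 * pi * ?summ (\<lambda>j m. Z2 j m - (Z1 j m)\<^sup>2)"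
    unfolding cross .
  have zero: "?sum (\<lambda>j i. (1 / den j i s - 1) * (1 - \<kappa> j i)) = 0"
  proof (intro sum.neutral ballI)
    fix j assume j: "j \<in> J"
    \<comment> \<open>By C2 either r = 1, which makes den identically 1, or \<kappa> = 1.\<close>
    have "(1 / den j i s - 1) * (1 - \<kappa> j i) = 0" if i: "i < n j" for i
      using C2[OF j i] by (auto simp: \<kappa>_def den_def)
    then show "q j * (\<Sum>i<n j. (1 / den j i s - 1) * (1 - \<kappa> j i)) = 0" by (simp add: sum.neutral)
  qed
  have zero': "?sum (\<lambda>j i. 1 / den j i s - 1) + ?sum \<kappa> - ?sum (\<lambda>j i. \<kappa> j i / den j i s) = 0"
  proof -
    have "?sum (\<lambda>j i. (1 / den j i s - 1) * (1 - \<kappa> j i))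
      = ?sum (\<lambda>j i. 1 / den j i s - 1) + ?sum \<kappa> - ?sum (\<lambda>j i. \<kappa> j i / den j i s)"
      unfolding sum.distrib[symmetric] sum_subtractf[symmetric] distrib_left[symmetric] right_diff_distrib[symmetric]
      by (intro sum.cong refl arg_cong2[where f = "(*)"]) (simp add: algebra_simps diff_divide_distrib)
    then show ?thesis using zero by simp
  qed
  have var: "(\<Sum>m<d. Z2 j m - (Z1 j m)\<^sup>2) \<le> (\<Sum>i<n j. N2 j i) - (\<Sum>i<n j. (N1 j i)\<^sup>2)" if j: "j \<in> J" for j
  proof -
    have "(\<Sum>m<d. Z2 j m - (Z1 j m)\<^sup>2) = avg j s x (\<lambda>k. \<Sum>m<d. (Z j k m s x - Z1 j m)\<^sup>2)"
      unfolding avg_sum Z1_def Z2_def avg_variance[OF j] ..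
    also have "\<dots> \<le> avg j s x (\<lambda>k. \<Sum>i<n j. (N j k i s x - N1 j i)\<^sup>2)"
    proof (rule avg_mono[OF j])
      fix k
      have "Z j k m s x - Z1 j m = (\<Sum>i<n j. (N j k i s x - N1 j i) * (\<theta> j i \<bullet> v m))" for m
        unfolding Z1 Z_def by (simp add: left_diff_distrib sum_subtractf)
      then show "(\<Sum>m<d. (Z j k m s x - Z1 j m)\<^sup>2) \<le> (\<Sum>i<n j. (N j k i s x - N1 j i)\<^sup>2)"
        using C1[OF j, of "\<lambda>i. N j k i s x - N1 j i"] by simp
    qed
    also have "\<dots> = (\<Sum>i<n j. N2 j i - (N1 j i)\<^sup>2)"
      unfolding avg_sum N1_def N2_def avg_variance[OF j] ..
    finally show ?thesis by (simp add: sum_subtractf)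
  qed
  have "?summ (\<lambda>j m. Z2 j m - (Z1 j m)\<^sup>2) \<le> (\<Sum>j\<in>J. q j * ((\<Sum>i<n j. N2 j i) - (\<Sum>i<n j. (N1 j i)\<^sup>2)))"
    using q var by (intro sum_mono mult_left_mono) (auto simp: less_imp_le)
  also have "\<dots> = ?sum N2 - ?sum (\<lambda>j i. (N1 j i)\<^sup>2)"
    by (simp add: right_diff_distrib sum_subtractf)
  finally have "?summ (\<lambda>j m. Z2 j m - (Z1 j m)\<^sup>2) \<le> ?sum N2 - ?sum (\<lambda>j i. (N1 j i)\<^sup>2)" .
  moreover have "(\<Sum>m<d. (z m)\<^sup>2) \<le> ?sum (\<lambda>j i. (N1 j i)\<^sup>2)"
    by (rule bessel) (simp add: z_def Z1)
  ultimately have fin: "(\<Sum>m<d. (z m)\<^sup>2) + ?summ (\<lambda>j m. Z2 j m - (Z1 j m)\<^sup>2) - ?sum N2 \<le> 0" by linarith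
  have "?sum (\<lambda>j i. - 2 * pi * N2 j i + (1 / den j i s - 1) + 2 * pi * (N1 j i * (\<theta> j i \<bullet> x)))
      = - 2 * pi * ?sum N2 + ?sum (\<lambda>j i. 1 / den j i s - 1) + 2 * pi * ?sum (\<lambda>j i. N1 j i * (\<theta> j i \<bullet> x))"
    by (simp add: sum.distrib distrib_left sum_distrib_left sum_subtractf right_diff_distrib ac_simps sum_negf)
  then have "s * (\<Sum>j\<in>J. q j * avg j s x (\<lambda>k. dtime j k s x)) + (\<Sum>m<d. dflux m s x)
     = 2 * pi * ((\<Sum>m<d. (z m)\<^sup>2) + ?summ (\<lambda>j m. Z2 j m - (Z1 j m)\<^sup>2) - ?sum N2)"
    unfolding time space using zero' by (simp add: algebra_simps)
  also have "\<dots> \<le> 0" using fin by (simp add: mult_le_0_iff)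
  finally show ?thesis .
qed

end

text \<open>From \<open>1 + t \<le> exp t\<close>; the exponent \<open>p * t\<close> is absorbed
  into \<open>c * t\<^sup>2\<close> by completing the square.\<close>

lemma poly_le_gauss:
  fixes p :: nat and c t :: real
  assumes "0 < c" "0 \<le> t"
  shows "(1 + t) ^ p \<le> exp (real p ^ 2 / (4 * c)) * exp (c * t\<^sup>2)"
proof -
  have "(1 + t) ^ p \<le> exp t ^ p" using assms by (intro power_mono) auto
  also have "\<dots> = exp (p * t)" by (simp add: exp_of_nat_mult)
  also have "\<dots> \<le> exp (real p ^ 2 / (4 * c) + c * t\<^sup>2)"
  proof -
    have "0 \<le> (real p - 2 * c * t)\<^sup>2" by simp
    then have "4 * c * (p * t) \<le> real p ^ 2 + 4 * c * (c * t\<^sup>2)"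
      by (simp add: power2_eq_square algebra_simps)
    then have "p * t \<le> real p ^ 2 / (4 * c) + c * t\<^sup>2"
      using assms by (simp add: field_simps)
    then show ?thesis by simp
  qed
  finally show ?thesis by (simp add: exp_add)
qed

section \<open>Growth bounds and integrability along the flow\<close>

context gaussian_flow
begin

text \<open>Polynomial growth in x, uniformly in the time s. Everything that multiplies W is of this
  kind, so a single Gaussian dominates it for all times at once.\<close>

definition tame :: "(real \<Rightarrow> 'a \<Rightarrow> real) \<Rightarrow> bool" where
  "tame f \<longleftrightarrow> (\<exists>C p. 0 \<le> C \<and> (\<forall>s\<in>{0..1}. \<forall>x. \<bar>f s x\<bar> \<le> C * (1 + norm x) ^ p))"

lemma tameI:
  assumes "0 \<le> C" "\<And>s x. s \<in> {0..1} \<Longrightarrow> \<bar>f s x\<bar> \<le> C * (1 + norm x) ^ p"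
  shows "tame f"
  using assms unfolding tame_def by blast

lemma tame_mono:
  assumes "tame f" "\<And>s x. s \<in> {0..1} \<Longrightarrow> \<bar>g s x\<bar> \<le> \<bar>f s x\<bar>"
  shows "tame g"
  using assms unfolding tame_def by (meson order_trans)

lemma tame_const: "tame (\<lambda>s x. c)"
  by (rule tameI[of "\<bar>c\<bar>" _ 0]) auto

lemma tame_bounded: "(\<And>s x. s \<in> {0..1} \<Longrightarrow> \<bar>f s x\<bar> \<le> c) \<Longrightarrow> tame f"
  by (rule tame_mono[OF tame_const[of c]]) (meson abs_ge_self order_trans)

lemma tame_inner: "tame (\<lambda>s x. z \<bullet> x)"
proof (rule tameI[of "norm z" _ 1])
  fix s and x :: 'a
  have "\<bar>z \<bullet> x\<bar> \<le> norm z * norm x" by (rule Cauchy_Schwarz_ineq2)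
  also have "\<dots> \<le> norm z * (1 + norm x) ^ 1" by (intro mult_left_mono) auto
  finally show "\<bar>z \<bullet> x\<bar> \<le> norm z * (1 + norm x) ^ 1" .
qed simp

lemma tame_add:
  assumes "tame f" "tame g" shows "tame (\<lambda>s x. f s x + g s x)"
proof -
  obtain C p where f: "0 \<le> C" "\<And>s x. s \<in> {0..1} \<Longrightarrow> \<bar>f s x\<bar> \<le> C * (1 + norm x) ^ p" using assms(1) unfolding tame_def by blast
  obtain D p' where g: "0 \<le> D" "\<And>s x. s \<in> {0..1} \<Longrightarrow> \<bar>g s x\<bar> \<le> D * (1 + norm x) ^ p'" using assms(2) unfolding tame_def by blast
  show ?thesis
  proof (rule tameI[of "C + D" _ "max p p'"])
    fix s :: real and x assume s: "s \<in> {0..1}"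
    have "\<bar>f s x + g s x\<bar> \<le> C * (1 + norm x) ^ p + D * (1 + norm x) ^ p'"
      using f(2)[OF s, of x] g(2)[OF s, of x] by linarith
    also have "\<dots> \<le> C * (1 + norm x) ^ max p p' + D * (1 + norm x) ^ max p p'"
      using f(1) g(1) by (intro add_mono mult_left_mono power_increasing) auto
    finally show "\<bar>f s x + g s x\<bar> \<le> (C + D) * (1 + norm x) ^ max p p'" by (simp add: algebra_simps)
  qed (use f g in auto)
qed

lemma tame_mult:
  assumes "tame f" "tame g" shows "tame (\<lambda>s x. f s x * g s x)"
proof -
  obtain C p where f: "0 \<le> C" "\<And>s x. s \<in> {0..1} \<Longrightarrow> \<bar>f s x\<bar> \<le> C * (1 + norm x) ^ p" using assms(1) unfolding tame_def by blast
  obtain D p' where g: "0 \<le> D" "\<And>s x. s \<in> {0..1} \<Longrightarrow> \<bar>g s x\<bar> \<le> D * (1 + norm x) ^ p'" using assms(2) unfolding tame_def by blast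
  show ?thesis
  proof (rule tameI[of "C * D" _ "p + p'"])
    fix s :: real and x assume s: "s \<in> {0..1}"
    have "\<bar>f s x * g s x\<bar> \<le> (C * (1 + norm x) ^ p) * (D * (1 + norm x) ^ p')"
      unfolding abs_mult using f g s by (intro mult_mono) auto
    then show "\<bar>f s x * g s x\<bar> \<le> (C * D) * (1 + norm x) ^ (p + p')" by (simp add: power_add ac_simps)
  qed (use f g in auto)
qed

lemma tame_diff: "tame f \<Longrightarrow> tame g \<Longrightarrow> tame (\<lambda>s x. f s x - g s x)"
  using tame_add[of f "\<lambda>s x. - 1 * g s x"] tame_mult[OF tame_const[of "- 1"], of g] by simp

lemma tame_power: "tame f \<Longrightarrow> tame (\<lambda>s x. (f s x)\<^sup>2)"
  unfolding power2_eq_square by (rule tame_mult)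

lemma tame_sum: "(\<And>i. i \<in> A \<Longrightarrow> tame (f i)) \<Longrightarrow> tame (\<lambda>s x. \<Sum>i\<in>A. f i s x)"
  by (induction A rule: infinite_finite_induct) (auto intro: tame_const tame_add)

lemma tame_s: "tame (\<lambda>s x. s)"
  by (rule tame_bounded[of _ 1]) auto

text \<open>The posterior weights lie between 0 and 1, so a mean is bounded by the sum of the
  absolute values.\<close>

lemma tame_avg:
  assumes j: "j \<in> J" and f: "\<And>k. k \<in> K j \<Longrightarrow> tame (f k)"
  shows "tame (\<lambda>s x. avg j s x (\<lambda>k. f k s x))"
proof (rule tame_mono)
  have "tame (\<lambda>s x. \<bar>f k s x\<bar>)" if "k \<in> K j" for k
    using tame_mono[OF f[OF that]] by simp
  then show "tame (\<lambda>s x. \<Sum>k\<in>K j. \<bar>f k s x\<bar>)" by (rule tame_sum)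
  fix s x
  have "\<bar>mix j k s x * f k s x / U j s x\<bar> \<le> \<bar>f k s x\<bar>" if k: "k \<in> K j" for k
  proof -
    have "mix j k s x \<le> U j s x"
      unfolding U_def using K(1)[OF j] k mix_pos[OF j, THEN less_imp_le] by (intro member_le_sum) auto
    then have "mix j k s x / U j s x \<le> 1" "0 \<le> mix j k s x / U j s x"
      using U_pos[OF j, of s x] mix_pos[OF j k, of s x] by auto
    then have "\<bar>mix j k s x / U j s x\<bar> * \<bar>f k s x\<bar> \<le> 1 * \<bar>f k s x\<bar>"
      by (intro mult_right_mono) auto
    then show ?thesis by (simp add: abs_mult)
  qed
  then have "(\<Sum>k\<in>K j. \<bar>mix j k s x * f k s x / U j s x\<bar>) \<le> (\<Sum>k\<in>K j. \<bar>f k s x\<bar>)" by (rule sum_mono)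
  moreover have "\<bar>avg j s x (\<lambda>k. f k s x)\<bar> \<le> (\<Sum>k\<in>K j. \<bar>mix j k s x * f k s x / U j s x\<bar>)"
    unfolding avg_def sum_divide_distrib by (rule sum_abs)
  ultimately show "\<bar>avg j s x (\<lambda>k. f k s x)\<bar> \<le> \<bar>\<Sum>k\<in>K j. \<bar>f k s x\<bar>\<bar>" by linarith
qed

lemma tame_inverse_den:
  assumes "j \<in> J" "i < n j"
  shows "tame (\<lambda>s x. 1 / den j i s)"
proof (rule tame_bounded[of _ "r j i"])
  fix s :: real assume s: "s \<in> {0..1}"
  have "1 / den j i s \<le> r j i"
    using den_bounds[OF assms s] r[OF assms] by (simp add: field_simps)
  then show "\<bar>1 / den j i s\<bar> \<le> r j i" using den_bounds(3)[OF assms s] by simp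
qed

lemma tame_N: "j \<in> J \<Longrightarrow> i < n j \<Longrightarrow> tame (\<lambda>s x. N j k i s x)"
  using tame_mult[OF tame_diff[OF tame_inner tame_mult[OF tame_s tame_const]] tame_inverse_den, of j i "\<theta> j i" "y j k i"]
  by (simp add: N_def[abs_def])

lemma tame_Z: "j \<in> J \<Longrightarrow> tame (\<lambda>s x. Z j k m s x)"
  unfolding Z_def by (intro tame_sum tame_mult tame_const tame_N) auto

lemma tame_coord: "tame (\<lambda>s x. coord m x)"
  unfolding coord_def by (intro tame_sum tame_mult tame_const tame_inner)

lemma tame_flux: "tame (flux m)"
  unfolding flux_def[abs_def] by (intro tame_diff tame_coord tame_sum tame_mult tame_const tame_avg tame_Z)

lemma tame_dflux: "tame (dflux m)"
proof -
  have "tame (\<lambda>s x. (\<theta> j i \<bullet> v m)\<^sup>2 / den j i s)" if "j \<in> J" "i < n j" for j i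
    using tame_mult[OF tame_const tame_inverse_den[OF that], of "(\<theta> j i \<bullet> v m)\<^sup>2"] by simp
  then show ?thesis
    unfolding dflux_def[abs_def]
    by (intro tame_add tame_diff tame_mult tame_const tame_flux tame_sum tame_avg tame_power tame_Z) auto
qed

lemma tame_dtime: "j \<in> J \<Longrightarrow> tame (dtime j k)"
proof -
  assume j: "j \<in> J"
  have "tame (\<lambda>s x. s * (1 - 1 / r j i) / den j i s)" if "i < n j" for i
    using tame_mult[OF tame_mult[OF tame_s tame_const] tame_inverse_den[OF j that], of "1 - 1 / r j i"] by simp
  then show ?thesis
    unfolding dtime_def[abs_def]
    by (intro tame_add tame_diff tame_mult tame_const tame_sum tame_power tame_N[OF j] tame_s) auto
qed

text \<open>This is \<open>x \<bullet> M x\<close>.\<close>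

definition Q :: "'a \<Rightarrow> real" where
  "Q x = (\<Sum>j\<in>J. q j * (\<Sum>i<n j. (\<theta> j i \<bullet> x)\<^sup>2))"

text \<open>A coercivity constant of Q, from Cauchy-Schwarz applied to the expansion of x in the v
  m. The summand 1 keeps the denominator positive.\<close>

definition rate :: real where
  "rate = 1 / (1 + (\<Sum>m<d. (norm (v m))\<^sup>2))"

lemma rate_pos: "0 < rate"
  unfolding rate_def by (auto intro!: add_pos_nonneg sum_nonneg)

lemma Q_lower: "rate * (norm x)\<^sup>2 \<le> Q x"
proof -
  have "Q x = (\<Sum>j\<in>J. q j * (\<Sum>i<n j. (\<theta> j i \<bullet> x) * (\<Sum>m<d. coord m x * (\<theta> j i \<bullet> v m))))"
    unfolding Q_def expand_inner[where x = x, symmetric] by (simp add: power2_eq_square)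
  also have "\<dots> = (\<Sum>m<d. (coord m x)\<^sup>2)"
    unfolding sum_frame by (simp add: coord_def power2_eq_square)
  finally have Q: "Q x = (\<Sum>m<d. (coord m x)\<^sup>2)" .
  have "norm x \<le> (\<Sum>m<d. \<bar>coord m x\<bar> * norm (v m))"
    by (subst C4[of x]) (auto intro!: sum_norm_le simp: coord_def)
  then have "(norm x)\<^sup>2 \<le> (\<Sum>m<d. \<bar>coord m x\<bar> * norm (v m))\<^sup>2" by (intro power_mono) auto
  also have "\<dots> \<le> (\<Sum>m<d. \<bar>coord m x\<bar>\<^sup>2) * (\<Sum>m<d. (norm (v m))\<^sup>2)" by (rule Cauchy_Schwarz_ineq_sum)
  also have "\<dots> \<le> Q x * (1 + (\<Sum>m<d. (norm (v m))\<^sup>2))"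
    unfolding Q by (intro mult_mono) (auto intro!: sum_nonneg)
  finally show ?thesis
    unfolding rate_def by (simp add: field_simps add_pos_nonneg sum_nonneg)
qed

lemma W_upper: "\<exists>C>0. \<forall>s\<in>{0..1}. \<forall>x. W s x \<le> C * exp (- (pi / 2) * Q x)"
proof -
  define B where "B j k = a j k * exp (\<Sum>i<n j. ln (r j i) / 2 + pi * (y j k i)\<^sup>2)" for j k
  define C where "C j = (\<Sum>k\<in>K j. B j k)" for j
  have C: "0 < C j" if "j \<in> J" for j
    unfolding C_def B_def using that K a by (intro sum_pos) auto
  have mix: "mix j k s x \<le> B j k * exp (- (pi / 2) * (\<Sum>i<n j. (\<theta> j i \<bullet> x)\<^sup>2))"
    if j: "j \<in> J" and k: "k \<in> K j" and s: "s \<in> {0..1}" for j k s x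
  proof -
    have "- ln (den j i s) / 2 - pi * (\<theta> j i \<bullet> x - s * y j k i)\<^sup>2 / den j i s
        \<le> ln (r j i) / 2 + pi * (y j k i)\<^sup>2 - (pi / 2) * (\<theta> j i \<bullet> x)\<^sup>2" if i: "i < n j" for i
    proof -
      note D = den_bounds[OF j i s]
      have r1: "1 \<le> r j i" using r j i by blast
      have "- ln (r j i) = ln (1 / r j i)" using r1 by (simp add: ln_div)
      also have "\<dots> \<le> ln (den j i s)" using D r1 by simp
      finally have 1: "- ln (den j i s) / 2 \<le> ln (r j i) / 2" by simp
      \<comment> \<open>Half of the quadratic decay is spent on the displacement of the centre;
        dividing by den, which is at most 1, only helps.\<close>
      let ?t = "\<theta> j i \<bullet> x" and ?y = "y j k i"
      have "?t\<^sup>2 \<le> 2 * (?t - s * ?y)\<^sup>2 + 2 * (s * ?y)\<^sup>2"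
        using zero_le_power2[of "?t - 2 * (s * ?y)"] by (simp add: power2_eq_square algebra_simps)
      moreover have "(s * ?y)\<^sup>2 \<le> ?y\<^sup>2"
        using s by (simp add: power_mult_distrib mult_left_le_one_le power_le_one)
      ultimately have "?t\<^sup>2 / 2 - ?y\<^sup>2 \<le> (?t - s * ?y)\<^sup>2" by linarith
      also have "\<dots> \<le> (?t - s * ?y)\<^sup>2 / den j i s" using D by (simp add: field_simps mult_left_le_one_le)
      finally have "pi * (?t\<^sup>2 / 2 - ?y\<^sup>2) \<le> pi * ((?t - s * ?y)\<^sup>2 / den j i s)" by (intro mult_left_mono) auto
      then show ?thesis using 1 by (simp add: algebra_simps)
    qed
    then have "(\<Sum>i<n j. - ln (den j i s) / 2 - pi * (\<theta> j i \<bullet> x - s * y j k i)\<^sup>2 / den j i s)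
        \<le> (\<Sum>i<n j. ln (r j i) / 2 + pi * (y j k i)\<^sup>2 - (pi / 2) * (\<theta> j i \<bullet> x)\<^sup>2)" by (intro sum_mono) auto
    also have "\<dots> = (\<Sum>i<n j. ln (r j i) / 2 + pi * (y j k i)\<^sup>2) + - (pi / 2) * (\<Sum>i<n j. (\<theta> j i \<bullet> x)\<^sup>2)"
      by (simp add: sum_subtractf sum_distrib_left sum_negf)
    finally show ?thesis
      unfolding mix_def B_def mult.assoc exp_add[symmetric] using a[OF j k] by (intro mult_left_mono) auto
  qed
  have lnU: "ln (U j s x) \<le> ln (C j) - (pi / 2) * (\<Sum>i<n j. (\<theta> j i \<bullet> x)\<^sup>2)" if j: "j \<in> J" and s: "s \<in> {0..1}" for j s x
  proof -
    have "U j s x \<le> C j * exp (- (pi / 2) * (\<Sum>i<n j. (\<theta> j i \<bullet> x)\<^sup>2))"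
      unfolding U_def C_def sum_distrib_right using mix[OF j _ s] by (intro sum_mono)
    then have "ln (U j s x) \<le> ln (C j * exp (- (pi / 2) * (\<Sum>i<n j. (\<theta> j i \<bullet> x)\<^sup>2)))"
      using U_pos[OF j] by (subst ln_le_cancel_iff) (auto simp: C[OF j])
    then show ?thesis using C[OF j] by (simp add: ln_mult)
  qed
  show ?thesis
  proof (intro exI[of _ "exp (\<Sum>j\<in>J. q j * ln (C j))"] conjI ballI allI)
    fix s :: real and x assume s: "s \<in> {0..1}"
    have "(\<Sum>j\<in>J. q j * ln (U j s x)) \<le> (\<Sum>j\<in>J. q j * (ln (C j) - (pi / 2) * (\<Sum>i<n j. (\<theta> j i \<bullet> x)\<^sup>2)))"
      using lnU[OF _ s] q by (intro sum_mono mult_left_mono) (auto simp: less_imp_le)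
    also have "\<dots> = (\<Sum>j\<in>J. q j * ln (C j)) + - (pi / 2) * Q x"
      unfolding Q_def by (simp add: right_diff_distrib sum_subtractf sum_distrib_left mult.left_commute sum_negf)
    finally show "W s x \<le> exp (\<Sum>j\<in>J. q j * ln (C j)) * exp (- (pi / 2) * Q x)"
      unfolding W_def exp_add[symmetric] by simp
  qed simp
qed

text \<open>W decays at rate pi / 2 * rate; half of this exponent swallows the polynomial growth of
  f.\<close>

lemma W_tame_bound:
  assumes "tame f"
  shows "\<exists>C. \<forall>s\<in>{0..1}. \<forall>x. \<bar>W s x * f s x\<bar> \<le> C * exp (- (pi / 4 * rate) * (norm x)\<^sup>2)"
proof -
  let ?c = "pi / 4 * rate"
  have c: "0 < ?c" using rate_pos by simp
  obtain B where B: "0 < B" "\<And>s x. s \<in> {0..1} \<Longrightarrow> W s x \<le> B * exp (- (pi / 2) * Q x)" using W_upper by blast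
  obtain D p where D: "0 \<le> D" "\<And>s x. s \<in> {0..1} \<Longrightarrow> \<bar>f s x\<bar> \<le> D * (1 + norm x) ^ p" using assms unfolding tame_def by blast
  show ?thesis
  proof (intro exI[of _ "B * (D * exp (real p ^ 2 / (4 * ?c)))"] ballI allI)
    fix s :: real and x :: 'a assume s: "s \<in> {0..1}"
    let ?E = "exp (- (2 * ?c) * (norm x)\<^sup>2)"
    have "W s x \<le> B * ?E"
    proof -
      have "(pi / 2) * (rate * (norm x)\<^sup>2) \<le> (pi / 2) * Q x" by (intro mult_left_mono Q_lower) simp
      then have "exp (- (pi / 2) * Q x) \<le> ?E" by simp
      then have "B * exp (- (pi / 2) * Q x) \<le> B * ?E" using B(1) by (intro mult_left_mono) auto
      then show ?thesis using B(2)[OF s, of x] by linarith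
    qed
    moreover have "\<bar>f s x\<bar> \<le> D * (exp (real p ^ 2 / (4 * ?c)) * exp (?c * (norm x)\<^sup>2))"
      using order_trans[OF D(2)[OF s] mult_left_mono[OF poly_le_gauss[OF c norm_ge_zero] D(1)]] .
    ultimately have "\<bar>W s x * f s x\<bar> \<le> (B * ?E) * (D * (exp (real p ^ 2 / (4 * ?c)) * exp (?c * (norm x)\<^sup>2)))"
      unfolding abs_mult using W_pos[of s x] B(1) by (intro mult_mono) auto
    also have "\<dots> = B * (D * exp (real p ^ 2 / (4 * ?c))) * (?E * exp (?c * (norm x)\<^sup>2))" by (simp add: ac_simps)
    also have "?E * exp (?c * (norm x)\<^sup>2) = exp (- ?c * (norm x)\<^sup>2)"
      unfolding exp_add[symmetric] by (simp add: algebra_simps)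
    finally show "\<bar>W s x * f s x\<bar> \<le> B * (D * exp (real p ^ 2 / (4 * ?c))) * exp (- ?c * (norm x)\<^sup>2)" .
  qed
qed

lemma rate'_pos: "0 < pi / 4 * rate"
  using rate_pos by simp

lemma integrable_W_tame:
  assumes "tame f" "s \<in> {0..1}" "f s \<in> borel_measurable borel"
  shows "integrable lborel (\<lambda>x. W s x * f s x)"
proof -
  obtain C where C: "\<And>x. \<bar>W s x * f s x\<bar> \<le> C * exp (- (pi / 4 * rate) * (norm x)\<^sup>2)"
    using W_tame_bound[OF assms(1)] assms(2) by blast
  show ?thesis
    by (rule integrable_gauss_bounded[OF _ rate'_pos C]) (use assms(3) in measurable)
qed

lemma integrable_W: "s \<in> {0..1} \<Longrightarrow> integrable lborel (W s)"
  using integrable_W_tame[OF tame_const[of 1]] by simp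

lemma integral_dflux:
  assumes s: "s \<in> {0..1}"
  shows "(\<integral>x. W s x * dflux m s x \<partial>lborel) = 0"
proof -
  obtain C1 where C1: "\<And>x. \<bar>W s x * flux m s x\<bar> \<le> C1 * exp (- (pi / 4 * rate) * (norm x)\<^sup>2)"
    using W_tame_bound[OF tame_flux] s by blast
  obtain C2 where C2: "\<And>x. \<bar>W s x * dflux m s x\<bar> \<le> C2 * exp (- (pi / 4 * rate) * (norm x)\<^sup>2)"
    using W_tame_bound[OF tame_dflux] s by blast
  show ?thesis
  proof (rule integral_directional_derivative[OF flux_derivative _ _ rate'_pos])
    show "\<bar>W s x * flux m s x\<bar> \<le> max C1 C2 * exp (- (pi / 4 * rate) * (norm x)\<^sup>2)" for x
      by (rule order_trans[OF C1 mult_right_mono]) auto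
    show "\<bar>W s x * dflux m s x\<bar> \<le> max C1 C2 * exp (- (pi / 4 * rate) * (norm x)\<^sup>2)" for x
      by (rule order_trans[OF C2 mult_right_mono]) auto
  qed measurable
qed

text \<open>The terms \<open>W * dflux m\<close> integrate to 0, so they may be added to s times the
  time derivative, and then the integrand is nonpositive everywhere. The factor s can be divided out
  only for s > 0; continuity covers the endpoint.\<close>

theorem integral_W_le: "(\<integral>x. W 1 x \<partial>lborel) \<le> (\<integral>x. W 0 x \<partial>lborel)"
proof -
  let ?dt = "\<lambda>s x. \<Sum>j\<in>J. q j * avg j s x (\<lambda>k. dtime j k s x)"
  have tame: "tame ?dt" by (intro tame_sum tame_mult tame_const tame_avg tame_dtime)
  have meas: "?dt s \<in> borel_measurable borel" for s by measurable
  obtain C where C: "\<And>s x. s \<in> {0..1} \<Longrightarrow> \<bar>W s x * ?dt s x\<bar> \<le> C * exp (- (pi / 4 * rate) * (norm x)\<^sup>2)"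
    using W_tame_bound[OF tame] by blast
  have der: "((\<lambda>s. \<integral>x. W s x \<partial>lborel) has_real_derivative (\<integral>x. W s x * ?dt s x \<partial>lborel)) (at s within {0..1})"
    if s: "s \<in> {0..1}" for s
  proof (rule has_real_derivative_integral[where B = "\<lambda>x. C * exp (- (pi / 4 * rate) * (norm x)\<^sup>2)"])
    show "((\<lambda>t. W t x) has_real_derivative W t x * ?dt t x) (at t within {0..1})" if "t \<in> {0..1}" for t x
      by (rule W_derivative_time[OF that])
    show "integrable lborel (\<lambda>x. C * exp (- (pi / 4 * rate) * (norm x)\<^sup>2))"
      by (intro integrable_mult_right integrable_gauss rate'_pos)
    show "(\<lambda>x. W s x * ?dt s x) \<in> borel_measurable lborel" by measurable
  qed (use s C integrable_W in auto)
  have nonpos: "(\<integral>x. W s x * ?dt s x \<partial>lborel) \<le> 0" if s: "0 < s" "s < 1" for s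
  proof -
    have s': "s \<in> {0..1}" using s by simp
    have int: "integrable lborel (\<lambda>x. W s x * ?dt s x)" by (rule integrable_W_tame[OF tame s' meas])
    have intm: "integrable lborel (\<lambda>x. W s x * dflux m s x)" for m
      by (rule integrable_W_tame[OF tame_dflux s']) measurable
    have "s * (\<integral>x. W s x * ?dt s x \<partial>lborel) = (\<integral>x. s * (W s x * ?dt s x) + (\<Sum>m<d. W s x * dflux m s x) \<partial>lborel)"
      using int intm by (subst Bochner_Integration.integral_add) (auto simp: integral_dflux[OF s'])
    also have "\<dots> \<le> (\<integral>(x::'a). 0 \<partial>lborel)"
    proof (rule integral_mono)
      show "integrable lborel (\<lambda>x. s * (W s x * ?dt s x) + (\<Sum>m<d. W s x * dflux m s x))"
        using int intm by auto
      fix x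
      have "W s x * (s * ?dt s x + (\<Sum>m<d. dflux m s x)) \<le> 0"
        using differential_inequality[OF s', of x] W_pos[of s x] by (simp add: mult_le_0_iff)
      then show "s * (W s x * ?dt s x) + (\<Sum>m<d. W s x * dflux m s x) \<le> 0"
        by (simp add: distrib_left sum_distrib_left mult.left_commute)
    qed simp
    finally show ?thesis using s by (simp add: mult_le_0_iff)
  qed
  show ?thesis
  proof (rule DERIV_nonpos_imp_decreasing_open[where f = "\<lambda>s. \<integral>x. W s x \<partial>lborel" and a = 0 and b = 1])
    show "continuous_on {0..1} (\<lambda>s. \<integral>x. W s x \<partial>lborel)"
      by (rule DERIV_continuous_on[OF der])
    fix s :: real assume s: "0 < s" "s < 1"
    then have "((\<lambda>s. \<integral>x. W s x \<partial>lborel) has_real_derivative (\<integral>x. W s x * ?dt s x \<partial>lborel)) (at s)"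
      using der[of s] by (simp add: at_within_Icc_at)
    then show "\<exists>y. ((\<lambda>s. \<integral>x. W s x \<partial>lborel) has_real_derivative y) (at s) \<and> y \<le> 0"
      using nonpos[OF s] by blast
  qed simp
qed

end

section \<open>The determinant inequality\<close>

lemma adjoint_on_eqI:
  fixes f :: "'a::euclidean_space \<Rightarrow> 'b::euclidean_space"
  assumes W: "subspace W" "linear f" and z: "z \<in> W" "\<And>x. x \<in> W \<Longrightarrow> f x \<bullet> y = x \<bullet> z"
  shows "adjoint_on W f y = z"
proof -
  let ?a = "adjoint_on W f y"
  have "z - ?a \<in> W" using W z adjoint_on_works(1)[OF W] by (simp add: subspace_diff)
  then have "(z - ?a) \<bullet> z = (z - ?a) \<bullet> ?a"
    using z(2) adjoint_on_works(2)[OF W] by metis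
  then have "(z - ?a) \<bullet> (z - ?a) = 0" by (simp add: inner_diff_right[of "z - ?a"])
  then show ?thesis by simp
qed

lemma subspace_singular_space:
  fixes f :: "'a::euclidean_space \<Rightarrow> 'b::euclidean_space"
  assumes W: "subspace W" and f: "linear f"
  shows "subspace (singular_space W f s)"
proof -
  note aw = adjoint_on_works[OF W f]
  have add: "adjoint_on W f (y + y') = adjoint_on W f y + adjoint_on W f y'" for y y'
    using aw by (intro adjoint_on_eqI[OF W f]) (auto simp: inner_add_right subspace_add[OF W])
  have scale: "adjoint_on W f (c *\<^sub>R y) = c *\<^sub>R adjoint_on W f y" for c y
    using aw by (intro adjoint_on_eqI[OF W f]) (auto simp: subspace_scale[OF W])
  show ?thesis
    unfolding subspace_def singular_space_def
    using scale[of 0] by (auto simp: linear_0[OF f] linear_add[OF f] linear_scale[OF f] add scale scaleR_add_right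
        subspace_0[OF W] subspace_add[OF W] subspace_scale[OF W] scaleR_left_commute)
qed

lemma singular_space_inner:
  fixes f :: "'a::euclidean_space \<Rightarrow> 'b::euclidean_space"
  assumes W: "subspace W" and f: "linear f" and "x \<in> singular_space W f s" "y \<in> singular_space W f t"
  shows "f x \<bullet> f y = t\<^sup>2 * (x \<bullet> y)"
  using adjoint_on_works(2)[OF W f, of x "f y"] assms(3,4) by (simp add: singular_space_def)

text \<open>The witness consists of right singular vectors for the singular values exceeding \<open>\<alpha>\<close>.\<close>

lemma ess_rank_expanding:
  fixes f :: "'a::euclidean_space \<Rightarrow> 'b::euclidean_space"
  assumes W: "subspace W" and f: "linear f" and \<alpha>: "0 \<le> \<alpha>"
  shows "\<exists>C. onset C \<and> C \<subseteq> W \<and> card C = ess_rank \<alpha> W f \<and> (\<forall>w\<in>span C. w \<noteq> 0 \<longrightarrow> \<alpha> * norm w < norm (f w))"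
proof -
  let ?S = "{s. s \<in> singular_values W f \<and> \<alpha> < s}"
  have finS: "finite ?S" using finite_singular_values[OF W f] by simp
  have "\<forall>s. \<exists>B. B \<subseteq> singular_space W f s \<and> onset B \<and> card B = dim (singular_space W f s)"
  proof
    fix s
    obtain B where "B \<subseteq> singular_space W f s" "pairwise orthogonal B" "\<And>x. x \<in> B \<Longrightarrow> norm x = 1"
      "independent B" "card B = dim (singular_space W f s)"
      using orthonormal_basis_subspace[OF subspace_singular_space[OF W f]] by metis
    then show "\<exists>B. B \<subseteq> singular_space W f s \<and> onset B \<and> card B = dim (singular_space W f s)"
      using finiteI_independent[of B]
      by (intro exI[of _ B]) (auto simp: onset_def pairwise_def orthogonal_def norm_eq_1)
  qed
  from choice[OF this] obtain B where B: "\<And>s. B s \<subseteq> singular_space W f s" "\<And>s. onset (B s)"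
    "\<And>s. card (B s) = dim (singular_space W f s)" by blast
  have Bself: "b \<bullet> c = (if b = c then 1 else 0)" if "b \<in> B s" "c \<in> B s" for b c s
    using B(2)[of s] that by (simp add: onset_def)
  have cross: "b \<bullet> c = 0" if "b \<in> B s" "c \<in> B t" "s \<in> ?S" "t \<in> ?S" "s \<noteq> t" for b c s t
  proof -
    have "f b \<bullet> f c = t\<^sup>2 * (b \<bullet> c)" "f c \<bullet> f b = s\<^sup>2 * (c \<bullet> b)"
      using B(1) that singular_space_inner[OF W f] by blast+
    moreover have "s\<^sup>2 \<noteq> t\<^sup>2" using that \<alpha> by (auto simp: power2_eq_iff_nonneg)
    ultimately show ?thesis by (simp add: inner_commute)
  qed
  have disj: "B s \<inter> B t = {}" if "s \<in> ?S" "t \<in> ?S" "s \<noteq> t" for s t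
    using cross[OF _ _ that] Bself by fastforce
  let ?C = "\<Union>s\<in>?S. B s"
  have finB: "finite (B s)" for s using B(2) by (simp add: onset_def)
  have C: "onset ?C"
    unfolding onset_def
  proof (intro conjI ballI)
    show "finite ?C" using finS finB by blast
    fix b c assume "b \<in> ?C" "c \<in> ?C"
    then obtain s t where st: "s \<in> ?S" "t \<in> ?S" "b \<in> B s" "c \<in> B t" by blast
    show "b \<bullet> c = (if b = c then 1 else 0)"
      using Bself[of b s c] cross[of b s c t] st disj[of s t] by (cases "s = t") auto
  qed
  have card: "card ?C = ess_rank \<alpha> W f"
    unfolding ess_rank_def using finS finB disj by (subst card_UN_disjoint) (auto simp: B(3))
  have CW: "?C \<subseteq> W" using B(1) by (auto simp: singular_space_def)
  have expand: "\<alpha> * norm w < norm (f w)" if w: "w \<in> span ?C" "w \<noteq> 0" for w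
  proof -
    have wex: "w = (\<Sum>c\<in>?C. (c \<bullet> w) *\<^sub>R c)" using onset_expand[OF C w(1)] by simp
    have "\<forall>c\<in>?C. \<exists>s. s \<in> ?S \<and> c \<in> B s" by blast
    from bchoice[OF this] obtain \<sigma> where \<sigma>: "\<And>c. c \<in> ?C \<Longrightarrow> \<sigma> c \<in> ?S \<and> c \<in> B (\<sigma> c)" by blast
    have fin: "finite ?C" using C by (simp add: onset_def)
    have cc: "f b \<bullet> f c = (if b = c then (\<sigma> c)\<^sup>2 else 0)" if "b \<in> ?C" "c \<in> ?C" for b c
    proof -
      have "f b \<bullet> f c = (\<sigma> c)\<^sup>2 * (b \<bullet> c)"
        using \<sigma>[OF that(1)] \<sigma>[OF that(2)] B(1) by (intro singular_space_inner[OF W f]) blast+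
      then show ?thesis using C that unfolding onset_def by auto
    qed
    have fw: "f w = (\<Sum>c\<in>?C. (c \<bullet> w) *\<^sub>R f c)"
      by (subst wex) (simp add: linear_sum[OF f] linear_scale[OF f])
    have "f w \<bullet> f w = (\<Sum>b\<in>?C. (b \<bullet> w) * (\<Sum>c\<in>?C. (c \<bullet> w) * (f b \<bullet> f c)))"
    proof -
      have 1: "f w \<bullet> z = (\<Sum>b\<in>?C. (b \<bullet> w) * (f b \<bullet> z))" for z
        unfolding fw by (simp add: inner_sum_left)
      have 2: "f b \<bullet> f w = (\<Sum>c\<in>?C. (c \<bullet> w) * (f b \<bullet> f c))" for b
        unfolding fw by (simp add: inner_sum_right)
      show ?thesis by (rule trans[OF 1]) (simp only: 2)
    qed
    also have "\<dots> = (\<Sum>b\<in>?C. (b \<bullet> w) * (\<Sum>c\<in>?C. if b = c then (b \<bullet> w) * (\<sigma> b)\<^sup>2 else 0))"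
      using cc by (intro sum.cong refl arg_cong2[where f = "(*)"]) auto
    also have "\<dots> = (\<Sum>b\<in>?C. (\<sigma> b)\<^sup>2 * (b \<bullet> w)\<^sup>2)"
      using fin by (intro sum.cong) (auto simp: power2_eq_square)
    finally have fwfw: "f w \<bullet> f w = (\<Sum>b\<in>?C. (\<sigma> b)\<^sup>2 * (b \<bullet> w)\<^sup>2)" .
    have ww: "w \<bullet> w = (\<Sum>b\<in>?C. (b \<bullet> w)\<^sup>2)"
      by (subst (1) wex) (simp add: inner_sum_left power2_eq_square)
    have "\<exists>b\<in>?C. b \<bullet> w \<noteq> 0"
    proof (rule ccontr)
      assume "\<not> (\<exists>b\<in>?C. b \<bullet> w \<noteq> 0)"
      then have "w \<bullet> w = 0" unfolding ww by (intro sum.neutral) auto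
      then show False using w by simp
    qed
    then obtain b where b: "b \<in> ?C" "b \<bullet> w \<noteq> 0" by blast
    have lt: "\<alpha>\<^sup>2 < (\<sigma> c)\<^sup>2" if "c \<in> ?C" for c
      using \<sigma>[OF that] \<alpha> by (intro power_strict_mono) auto
    have "\<alpha>\<^sup>2 * (w \<bullet> w) < f w \<bullet> f w"
      unfolding ww fwfw sum_distrib_left
    proof (rule sum_strict_mono_ex1[OF fin])
      show "\<forall>c\<in>?C. \<alpha>\<^sup>2 * (c \<bullet> w)\<^sup>2 \<le> (\<sigma> c)\<^sup>2 * (c \<bullet> w)\<^sup>2"
        using lt by (intro ballI mult_right_mono) (auto simp: less_imp_le)
      show "\<exists>c\<in>?C. \<alpha>\<^sup>2 * (c \<bullet> w)\<^sup>2 < (\<sigma> c)\<^sup>2 * (c \<bullet> w)\<^sup>2"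
        using lt[OF b(1)] b by (intro bexI[of _ b] mult_strict_right_mono) auto
    qed
    then have "(\<alpha> * norm w)\<^sup>2 < (norm (f w))\<^sup>2" by (simp add: power_mult_distrib power2_norm_eq_inner)
    then show ?thesis by (rule power2_less_imp_less) simp
  qed
  show ?thesis using C CW card expand by blast
qed

text \<open>The scan keeps n exactly when \<open>w n\<close> is farther than \<delta> from the span
  of the vectors kept so far. The separation of the kept vectors feeds Hadamard's inequality; the
  approximation of all vectors feeds the rank bound.\<close>

lemma greedy_selection:
  fixes w :: "nat \<Rightarrow> 'b::euclidean_space"
  assumes "0 \<le> \<delta>"
  shows "\<exists>I\<subseteq>{..<n}. inj_on w I \<and> independent (w ` I) \<and>
    (\<forall>i\<in>I. \<forall>u\<in>span (w ` (I \<inter> {..<i})). \<delta> \<le> norm (w i - u)) \<and>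
    (\<forall>i<n. \<exists>u\<in>span (w ` (I \<inter> {..i})). norm (w i - u) \<le> \<delta>)"
proof (induction n)
  case 0
  then show ?case by (intro exI[of _ "{}"]) (auto simp: independent_empty)
next
  case (Suc n)
  then obtain I where I: "I \<subseteq> {..<n}" "inj_on w I" "independent (w ` I)"
    "\<forall>i\<in>I. \<forall>u\<in>span (w ` (I \<inter> {..<i})). \<delta> \<le> norm (w i - u)"
    "\<forall>i<n. \<exists>u\<in>span (w ` (I \<inter> {..i})). norm (w i - u) \<le> \<delta>" by blast
  show ?case
  proof (cases "\<exists>u\<in>span (w ` I). norm (w n - u) \<le> \<delta>")
    case True
    have "I \<inter> {..n} = I" using I(1) by auto
    then have "\<forall>i<Suc n. \<exists>u\<in>span (w ` (I \<inter> {..i})). norm (w i - u) \<le> \<delta>"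
      using I(5) True by (simp add: less_Suc_eq)
    then show ?thesis using I by (intro exI[of _ I]) auto
  next
    case False
    then have gt: "\<And>u. u \<in> span (w ` I) \<Longrightarrow> \<delta> < norm (w n - u)" by force
    have notin: "w n \<notin> span (w ` I)" using gt[of "w n"] assms by auto
    have lt: "insert n I \<inter> {..<i} = I \<inter> {..<i}" if "i \<le> n" for i using that by auto
    have le: "insert n I \<inter> {..i} = I \<inter> {..i}" if "i < n" for i using that by auto
    have In: "I \<inter> {..<n} = I" using I(1) by auto
    show ?thesis
    proof (intro exI[of _ "insert n I"] conjI)
      show "insert n I \<subseteq> {..<Suc n}" using I(1) by auto
      have "w n \<notin> w ` I" using notin span_base[of "w n" "w ` I"] by (rule contrapos_nn)
      then show "inj_on w (insert n I)" using I(2) by auto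
      show "independent (w ` insert n I)"
        using I(3) notin \<open>w n \<notin> w ` I\<close> by (simp add: independent_insert)
      show "\<forall>i\<in>insert n I. \<forall>u\<in>span (w ` (insert n I \<inter> {..<i})). \<delta> \<le> norm (w i - u)"
      proof
        fix i assume i: "i \<in> insert n I"
        then have "i \<le> n" using I(1) by auto
        then show "\<forall>u\<in>span (w ` (insert n I \<inter> {..<i})). \<delta> \<le> norm (w i - u)"
          using i I(4) gt by (cases "i = n") (auto simp: lt In less_imp_le)
      qed
      show "\<forall>i<Suc n. \<exists>u\<in>span (w ` (insert n I \<inter> {..i})). norm (w i - u) \<le> \<delta>"
      proof (intro allI impI)
        fix i assume "i < Suc n"
        show "\<exists>u\<in>span (w ` (insert n I \<inter> {..i})). norm (w i - u) \<le> \<delta>"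
        proof (cases "i = n")
          case True
          \<comment> \<open>Here it matters that the approximating span includes index i itself: a
            kept vector is approximated by itself.\<close>
          then show ?thesis using assms by (intro bexI[of _ "w n"] span_base) auto
        next
          case False
          then have "i < n" using \<open>i < Suc n\<close> by simp
          then show ?thesis using I(5) le by simp
        qed
      qed
    qed
  qed
qed

text \<open>The map P into \<open>span D\<close> satisfies \<open>f w \<bullet> P w =
  (\<Sum>u\<in>D. (f w \<bullet> u)\<^sup>2)\<close>, so a zero of P is orthogonal to D after f, and
  P is injective on \<open>span C\<close>.\<close>

lemma card_le_of_injective_projection:
  fixes f :: "'a::euclidean_space \<Rightarrow> 'b::euclidean_space"
  assumes f: "linear f" and C: "independent C" and D: "finite D"
    and inj: "\<And>w. w \<in> span C \<Longrightarrow> (\<And>u. u \<in> D \<Longrightarrow> f w \<bullet> u = 0) \<Longrightarrow> w = 0"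
  shows "card C \<le> card D"
proof -
  define P where "P w = (\<Sum>u\<in>D. (f w \<bullet> u) *\<^sub>R u)" for w
  have linP: "linear P"
    unfolding P_def by (rule linearI)
      (auto simp: linear_add[OF f] linear_scale[OF f] inner_add_left scaleR_add_left sum.distrib scaleR_sum_right)
  have "w = 0" if "w \<in> span C" "P w = 0" for w
  proof (rule inj[OF that(1)])
    have "0 = f w \<bullet> P w" using that by simp
    also have "\<dots> = (\<Sum>u\<in>D. (f w \<bullet> u)\<^sup>2)" by (simp add: P_def inner_sum_right power2_eq_square)
    finally have "(\<Sum>u\<in>D. (f w \<bullet> u)\<^sup>2) = 0" ..
    then show "f w \<bullet> u = 0" if "u \<in> D" for u
      using that D by (simp add: sum_nonneg_eq_0_iff)
  qed
  then have "inj_on P (span C)"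
    using linear_inj_on_span_iff_independent_image linP by (simp add: linear_injective_on_subspace_0)
  then have "dim (P ` span C) = dim (span C)" using linP by (intro dim_image_eq) (auto simp: span_span)
  moreover have "P ` span C \<subseteq> span D"
    unfolding P_def by (intro image_subsetI span_sum span_scale span_base)
  then have "dim (P ` span C) \<le> dim (span D)" by (rule dim_subset)
  moreover have "dim (span D) \<le> card D" using D dim_le_card[of "span D" D] by simp
  ultimately show ?thesis using C by (simp add: dim_eq_card_independent)
qed

lemma onset_independent: "onset C \<Longrightarrow> independent C"
proof (rule pairwise_orthogonal_independent)
  assume C: "onset C"
  then show "pairwise orthogonal C" by (auto simp: onset_def pairwise_def orthogonal_def)
  show "0 \<notin> C"
  proof
    assume "0 \<in> C"
    then have "(0::'a) \<bullet> 0 = (if (0::'a) = 0 then 1 else 0)" using C unfolding onset_def by blast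
    then show False by simp
  qed
qed

text \<open>If the rank were larger, some \<open>w\<close> in the expanding subspace would have \<open>f w\<close> orthogonal to the selected
  vectors, hence \<open>norm (f w) \<le> \<delta> * (\<Sum>i<k. \<bar>e i \<bullet> w\<bar>) \<le> \<alpha> * norm w\<close>.\<close>

lemma ess_rank_le_selection:
  fixes f :: "'a::euclidean_space \<Rightarrow> 'b::euclidean_space" and e :: "nat \<Rightarrow> 'a"
  assumes f: "linear f" and e: "\<And>i m. i < k \<Longrightarrow> m < k \<Longrightarrow> e i \<bullet> e m = (if i = m then 1 else 0)"
    and I: "finite I" and near: "\<And>i. i < k \<Longrightarrow> \<exists>u\<in>span ((\<lambda>i. f (e i)) ` I). norm (f (e i) - u) \<le> \<delta>"
    and \<delta>: "0 \<le> \<delta>" "\<delta> * sqrt (real k) \<le> \<alpha>"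
  shows "ess_rank \<alpha> (span (e ` {..<k})) f \<le> card I"
proof -
  let ?W = "span (e ` {..<k})" and ?D = "(\<lambda>i. f (e i)) ` I"
  have \<alpha>: "0 \<le> \<alpha>" using \<delta> by (meson mult_nonneg_nonneg order_trans real_sqrt_ge_zero of_nat_0_le_iff)
  obtain C where C: "onset C" "C \<subseteq> ?W" "card C = ess_rank \<alpha> ?W f"
    and ex: "\<forall>w\<in>span C. w \<noteq> 0 \<longrightarrow> \<alpha> * norm w < norm (f w)"
    using ess_rank_expanding[OF subspace_span f \<alpha>] by blast
  obtain u where u: "\<And>i. i < k \<Longrightarrow> u i \<in> span ?D \<and> norm (f (e i) - u i) \<le> \<delta>"
    using near by metis
  have inj: "inj_on e {..<k}"
  proof (rule inj_onI)
    fix i m assume "i \<in> {..<k}" "m \<in> {..<k}" "e i = e m"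
    then show "i = m" using e[of i m] e[of i i] by (simp split: if_splits)
  qed
  have eon: "onset (e ` {..<k})" unfolding onset_def using e inj by (auto simp: inj_on_def)
  have "card C \<le> card ?D"
  proof (rule card_le_of_injective_projection[OF f onset_independent[OF C(1)]])
    fix w assume w: "w \<in> span C" and orth: "\<And>v. v \<in> ?D \<Longrightarrow> f w \<bullet> v = 0"
    have "span C \<subseteq> ?W" using C(2) by (intro span_minimal) auto
    then have "w \<in> ?W" using w by blast
    then have wex: "w = (\<Sum>i<k. (e i \<bullet> w) *\<^sub>R e i)"
      using onset_expand[OF eon] inj by (simp add: sum.reindex)
    have ww: "w \<bullet> w = (\<Sum>i<k. (e i \<bullet> w)\<^sup>2)"
      by (subst (1) wex) (simp add: inner_sum_left power2_eq_square)
    have fw: "f w = (\<Sum>i<k. (e i \<bullet> w) *\<^sub>R f (e i))"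
      by (subst wex) (simp add: linear_sum[OF f] linear_scale[OF f])
    have orth': "f w \<bullet> v = 0" if "v \<in> span ?D" for v
    proof -
      have "subspace {v. f w \<bullet> v = 0}" by (auto simp: subspace_def inner_add_right)
      then have "span ?D \<subseteq> {v. f w \<bullet> v = 0}" using orth by (intro span_minimal) auto
      then show ?thesis using that by blast
    qed
    have "f w \<bullet> f w = (\<Sum>i<k. (e i \<bullet> w) * (f w \<bullet> f (e i)))"
      by (subst (2) fw) (simp add: inner_sum_right)
    \<comment> \<open>Subtracting \<open>u i\<close> is free because \<open>f w\<close> is
      orthogonal to the span containing it, and only the small error \<open>f (e i) - u i\<close>
      remains.\<close>
    also have "\<dots> = (\<Sum>i<k. (e i \<bullet> w) * (f w \<bullet> (f (e i) - u i)))"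
      using u orth' by (intro sum.cong) (auto simp: inner_diff_right)
    also have "\<dots> \<le> (\<Sum>i<k. \<bar>e i \<bullet> w\<bar> * (norm (f w) * \<delta>))"
    proof (rule sum_mono)
      fix i assume i: "i \<in> {..<k}"
      have "\<bar>f w \<bullet> (f (e i) - u i)\<bar> \<le> norm (f w) * norm (f (e i) - u i)" by (rule Cauchy_Schwarz_ineq2)
      also have "\<dots> \<le> norm (f w) * \<delta>" using u i by (intro mult_left_mono) auto
      finally have "\<bar>e i \<bullet> w\<bar> * \<bar>f w \<bullet> (f (e i) - u i)\<bar> \<le> \<bar>e i \<bullet> w\<bar> * (norm (f w) * \<delta>)" by (intro mult_left_mono) auto
      then show "(e i \<bullet> w) * (f w \<bullet> (f (e i) - u i)) \<le> \<bar>e i \<bullet> w\<bar> * (norm (f w) * \<delta>)"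
        unfolding abs_mult[symmetric] by (meson abs_le_D1 order_trans abs_ge_self)
    qed
    also have "\<dots> = norm (f w) * (\<delta> * (\<Sum>i<k. \<bar>e i \<bullet> w\<bar> * 1))" by (simp add: sum_distrib_left sum_distrib_right ac_simps)
    also have "\<dots> \<le> norm (f w) * (\<delta> * (sqrt (real k) * norm w))"
    proof (intro mult_left_mono)
      have "(\<Sum>i<k. \<bar>e i \<bullet> w\<bar> * 1)\<^sup>2 \<le> (\<Sum>i<k. \<bar>e i \<bullet> w\<bar>\<^sup>2) * (\<Sum>i<k. 1\<^sup>2)" by (rule Cauchy_Schwarz_ineq_sum)
      also have "\<dots> = (sqrt (real k) * norm w)\<^sup>2"
        using ww by (simp add: power_mult_distrib power2_norm_eq_inner)
      finally show "(\<Sum>i<k. \<bar>e i \<bullet> w\<bar> * 1) \<le> sqrt (real k) * norm w" by (rule power2_le_imp_le) simp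
    qed (use \<delta> in auto)
    also have "\<dots> \<le> norm (f w) * (\<alpha> * norm w)"
      using mult_right_mono[OF \<delta>(2), of "norm w"] by (intro mult_left_mono) (auto simp: mult.assoc)
    finally have le: "norm (f w) * norm (f w) \<le> norm (f w) * (\<alpha> * norm w)"
      by (simp add: power2_norm_eq_inner flip: power2_eq_square)
    show "w = 0"
    proof (rule ccontr)
      assume "w \<noteq> 0"
      then have lt: "\<alpha> * norm w < norm (f w)" using ex w by blast
      then have "0 < norm (f w)" using \<alpha> by (meson le_less_trans mult_nonneg_nonneg norm_ge_zero)
      then have "norm (f w) * (\<alpha> * norm w) < norm (f w) * norm (f w)" using lt by (intro mult_strict_left_mono)
      then show False using le by linarith
    qed
  qed (use I in simp)
  also have "card ?D \<le> card I" using I by (rule card_image_le)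
  finally show ?thesis using C(3) by simp
qed

text \<open>The increasing enumeration of I turns smaller selected indices into preceding positions,
  as \<open>det_on_le_prod\<close> expects.\<close>

lemma det_on_le_selection:
  fixes w :: "nat \<Rightarrow> 'b::euclidean_space"
  assumes V: "subspace V" and A: "pos_form V A" and w: "\<And>i. i \<in> I \<Longrightarrow> w i \<in> V" and \<delta>: "0 < \<delta>"
    and I: "finite I" "card I = dim V"
    and dist: "\<And>i u. i \<in> I \<Longrightarrow> u \<in> span (w ` (I \<inter> {..<i})) \<Longrightarrow> \<delta> \<le> norm (w i - u)"
  shows "\<delta> ^ (2 * dim V) * det_on V A \<le> (\<Prod>i\<in>I. w i \<bullet> A (w i))"
proof -
  let ?xs = "sorted_list_of_set I"
  have xs: "set ?xs = I" "length ?xs = dim V" "sorted_wrt (<) ?xs" "distinct ?xs" using I by (auto simp: strict_sorted_iff)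
  have xI: "?xs ! m \<in> I" if "m < dim V" for m using that xs nth_mem by metis
  have "\<delta> ^ (2 * dim V) * det_on V A \<le> (\<Prod>m<dim V. w (?xs ! m) \<bullet> A (w (?xs ! m)))"
  proof (rule det_on_le_prod[OF V A _ \<delta>])
    show "w (?xs ! m) \<in> V" if "m < dim V" for m using xI[OF that] w by blast
    fix m u assume m: "m < dim V" and u: "u \<in> span ((\<lambda>m. w (?xs ! m)) ` {..<m})"
    have "?xs ! i \<in> I \<inter> {..<?xs ! m}" if "i < m" for i
      using that m xI xs by (auto simp: sorted_wrt_nth_less)
    then have "span ((\<lambda>m. w (?xs ! m)) ` {..<m}) \<subseteq> span (w ` (I \<inter> {..<?xs ! m}))"
      by (intro span_mono) auto
    then show "\<delta> \<le> norm (w (?xs ! m) - u)" using u dist[OF xI[OF m]] by blast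
  qed
  also have "\<dots> = (\<Prod>i\<in>I. w i \<bullet> A (w i))"
  proof -
    have "bij_betw ((!) ?xs) {..<dim V} I" using xs by (intro bij_betw_nth) auto
    then show ?thesis by (rule prod.reindex_bij_betw)
  qed
  finally show ?thesis .
qed

text \<open>Summation by parts as an induction: the partial sum plus \<beta> is nonnegative, so in
  front of it \<open>x (n - 1)\<close> may be raised to \<open>x n\<close>.\<close>

lemma abel_bound:
  fixes x c :: "nat \<Rightarrow> real"
  assumes mono: "\<And>i. Suc i < n \<Longrightarrow> x i \<le> x (Suc i)" and S: "\<And>k. k \<le> n \<Longrightarrow> - \<beta> \<le> (\<Sum>i<k. c i)" and n: "0 < n"
  shows "(\<Sum>i<n. c i * x i) \<le> ((\<Sum>i<n. c i) + \<beta>) * x (n - 1) - \<beta> * x 0"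
  using assms
proof (induction n)
  case (Suc n)
  show ?case
  proof (cases "n = 0")
    case False
    then have IH: "(\<Sum>i<n. c i * x i) \<le> ((\<Sum>i<n. c i) + \<beta>) * x (n - 1) - \<beta> * x 0"
      using Suc by auto
    have "((\<Sum>i<n. c i) + \<beta>) * x (n - 1) \<le> ((\<Sum>i<n. c i) + \<beta>) * x n"
      using Suc.prems(1)[of "n - 1"] Suc.prems(2)[of n] False by (intro mult_left_mono) auto
    then show ?thesis using IH by (simp add: algebra_simps)
  qed (simp add: algebra_simps)
qed simp

lemma sorted_eigenbasis:
  fixes M :: "'a::euclidean_space \<Rightarrow> 'a"
  assumes M: "pos_form UNIV M"
  obtains e where "\<And>i k. i < DIM('a) \<Longrightarrow> k < DIM('a) \<Longrightarrow> e i \<bullet> e k = (if i = k then 1 else 0)"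
    "\<And>i. Suc i < DIM('a) \<Longrightarrow> e i \<bullet> M (e i) \<le> e (Suc i) \<bullet> M (e (Suc i))"
    "det_on UNIV M = (\<Prod>i<DIM('a). e i \<bullet> M (e i))"
proof -
  let ?d = "DIM('a)"
  have lin: "linear M" and sym: "\<And>x y. x \<bullet> M y = y \<bullet> M x" using M by (auto simp: pos_form_def)
  obtain b where b: "form_onb (UNIV :: 'a set) (\<lambda>x. x) b"
    and diag: "\<And>i k. i < dim (UNIV :: 'a set) \<Longrightarrow> k < dim (UNIV :: 'a set) \<Longrightarrow> i \<noteq> k \<Longrightarrow> b i \<bullet> M (b k) = 0"
    using simultaneous_diagonalisation[OF subspace_UNIV pos_form_id lin sym] by blast
  define L where "L i = b i \<bullet> M (b i)" for i
  define xs where "xs = sort_key L [0..<?d]"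
  have xs: "length xs = ?d" "distinct xs" "set xs = {..<?d}" "sorted (map L xs)"
    by (auto simp: xs_def)
  have xi: "xs ! i < ?d" if "i < ?d" for i using that xs nth_mem by (metis lessThan_iff)
  show thesis
  proof (rule that[of "\<lambda>i. b (xs ! i)"])
    show "b (xs ! i) \<bullet> b (xs ! k) = (if i = k then 1 else 0)" if "i < ?d" "k < ?d" for i k
      using b xi that xs by (auto simp: form_onb_def nth_eq_iff_index_eq)
    show "b (xs ! i) \<bullet> M (b (xs ! i)) \<le> b (xs ! Suc i) \<bullet> M (b (xs ! Suc i))" if "Suc i < ?d" for i
      using sorted_nth_mono[OF xs(4), of i "Suc i"] that xs(1) by (simp add: L_def)
    have "det_on (UNIV :: 'a set) (\<lambda>x. x) = 1" by (rule det_on_id) simp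
    then have "det_on UNIV M = (\<Prod>i<?d. L i)"
      using det_on_diag[OF subspace_UNIV b linear_id[unfolded id_def] lin diag]
      by (simp add: L_def)
    also have "\<dots> = (\<Prod>i<?d. L (xs ! i))"
    proof -
      have "bij_betw ((!) xs) {..<?d} {..<?d}" using xs by (intro bij_betw_nth) auto
      then show ?thesis by (rule prod.reindex_bij_betw[symmetric])
    qed
    finally show "det_on UNIV M = (\<Prod>i<?d. b (xs ! i) \<bullet> M (b (xs ! i)))" by (simp add: L_def)
  qed
qed

text \<open>Of M = \<open>form_sum A\<close> only three facts enter: it dominates each single term,
  is at most N and is at least 1 / t. After taking logarithms the estimate is linear in the
  \<open>ln (\<Lambda> i)\<close>.\<close>

lemma det_bound:
  fixes J :: "'j set" and V :: "'j \<Rightarrow> 'b::euclidean_space set" and l :: "'j \<Rightarrow> 'a::euclidean_space \<Rightarrow> 'b"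
    and M :: "'a \<Rightarrow> 'a"
  assumes datum: "BL_datum J V l q" and \<alpha>: "\<forall>j\<in>J. 0 < \<alpha> j" and \<beta>: "0 \<le> \<beta>" and perc: "perceptive J l q \<alpha> \<beta>"
    and surj: "\<forall>j\<in>J. ess_rank (\<alpha> j) UNIV (l j) = dim (V j)"
    and M: "pos_form UNIV M" and A: "\<And>j. j \<in> J \<Longrightarrow> pos_form (V j) (A j)"
    and AM: "\<And>j x. j \<in> J \<Longrightarrow> q j * (l j x \<bullet> A j (l j x)) \<le> x \<bullet> M x"
    and N: "\<And>x. x \<bullet> M x \<le> N * (x \<bullet> x)" and t: "\<And>x. x \<bullet> x \<le> t * (x \<bullet> M x)"
  shows "(\<Prod>j\<in>J. det_on (V j) (A j) powr q j) \<le>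
    real DIM('a) powr BL_A J V q * (\<Prod>j\<in>J. q j powr (- (q j * dim (V j)))) * (\<Prod>j\<in>J. \<alpha> j powr (- (2 * (q j * dim (V j)))))
     * N powr (BL_A J V q - DIM('a) + \<beta>) * t powr \<beta> * det_on UNIV M"
proof -
  let ?d = "DIM('a)"
  have J: "finite J" and V: "\<And>j. j \<in> J \<Longrightarrow> subspace (V j)" and l: "\<And>j. j \<in> J \<Longrightarrow> linear (l j)"
    and lV: "\<And>j x. j \<in> J \<Longrightarrow> l j x \<in> V j" and q: "\<And>j. j \<in> J \<Longrightarrow> 0 < q j"
    using datum by (auto simp: BL_datum_def)
  obtain e :: "nat \<Rightarrow> 'a" where e: "\<And>i k. i < ?d \<Longrightarrow> k < ?d \<Longrightarrow> e i \<bullet> e k = (if i = k then 1 else 0)"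
    and mono: "\<And>i. Suc i < ?d \<Longrightarrow> e i \<bullet> M (e i) \<le> e (Suc i) \<bullet> M (e (Suc i))"
    and detM: "det_on UNIV M = (\<Prod>i<?d. e i \<bullet> M (e i))"
    using sorted_eigenbasis[OF M] by blast
  define \<Lambda> where "\<Lambda> i = e i \<bullet> M (e i)" for i
  have ee: "e i \<bullet> e i = 1" if "i < ?d" for i using e[OF that that] by simp
  have \<Lambda>0: "0 < \<Lambda> i" if "i < ?d" for i
  proof -
    have "e i \<noteq> 0" using ee[OF that] by auto
    then show ?thesis using M by (simp add: pos_form_def \<Lambda>_def)
  qed
  have \<Lambda>N: "\<Lambda> i \<le> N" if "i < ?d" for i using N[of "e i"] ee[OF that] by (simp add: \<Lambda>_def)
  have \<Lambda>t: "1 \<le> t * \<Lambda> i" if "i < ?d" for i using t[of "e i"] ee[OF that] by (simp add: \<Lambda>_def)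
  have d: "0 < ?d" by simp
  have N0: "0 < N" using \<Lambda>0[OF d] \<Lambda>N[OF d] by linarith
  have t0: "0 < t"
  proof (rule ccontr)
    assume "\<not> 0 < t"
    then have "t * \<Lambda> 0 \<le> 0" using \<Lambda>0[OF d] by (simp add: mult_le_0_iff)
    then show False using \<Lambda>t[OF d] by linarith
  qed
  \<comment> \<open>The rank bound needs \<open>\<delta> * sqrt k \<le> \<alpha>\<close> for all k
    up to the dimension d; this is where the power of d in the constant is born.\<close>
  define \<delta> where "\<delta> j = \<alpha> j / sqrt (real ?d)" for j
  have \<delta>: "0 < \<delta> j" if "j \<in> J" for j using \<alpha> that by (simp add: \<delta>_def)
  have finI: "finite I" if "I \<subseteq> {..<?d}" for I using that finite_subset by blast
  have "\<forall>j\<in>J. \<exists>I\<subseteq>{..<?d}. inj_on (\<lambda>i. l j (e i)) I \<and> independent ((\<lambda>i. l j (e i)) ` I) \<and>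
    (\<forall>i\<in>I. \<forall>u\<in>span ((\<lambda>i. l j (e i)) ` (I \<inter> {..<i})). \<delta> j \<le> norm (l j (e i) - u)) \<and>
    (\<forall>i<?d. \<exists>u\<in>span ((\<lambda>i. l j (e i)) ` (I \<inter> {..i})). norm (l j (e i) - u) \<le> \<delta> j)"
    using greedy_selection[OF less_imp_le[OF \<delta>]] by blast
  from bchoice[OF this] obtain I where I: "\<forall>j\<in>J. I j \<subseteq> {..<?d} \<and> inj_on (\<lambda>i. l j (e i)) (I j) \<and> independent ((\<lambda>i. l j (e i)) ` I j) \<and>
    (\<forall>i\<in>I j. \<forall>u\<in>span ((\<lambda>i. l j (e i)) ` (I j \<inter> {..<i})). \<delta> j \<le> norm (l j (e i) - u)) \<and>
    (\<forall>i<?d. \<exists>u\<in>span ((\<lambda>i. l j (e i)) ` (I j \<inter> {..i})). norm (l j (e i) - u) \<le> \<delta> j)" ..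
  have rank: "ess_rank (\<alpha> j) (span (e ` {..<k})) (l j) \<le> card (I j \<inter> {..<k})" if j: "j \<in> J" and k: "k \<le> ?d" for j k
  proof (rule ess_rank_le_selection[OF l[OF j]])
    show "e i \<bullet> e m = (if i = m then 1 else 0)" if "i < k" "m < k" for i m using e that k by simp
    show "finite (I j \<inter> {..<k})" by simp
    show "0 \<le> \<delta> j" using \<delta>[OF j] by simp
    have "\<delta> j * sqrt (real k) \<le> \<delta> j * sqrt (real ?d)" using k \<delta>[OF j] by (intro mult_left_mono) auto
    then show "\<delta> j * sqrt (real k) \<le> \<alpha> j" by (simp add: \<delta>_def)
    fix i assume i: "i < k"
    have "span ((\<lambda>i. l j (e i)) ` (I j \<inter> {..i})) \<subseteq> span ((\<lambda>i. l j (e i)) ` (I j \<inter> {..<k}))"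
      using i by (intro span_mono image_mono) auto
    moreover have "\<exists>u\<in>span ((\<lambda>i. l j (e i)) ` (I j \<inter> {..i})). norm (l j (e i) - u) \<le> \<delta> j"
      using I j i k by auto
    ultimately show "\<exists>u\<in>span ((\<lambda>i. l j (e i)) ` (I j \<inter> {..<k})). norm (l j (e i) - u) \<le> \<delta> j" by blast
  qed
  have dimk: "dim (span (e ` {..<k})) = k" if k: "k \<le> ?d" for k
  proof -
    have inj: "inj_on e {..<k}"
    proof (rule inj_onI)
      fix i m assume "i \<in> {..<k}" "m \<in> {..<k}" "e i = e m"
      then show "i = m" using e[of i m] ee[of i] k by (simp split: if_splits)
    qed
    have "onset (e ` {..<k})" unfolding onset_def using e inj k by (auto simp: inj_on_def)
    then have "dim (e ` {..<k}) = card (e ` {..<k})" by (intro dim_eq_card_independent onset_independent)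
    then show ?thesis using inj by (simp add: card_image)
  qed
  have spand: "span (e ` {..<?d}) = UNIV"
    using dimk[of ?d] dim_eq_full[of "span (e ` {..<?d})"] by (simp add: span_span)
  have cardI: "card (I j) = dim (V j)" if j: "j \<in> J" for j
  \<comment> \<open>Selected vectors are independent in \<open>V j\<close>, which bounds their
    number above; the rank bound for k = d with the full essential rank of \<open>l j\<close> bounds
    it below.\<close>
  proof (rule antisym)
    have "(\<lambda>i. l j (e i)) ` I j \<subseteq> V j" using lV[OF j] by blast
    then have "card ((\<lambda>i. l j (e i)) ` I j) \<le> dim (V j)" using I j independent_card_le_dim by blast
    then show "card (I j) \<le> dim (V j)" using I j by (simp add: card_image)
    have "I j \<inter> {..<?d} = I j" using I j by auto
    then show "dim (V j) \<le> card (I j)" using rank[OF j order_refl] spand surj j by simp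
  qed
  have lndet: "ln (det_on (V j) (A j)) \<le> (\<Sum>i\<in>I j. ln (\<Lambda> i)) - dim (V j) * ln (q j) + dim (V j) * ln (real ?d) - 2 * (dim (V j) * ln (\<alpha> j))"
    if j: "j \<in> J" for j
  proof -
    have Id: "i < ?d" if "i \<in> I j" for i using I j that by auto
    have detp: "0 < det_on (V j) (A j)"
      using A[OF j] pos_form_nonneg[OF A[OF j]] V[OF j] by (intro det_on_semidefinite(3)) (auto simp: pos_form_def)
    have "\<delta> j ^ (2 * dim (V j)) * det_on (V j) (A j) \<le> (\<Prod>i\<in>I j. l j (e i) \<bullet> A j (l j (e i)))"
    proof (rule det_on_le_selection[OF V[OF j] A[OF j] _ \<delta>[OF j]])
      show "finite (I j)" using I j finI by blast
      show "\<delta> j \<le> norm (l j (e i) - u)" if "i \<in> I j" "u \<in> span ((\<lambda>i. l j (e i)) ` (I j \<inter> {..<i}))" for i u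
        using bspec[OF I j] that by blast
    qed (use lV[OF j] cardI[OF j] in auto)
    \<comment> \<open>Testing the comparison with M at eigenvectors replaces A j by eigenvalues, at
      the price of 1 / q j for each selected index.\<close>
    also have "\<dots> \<le> (\<Prod>i\<in>I j. \<Lambda> i / q j)"
    proof (rule prod_mono)
      fix i assume i: "i \<in> I j"
      have "l j (e i) \<bullet> A j (l j (e i)) \<le> \<Lambda> i / q j"
        using AM[OF j, of "e i"] q[OF j] by (simp add: field_simps \<Lambda>_def)
      then show "0 \<le> l j (e i) \<bullet> A j (l j (e i)) \<and> l j (e i) \<bullet> A j (l j (e i)) \<le> \<Lambda> i / q j"
        using pos_form_nonneg[OF A[OF j] lV[OF j]] by simp
    qed
    finally have "ln (\<delta> j ^ (2 * dim (V j)) * det_on (V j) (A j)) \<le> ln (\<Prod>i\<in>I j. \<Lambda> i / q j)"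
      using \<delta>[OF j] detp q[OF j] \<Lambda>0 Id by (subst ln_le_cancel_iff) (auto intro!: prod_pos mult_pos_pos)
    moreover have "ln (\<delta> j ^ (2 * dim (V j)) * det_on (V j) (A j)) = 2 * dim (V j) * (ln (\<alpha> j) - ln (real ?d) / 2) + ln (det_on (V j) (A j))"
    proof -
      have "0 < \<alpha> j" using \<alpha> j by blast
      then have "ln (\<delta> j) = ln (\<alpha> j) - ln (real ?d) / 2" by (simp add: \<delta>_def ln_div ln_sqrt)
      then show ?thesis using \<delta>[OF j] detp by (simp add: ln_mult ln_realpow)
    qed
    moreover have "ln (\<Prod>i\<in>I j. \<Lambda> i / q j) = (\<Sum>i\<in>I j. ln (\<Lambda> i) - ln (q j))"
    proof -
      have L: "0 < \<Lambda> i" if "i \<in> I j" for i using \<Lambda>0[OF Id[OF that]] .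
      have "finite (I j)" using I j finI by blast
      moreover have "0 < \<Lambda> i / q j" if "i \<in> I j" for i using L[OF that] q[OF j] by simp
      ultimately have "ln (\<Prod>i\<in>I j. \<Lambda> i / q j) = (\<Sum>i\<in>I j. ln (\<Lambda> i / q j))"
        by (intro ln_prod) (metis less_irrefl)+
      also have "\<dots> = (\<Sum>i\<in>I j. ln (\<Lambda> i) - ln (q j))"
      proof (intro sum.cong refl)
        show "ln (\<Lambda> i / q j) = ln (\<Lambda> i) - ln (q j)" if "i \<in> I j" for i
          using L[OF that] q[OF j] by (simp add: ln_div)
      qed
      finally show ?thesis .
    qed
    ultimately show ?thesis using cardI[OF j] by (simp add: sum_subtractf algebra_simps)
  qed
  \<comment> \<open>The exponent of \<Lambda> i in the quotient: the weights of the j that select i,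
    minus 1 for its occurrence in det M.\<close>
  define c where "c i = (\<Sum>j\<in>J. q j * (if i \<in> I j then 1 else 0)) - 1" for i
  have csum: "(\<Sum>i<k. c i) = (\<Sum>j\<in>J. q j * card (I j \<inter> {..<k})) - k" for k
  proof -
    have "(\<Sum>i<k. (if i \<in> I j then 1 else 0)) = real (card (I j \<inter> {..<k}))" for j
      by (simp add: sum.If_cases Int_commute)
    then show ?thesis
      unfolding c_def sum_subtractf by (subst sum.swap) (simp flip: sum_distrib_left)
  qed
  have A_eq: "BL_A J V q = (\<Sum>j\<in>J. q j * card (I j \<inter> {..<?d}))"
    unfolding BL_A_def
  proof (rule sum.cong)
    fix j assume j: "j \<in> J"
    have "I j \<inter> {..<?d} = I j" using I j by auto
    then show "q j * dim (V j) = q j * card (I j \<inter> {..<?d})" using cardI[OF j] by simp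
  qed simp
  have abel: "(\<Sum>i<?d. c i * ln (\<Lambda> i)) \<le> ((\<Sum>i<?d. c i) + \<beta>) * ln (\<Lambda> (?d - 1)) - \<beta> * ln (\<Lambda> 0)"
  proof (rule abel_bound)
    show "ln (\<Lambda> i) \<le> ln (\<Lambda> (Suc i))" if "Suc i < ?d" for i
      using mono[OF that] \<Lambda>0[of i] \<Lambda>0[of "Suc i"] that by (simp add: \<Lambda>_def)
    \<comment> \<open>Perceptivity is applied to the span of the k eigenvectors with the smallest
      eigenvalues; the rank bound compares ranks with numbers of selected indices.\<close>
    show "- \<beta> \<le> (\<Sum>i<k. c i)" if k: "k \<le> ?d" for k
    proof -
      have "real k - \<beta> \<le> (\<Sum>j\<in>J. q j * real (ess_rank (\<alpha> j) (span (e ` {..<k})) (l j)))"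
        using perc dimk[OF k] subspace_span unfolding perceptive_def by (metis)
      also have "\<dots> \<le> (\<Sum>j\<in>J. q j * card (I j \<inter> {..<k}))"
        using rank k q by (intro sum_mono mult_left_mono) (auto simp: less_imp_le)
      finally show ?thesis unfolding csum by simp
    qed
  qed simp
  have SA: "(\<Sum>i<?d. c i) = BL_A J V q - ?d" unfolding csum A_eq ..
  have S0: "0 \<le> BL_A J V q - ?d + \<beta>"
  proof -
    have "real ?d - \<beta> \<le> (\<Sum>j\<in>J. q j * real (ess_rank (\<alpha> j) UNIV (l j)))"
      using perc subspace_UNIV unfolding perceptive_def by (metis dim_UNIV)
    then show ?thesis using surj by (simp add: BL_A_def)
  qed
  have "(BL_A J V q - ?d + \<beta>) * ln (\<Lambda> (?d - 1)) \<le> (BL_A J V q - ?d + \<beta>) * ln N"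
    using \<Lambda>N[of "?d - 1"] \<Lambda>0[of "?d - 1"] S0 N0 by (intro mult_left_mono) auto
  moreover have "- \<beta> * ln (\<Lambda> 0) \<le> \<beta> * ln t"
  proof -
    have "ln 1 \<le> ln (t * \<Lambda> 0)" using \<Lambda>t[OF d] by (subst ln_le_cancel_iff) auto
    then have "0 \<le> ln t + ln (\<Lambda> 0)" using t0 \<Lambda>0[OF d] by (simp add: ln_mult)
    then have "\<beta> * (- ln (\<Lambda> 0)) \<le> \<beta> * ln t" using \<beta> by (intro mult_left_mono) auto
    then show ?thesis by simp
  qed
  ultimately have bound: "(\<Sum>i<?d. c i * ln (\<Lambda> i)) \<le> (BL_A J V q - ?d + \<beta>) * ln N + \<beta> * ln t"
    using abel unfolding SA by linarith
  have "(\<Sum>j\<in>J. q j * (\<Sum>i\<in>I j. ln (\<Lambda> i))) = (\<Sum>i<?d. (\<Sum>j\<in>J. q j * (if i \<in> I j then 1 else 0)) * ln (\<Lambda> i))"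
  proof -
    have "(\<Sum>i\<in>I j. ln (\<Lambda> i)) = (\<Sum>i<?d. (if i \<in> I j then 1 else 0) * ln (\<Lambda> i))" if j: "j \<in> J" for j
    proof -
      have "{..<?d} \<inter> {i. i \<in> I j} = I j" using I j by auto
      then show ?thesis by (simp add: if_distrib[of "\<lambda>u. u * _"] sum.If_cases cong: if_cong)
    qed
    then have "(\<Sum>j\<in>J. q j * (\<Sum>i\<in>I j. ln (\<Lambda> i))) = (\<Sum>j\<in>J. \<Sum>i<?d. q j * (if i \<in> I j then 1 else 0) * ln (\<Lambda> i))"
      by (simp add: sum_distrib_left mult.assoc)
    then show ?thesis by (subst (asm) sum.swap) (simp add: sum_distrib_right)
  qed
  also have "\<dots> = (\<Sum>i<?d. c i * ln (\<Lambda> i)) + (\<Sum>i<?d. ln (\<Lambda> i))"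
    by (simp add: c_def left_diff_distrib sum_subtractf)
  finally have split: "(\<Sum>j\<in>J. q j * (\<Sum>i\<in>I j. ln (\<Lambda> i))) = (\<Sum>i<?d. c i * ln (\<Lambda> i)) + (\<Sum>i<?d. ln (\<Lambda> i))" .
  have lnM: "ln (det_on UNIV M) = (\<Sum>i<?d. ln (\<Lambda> i))"
    unfolding detM \<Lambda>_def[symmetric] by (intro ln_prod) (auto dest: \<Lambda>0)
  have "(\<Sum>j\<in>J. q j * ln (det_on (V j) (A j))) \<le> (\<Sum>j\<in>J. q j * ((\<Sum>i\<in>I j. ln (\<Lambda> i)) - dim (V j) * ln (q j) + dim (V j) * ln (real ?d) - 2 * (dim (V j) * ln (\<alpha> j))))"
    using lndet q by (intro sum_mono mult_left_mono) (auto simp: less_imp_le)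
  also have "\<dots> = (\<Sum>j\<in>J. q j * (\<Sum>i\<in>I j. ln (\<Lambda> i))) + (\<Sum>j\<in>J. - (q j * dim (V j)) * ln (q j)) + BL_A J V q * ln (real ?d)
      + (\<Sum>j\<in>J. - (2 * (q j * dim (V j))) * ln (\<alpha> j))"
    unfolding BL_A_def by (simp add: sum.distrib sum_subtractf sum_negf sum_distrib_left sum_distrib_right algebra_simps)
  finally have log: "(\<Sum>j\<in>J. q j * ln (det_on (V j) (A j))) \<le> BL_A J V q * ln (real ?d) + (\<Sum>j\<in>J. - (q j * dim (V j)) * ln (q j))
      + (\<Sum>j\<in>J. - (2 * (q j * dim (V j))) * ln (\<alpha> j)) + (BL_A J V q - ?d + \<beta>) * ln N + \<beta> * ln t + ln (det_on UNIV M)"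
    using bound unfolding split lnM by linarith
  have detMp: "0 < det_on UNIV M" unfolding detM \<Lambda>_def[symmetric] using \<Lambda>0 by (intro prod_pos) auto
  have detp: "det_on (V j) (A j) \<noteq> 0" if j: "j \<in> J" for j
  proof -
    have "0 < det_on (V j) (A j)"
      using A[OF j] pos_form_nonneg[OF A[OF j]] V[OF j] by (intro det_on_semidefinite(3)) (auto simp: pos_form_def)
    then show ?thesis by simp
  qed
  have "(\<Prod>j\<in>J. det_on (V j) (A j) powr q j) = exp (\<Sum>j\<in>J. q j * ln (det_on (V j) (A j)))"
    unfolding exp_sum[OF J] by (intro prod.cong) (auto simp: powr_def detp)
  also have "\<dots> \<le> exp (BL_A J V q * ln (real ?d) + (\<Sum>j\<in>J. - (q j * dim (V j)) * ln (q j))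
      + (\<Sum>j\<in>J. - (2 * (q j * dim (V j))) * ln (\<alpha> j)) + (BL_A J V q - ?d + \<beta>) * ln N + \<beta> * ln t + ln (det_on UNIV M))"
    using log by simp
  also have "\<dots> = real ?d powr BL_A J V q * (\<Prod>j\<in>J. q j powr (- (q j * dim (V j)))) * (\<Prod>j\<in>J. \<alpha> j powr (- (2 * (q j * dim (V j)))))
     * N powr (BL_A J V q - ?d + \<beta>) * t powr \<beta> * det_on UNIV M"
  proof -
    have 1: "exp (\<Sum>j\<in>J. - (q j * dim (V j)) * ln (q j)) = (\<Prod>j\<in>J. q j powr (- (q j * dim (V j))))"
      unfolding exp_sum[OF J] using q by (intro prod.cong) (force simp: powr_def)+
    have 2: "exp (\<Sum>j\<in>J. - (2 * (q j * dim (V j))) * ln (\<alpha> j)) = (\<Prod>j\<in>J. \<alpha> j powr (- (2 * (q j * dim (V j)))))"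
      unfolding exp_sum[OF J] using \<alpha> by (intro prod.cong) (force simp: powr_def)+
    show ?thesis unfolding exp_add 1 2 using N0 t0 detMp by (simp add: powr_def)
  qed
  finally show ?thesis .
qed

section \<open>Maximising Gaussians\<close>

text \<open>Tychonoff's theorem; the topology of a function type is that of pointwise
  convergence.\<close>

lemma compact_PiE_UNIV:
  fixes S :: "'i \<Rightarrow> 'x::topological_space set"
  assumes "\<And>i. compact (S i)"
  shows "compact {f. \<forall>i. f i \<in> S i}"
proof -
  have "compactin (product_topology (\<lambda>_. euclidean) UNIV) (PiE UNIV S)"
    using assms by (simp add: compactin_PiE)
  moreover have "PiE UNIV S = {f. \<forall>i. f i \<in> S i}" by auto
  ultimately show ?thesis by (simp add: euclidean_product_topology)
qed

lemma det_on_cong: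
  assumes "subspace V" "\<And>x. x \<in> V \<Longrightarrow> R x = R' x"
  shows "det_on V R = det_on V R'"
  unfolding det_on_def
proof (intro sum.cong refl arg_cong2[where f = "(*)"] prod.cong)
  fix p b assume "p \<in> {p. p permutes onb V}" "b \<in> onb V"
  then have "p b \<in> V" using is_onb_onb[OF assms(1)] permutes_in_image[of p "onb V" b] by (auto simp: is_onb_def)
  then show "b \<bullet> R (p b) = b \<bullet> R' (p b)" using assms(2) by simp
qed

definition proj_on :: "'b::euclidean_space set \<Rightarrow> 'b \<Rightarrow> 'b" where
  "proj_on V x = (\<Sum>b\<in>onb V. (b \<bullet> x) *\<^sub>R b)"

lemma linear_proj_on: "linear (proj_on V)"
  unfolding proj_on_def
  by (rule linearI) (auto simp: inner_add_right scaleR_add_left sum.distrib scaleR_sum_right)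

lemma proj_on_in: "subspace V \<Longrightarrow> proj_on V x \<in> V"
  unfolding proj_on_def using is_onb_onb[of V] by (intro subspace_sum subspace_scale) (auto simp: is_onb_def)

lemma proj_on_id: "subspace V \<Longrightarrow> x \<in> V \<Longrightarrow> proj_on V x = x"
  unfolding proj_on_def by (intro onset_expand onset_onb) (simp_all add: span_onb)

lemma proj_on_inner: "subspace V \<Longrightarrow> w \<in> V \<Longrightarrow> w \<bullet> proj_on V x = w \<bullet> x"
proof -
  assume V: "subspace V" and w: "w \<in> V"
  have "w \<bullet> proj_on V x = proj_on V w \<bullet> x"
    by (simp add: proj_on_def inner_sum_left inner_sum_right inner_commute mult.commute)
  then show ?thesis using proj_on_id[OF V w] by simp
qed

lemma norm_proj_on: "subspace V \<Longrightarrow> norm (proj_on V x) \<le> norm x"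
proof -
  assume V: "subspace V"
  have "(norm (proj_on V x))\<^sup>2 = proj_on V x \<bullet> x"
    by (simp add: power2_norm_eq_inner proj_on_inner[OF V proj_on_in[OF V]])
  also have "\<dots> \<le> norm (proj_on V x) * norm x" by (rule norm_cauchy_schwarz)
  finally show ?thesis by (cases "proj_on V x = 0") (auto simp: power2_eq_square)
qed

text \<open>The maps \<open>0 \<le> A \<le> R\<close> on \<open>V\<close>, extended by zero to the orthogonal complement so that they form a
  compact set in the topology of pointwise convergence.\<close>

definition form_interval :: "'b::euclidean_space set \<Rightarrow> ('b \<Rightarrow> 'b) \<Rightarrow> ('b \<Rightarrow> 'b) set" where
  "form_interval V R = {A. (\<forall>x y. A (x + y) = A x + A y) \<and> (\<forall>c x. A (c *\<^sub>R x) = c *\<^sub>R A x) \<and> (\<forall>x. A x \<in> V) \<and>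
     (\<forall>x. A x = A (proj_on V x)) \<and> (\<forall>x\<in>V. \<forall>y\<in>V. x \<bullet> A y = y \<bullet> A x) \<and> (\<forall>x\<in>V. 0 \<le> x \<bullet> A x \<and> x \<bullet> A x \<le> x \<bullet> R x)}"

lemma form_intervalD:
  assumes "A \<in> form_interval V R"
  shows "linear A" "A x \<in> V" "A x = A (proj_on V x)" "x \<in> V \<Longrightarrow> y \<in> V \<Longrightarrow> x \<bullet> A y = y \<bullet> A x"
    "x \<in> V \<Longrightarrow> 0 \<le> x \<bullet> A x" "x \<in> V \<Longrightarrow> x \<bullet> A x \<le> x \<bullet> R x"
  using assms unfolding form_interval_def by (auto intro: linearI)

lemma form_intervalI:
  assumes "linear A" "\<And>x. A x \<in> V" "\<And>x. A x = A (proj_on V x)" "\<And>x y. x \<in> V \<Longrightarrow> y \<in> V \<Longrightarrow> x \<bullet> A y = y \<bullet> A x"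
    "\<And>x. x \<in> V \<Longrightarrow> 0 \<le> x \<bullet> A x" "\<And>x. x \<in> V \<Longrightarrow> x \<bullet> A x \<le> x \<bullet> R x"
  shows "A \<in> form_interval V R"
  unfolding form_interval_def mem_Collect_eq
  using assms linear_add[OF assms(1)] linear_scale[OF assms(1)] by blast

lemma continuous_on_eval [continuous_intros]: "continuous_on UNIV (\<lambda>A. (A :: 'i \<Rightarrow> 'x::topological_space) x)"
  by simp

text \<open>The conditions are closed under pointwise limits, and A \<le> R bounds
  \<open>norm (A x)\<close> by a multiple of \<open>norm x\<close>, so the set is a closed part of a
  product of balls.\<close>

lemma compact_form_interval:
  fixes R :: "'b::euclidean_space \<Rightarrow> 'b"
  assumes V: "subspace V" and R: "linear R"
  shows "compact (form_interval V R)"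
proof -
  obtain B where B: "0 < B" "\<And>x. norm (R x) \<le> B * norm x" using linear_bounded_pos[OF R] by blast
  have bound: "norm (A x) \<le> B * norm x" if A: "A \<in> form_interval V R" for A x
  proof -
    note A = form_intervalD[OF A]
    let ?p = "proj_on V x" and ?y = "A x"
    have pV: "?p \<in> V" by (rule proj_on_in[OF V])
    have quad: "z \<bullet> A z \<le> B * (norm z)\<^sup>2" if "z \<in> V" for z
    proof -
      have "z \<bullet> A z \<le> z \<bullet> R z" by (rule A(6)[OF that])
      also have "\<dots> \<le> norm z * norm (R z)" by (rule norm_cauchy_schwarz)
      also have "\<dots> \<le> norm z * (B * norm z)" by (intro mult_left_mono B) simp
      finally show ?thesis by (simp add: power2_eq_square ac_simps)
    qed
    \<comment> \<open>With \<open>?y = A x\<close> the left side is \<open>(norm ?y) ^ 4\<close>.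
      Cauchy-Schwarz thus converts the bound on the quadratic form into a bound on the
      vector.\<close>
    have "(?y \<bullet> A ?p)\<^sup>2 \<le> (?y \<bullet> A ?y) * (?p \<bullet> A ?p)"
      using A(4)[OF A(2) pV] by (intro form_Cauchy_Schwarz A(1)) (auto intro!: A(5) subspace_add[OF V] subspace_scale[OF V] A(2) pV)
    also have "\<dots> \<le> (B * (norm ?y)\<^sup>2) * (B * (norm ?p)\<^sup>2)"
      using B(1) by (intro mult_mono quad A(2) pV A(5)) auto
    also have "\<dots> = (B * norm ?y * norm ?p)\<^sup>2" by (simp add: power_mult_distrib power2_eq_square ac_simps)
    finally have "?y \<bullet> A ?p \<le> B * norm ?y * norm ?p"
      by (rule power2_le_imp_le) (use B(1) in simp)
    then have "norm ?y * norm ?y \<le> norm ?y * (B * norm ?p)"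
      using A(3)[of x] by (simp add: power2_norm_eq_inner flip: power2_eq_square) (simp add: ac_simps)
    then have "norm ?y \<le> B * norm ?p" using B(1) by (cases "?y = 0") auto
    also have "\<dots> \<le> B * norm x" using B(1) norm_proj_on[OF V] by (intro mult_left_mono) auto
    finally show ?thesis .
  qed
  have closed: "closed (form_interval V R)"
    unfolding form_interval_def
  proof (intro closed_Collect_conj closed_Collect_all closed_Collect_eq continuous_intros)
    show "closed {A :: 'b \<Rightarrow> 'b. \<forall>x\<in>V. \<forall>y\<in>V. x \<bullet> A y = y \<bullet> A x}"
      unfolding Ball_def by (intro closed_Collect_all closed_Collect_imp open_Collect_const closed_Collect_eq continuous_intros)
    show "closed {A :: 'b \<Rightarrow> 'b. \<forall>x\<in>V. 0 \<le> x \<bullet> A x \<and> x \<bullet> A x \<le> x \<bullet> R x}"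
      unfolding Ball_def by (intro closed_Collect_all closed_Collect_imp closed_Collect_conj open_Collect_const closed_Collect_le continuous_intros)
    show "closed {A :: 'b \<Rightarrow> 'b. A x \<in> V}" for x
      using closed_vimage[OF closed_subspace[OF V] continuous_on_eval[of x]] by (simp add: vimage_def)
  qed
  have "compact ({A :: 'b \<Rightarrow> 'b. \<forall>x. A x \<in> cball 0 (B * norm x)} \<inter> form_interval V R)"
    by (intro compact_Int_closed compact_PiE_UNIV compact_cball closed)
  moreover have "{A :: 'b \<Rightarrow> 'b. \<forall>x. A x \<in> cball 0 (B * norm x)} \<inter> form_interval V R = form_interval V R"
    using bound by auto
  ultimately show ?thesis by simp
qed

lemma pos_form_det: "subspace V \<Longrightarrow> pos_form V A \<Longrightarrow> 0 < det_on V A"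
  using det_on_semidefinite(3)[of V A] pos_form_nonneg[of V A] by (auto simp: pos_form_def)

section \<open>The maximisation problem of a datum\<close>

locale lr_datum =
  fixes J :: "'j set" and V :: "'j \<Rightarrow> 'b::euclidean_space set" and l :: "'j \<Rightarrow> 'a::euclidean_space \<Rightarrow> 'b"
    and q :: "'j \<Rightarrow> real" and R :: "'j \<Rightarrow> 'b \<Rightarrow> 'b" and T :: "'a \<Rightarrow> 'a"
  assumes lr: "localised_regularised_BL_datum J V l q R T"
begin

lemma datum: "BL_datum J V l q" and finJ: "finite J" and V: "j \<in> J \<Longrightarrow> subspace (V j)" and l: "j \<in> J \<Longrightarrow> linear (l j)"
  and lV: "j \<in> J \<Longrightarrow> l j x \<in> V j" and q: "j \<in> J \<Longrightarrow> 0 < q j"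
  and R: "j \<in> J \<Longrightarrow> pos_def_on (V j) (R j)" and T: "pos_def_on UNIV T"
  using lr by (auto simp: localised_regularised_BL_datum_def BL_datum_def)

lemma posR: "j \<in> J \<Longrightarrow> pos_form (V j) (R j)" and posT: "pos_form UNIV T"
  using R T pos_def_on_imp_pos_form by blast+

lemma RV: "j \<in> J \<Longrightarrow> x \<in> V j \<Longrightarrow> R j x \<in> V j"
  using R[of j] unfolding pos_def_on_def by blast

text \<open>The operator M of a family A; for A = R its norm is \<open>BL_N\<close>.\<close>

definition form_sum :: "('j \<Rightarrow> 'b \<Rightarrow> 'b) \<Rightarrow> 'a \<Rightarrow> 'a" where
  "form_sum A x = T x + (\<Sum>j\<in>J. q j *\<^sub>R adjoint (l j) (A j (l j x)))"

lemma form_sum_inner: "x \<bullet> form_sum A z = x \<bullet> T z + (\<Sum>j\<in>J. q j * (l j x \<bullet> A j (l j z)))"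
  by (simp add: form_sum_def inner_add_right inner_sum_right adjoint_works[OF l])

lemma linear_form_sum:
  assumes "\<And>j. j \<in> J \<Longrightarrow> linear (A j)"
  shows "linear (form_sum A)"
proof -
  have "linear (\<lambda>x. q j *\<^sub>R adjoint (l j) (A j (l j x)))" if "j \<in> J" for j
    using linear_compose[OF linear_compose[OF l assms] adjoint_linear[OF l], OF that that that]
    by (intro linear_compose_scale_right) (simp add: o_def)
  then show ?thesis
    unfolding form_sum_def[abs_def] using posT finJ by (intro linear_compose_add linear_compose_sum) (auto simp: pos_form_def)
qed

lemma pos_form_sum:
  assumes "\<And>j. j \<in> J \<Longrightarrow> linear (A j)" "\<And>j x y. j \<in> J \<Longrightarrow> x \<in> V j \<Longrightarrow> y \<in> V j \<Longrightarrow> x \<bullet> A j y = y \<bullet> A j x"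
    "\<And>j x. j \<in> J \<Longrightarrow> x \<in> V j \<Longrightarrow> 0 \<le> x \<bullet> A j x"
  shows "pos_form UNIV (form_sum A)"
  unfolding pos_form_def
proof (intro conjI ballI impI linear_form_sum assms(1))
  fix x y
  show "x \<bullet> form_sum A y = y \<bullet> form_sum A x"
    using posT assms(2)[OF _ lV lV] unfolding form_sum_inner by (auto simp: pos_form_def intro!: arg_cong2[where f = "(+)"] sum.cong)
  assume "x \<noteq> 0"
  then have "0 < x \<bullet> T x" using posT by (simp add: pos_form_def)
  moreover have "0 \<le> (\<Sum>j\<in>J. q j * (l j x \<bullet> A j (l j x)))"
    using q assms(3)[OF _ lV] by (intro sum_nonneg mult_nonneg_nonneg) (auto simp: less_imp_le)
  ultimately show "0 < x \<bullet> form_sum A x" unfolding form_sum_inner by linarith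
qed

text \<open>Families are total functions on the index type, so they are pinned to 0 outside J to
  keep the set compact.\<close>

definition feasible :: "('j \<Rightarrow> 'b \<Rightarrow> 'b) set" where
  "feasible = {A. \<forall>j. A j \<in> (if j \<in> J then form_interval (V j) (R j) else {\<lambda>_. 0})}"

definition ratio :: "('j \<Rightarrow> 'b \<Rightarrow> 'b) \<Rightarrow> real" where
  "ratio A = (\<Prod>j\<in>J. det_on (V j) (A j) powr q j) / det_on UNIV (form_sum A)"

lemma linR: "j \<in> J \<Longrightarrow> linear (R j)"
  using posR by (simp add: pos_form_def)

lemma compact_feasible: "compact feasible"
  unfolding feasible_def by (rule compact_PiE_UNIV) (auto intro: compact_form_interval V linR)

lemma feasibleD: "A \<in> feasible \<Longrightarrow> j \<in> J \<Longrightarrow> A j \<in> form_interval (V j) (R j)"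
  unfolding feasible_def by (auto split: if_splits)

lemma feasible_pos_form_sum:
  assumes A: "A \<in> feasible"
  shows "pos_form UNIV (form_sum A)"
proof (rule pos_form_sum)
  fix j x y assume j: "j \<in> J"
  note D = form_intervalD[OF feasibleD[OF A j]]
  show "linear (A j)" by (rule D)
  show "x \<bullet> A j y = y \<bullet> A j x" if "x \<in> V j" "y \<in> V j" using that by (rule D)
  show "0 \<le> x \<bullet> A j x" if "x \<in> V j" using that by (rule D)
qed

text \<open>The exponents q j are positive, so the powers are continuous even where a determinant
  vanishes; the denominator is positive because M dominates T.\<close>

lemma continuous_ratio: "continuous_on feasible ratio"
proof -
  have ev: "continuous_on S (\<lambda>A. A j x)" for S :: "('j \<Rightarrow> 'b \<Rightarrow> 'b) set" and j x
    by (rule continuous_on_product_then_coordinatewise[OF continuous_on_product_then_coordinatewise[OF continuous_on_id]])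
  have adj: "continuous_on UNIV (adjoint (l j))" if "j \<in> J" for j
    using adjoint_linear[OF l[OF that]] by (intro linear_continuous_on) (simp add: linear_conv_bounded_linear)
  have cadj: "continuous_on S (\<lambda>A. adjoint (l j) (A j x))" if "j \<in> J" for S :: "('j \<Rightarrow> 'b \<Rightarrow> 'b) set" and j x
    by (rule continuous_on_compose2[OF adj[OF that] ev subset_UNIV])
  have num: "continuous_on feasible (\<lambda>A. det_on (V j) (A j))" for j
    unfolding det_on_def by (intro continuous_intros ev)
  have den: "continuous_on feasible (\<lambda>A. det_on UNIV (form_sum A))"
    unfolding det_on_def form_sum_def by (intro continuous_intros cadj)
  have nn: "0 \<le> det_on (V j) (A j)" if "A \<in> feasible" "j \<in> J" for A j
    using form_intervalD[OF feasibleD[OF that]] by (intro det_on_semidefinite(1) V that)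
  have "det_on UNIV (form_sum A) \<noteq> 0" if "A \<in> feasible" for A
    using pos_form_det[OF subspace_UNIV feasible_pos_form_sum[OF that]] by simp
  then show ?thesis
    unfolding ratio_def using nn q
    by (intro continuous_on_divide continuous_on_prod continuous_on_powr' num den continuous_on_const) auto
qed

text \<open>The family R as a feasible point: \<open>R j\<close> extended by zero to the orthogonal
  complement of \<open>V j\<close>.\<close>

definition zero_ext :: "'j \<Rightarrow> 'b \<Rightarrow> 'b" where
  "zero_ext j x = (if j \<in> J then R j (proj_on (V j) x) else 0)"

lemma zero_ext_form_interval: "j \<in> J \<Longrightarrow> zero_ext j \<in> form_interval (V j) (R j)"
proof -
  assume j: "j \<in> J"
  note p = linear_proj_on[of "V j"] proj_on_in[OF V[OF j]] proj_on_id[OF V[OF j]]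
  have sym: "x \<bullet> R j y = y \<bullet> R j x" if "x \<in> V j" "y \<in> V j" for x y
    using posR[OF j] that by (simp add: pos_form_def)
  have ze: "zero_ext j = (\<lambda>x. R j (proj_on (V j) x))" using j by (simp add: zero_ext_def fun_eq_iff)
  show ?thesis
    unfolding form_interval_def ze
    using j p sym pos_form_nonneg[OF posR[OF j]] RV[OF j]
    by (auto simp: linear_add[OF p(1)] linear_scale[OF p(1)] linear_add[OF linR] linear_scale[OF linR])
qed

lemma zero_ext_feasible: "zero_ext \<in> feasible"
  unfolding feasible_def using zero_ext_form_interval by (auto simp: zero_ext_def[abs_def])

lemma ratio_zero_ext_pos: "0 < ratio zero_ext"
proof -
  have "det_on (V j) (zero_ext j) = det_on (V j) (R j)" if "j \<in> J" for j
    using that by (intro det_on_cong V) (auto simp: zero_ext_def proj_on_id V)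
  then have "0 < det_on (V j) (zero_ext j)" if "j \<in> J" for j
    using that pos_form_det[OF V posR] by simp
  moreover have "0 < det_on UNIV (form_sum zero_ext)"
    by (rule pos_form_det[OF subspace_UNIV feasible_pos_form_sum[OF zero_ext_feasible]])
  moreover have "0 < (\<Prod>j\<in>J. det_on (V j) (zero_ext j) powr q j)"
  proof (intro prod_pos ballI)
    fix j assume "j \<in> J"
    then have "0 < det_on (V j) (zero_ext j)" using calculation(1) by blast
    then show "0 < det_on (V j) (zero_ext j) powr q j" by simp
  qed
  ultimately show ?thesis unfolding ratio_def by simp
qed

text \<open>The quotient is positive at R, so at a maximiser no determinant vanishes, and a
  semidefinite form with nonzero determinant is definite.\<close>

lemma maximiser:
  obtains A where "A \<in> feasible" "\<And>j. j \<in> J \<Longrightarrow> pos_form (V j) (A j)" "\<And>B. B \<in> feasible \<Longrightarrow> ratio B \<le> ratio A"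
proof -
  obtain A where A: "A \<in> feasible" and max: "\<forall>B\<in>feasible. ratio B \<le> ratio A"
    using continuous_attains_sup[OF compact_feasible _ continuous_ratio] zero_ext_feasible by blast
  have "0 < ratio A" using ratio_zero_ext_pos max zero_ext_feasible by fastforce
  then have nz: "(\<Prod>j\<in>J. det_on (V j) (A j) powr q j) \<noteq> 0" unfolding ratio_def by auto
  have "pos_form (V j) (A j)" if j: "j \<in> J" for j
  proof -
    note D = form_intervalD[OF feasibleD[OF A j]]
    have "det_on (V j) (A j) \<noteq> 0" using nz j finJ by auto
    moreover have "0 \<le> det_on (V j) (A j)" by (rule det_on_semidefinite(1)[OF V[OF j] D(1,4,5)])
    ultimately have "0 < det_on (V j) (A j)" by simp
    then show ?thesis by (rule det_on_semidefinite(2)[OF V[OF j] D(1,4,5), rotated -1])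
  qed
  then show thesis using that A max by blast
qed

text \<open>First-order optimality: along a feasible direction \<open>D\<close> both determinants in \<open>ratio\<close> are explicit products,
  and the logarithmic derivatives at the maximiser are the traces of \<open>D\<close> with respect to the two forms.\<close>

lemma first_order_condition:
  assumes A: "A \<in> feasible" and Apos: "pos_form (V j) (A j)" and max: "\<And>B. B \<in> feasible \<Longrightarrow> ratio B \<le> ratio A"
    and pos: "\<And>j. j \<in> J \<Longrightarrow> pos_form (V j) (A j)"
    and j: "j \<in> J" and D: "linear D" "\<And>x y. x \<in> V j \<Longrightarrow> y \<in> V j \<Longrightarrow> x \<bullet> D y = y \<bullet> D x"
    and \<epsilon>: "0 < \<epsilon>" and feas: "\<And>s. 0 \<le> s \<Longrightarrow> s \<le> \<epsilon> \<Longrightarrow> (\<lambda>x. A j x + s *\<^sub>R D x) \<in> form_interval (V j) (R j)"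
    and b: "form_onb (V j) (A j) b" and v: "form_onb UNIV (form_sum A) v"
  shows "(\<Sum>i<dim (V j). b i \<bullet> D (b i)) \<le> (\<Sum>m<DIM('a). l j (v m) \<bullet> D (l j (v m)))"
proof -
  let ?n = "dim (V j)" and ?d = "DIM('a)" and ?M = "form_sum A"
  define K where "K x = adjoint (l j) (D (l j x))" for x
  have linA: "linear (A j)" and linM: "linear ?M" and posM: "pos_form UNIV ?M"
    using Apos feasible_pos_form_sum[OF A] by (auto simp: pos_form_def)
  have linK: "linear K"
    using linear_compose[OF linear_compose[OF l[OF j] D(1)] adjoint_linear[OF l[OF j]]] unfolding K_def o_def .
  have Kin: "x \<bullet> K y = l j x \<bullet> D (l j y)" for x y by (simp add: K_def adjoint_works[OF l[OF j]])
  obtain c where c: "form_onb (V j) (A j) c" and cd: "\<And>i k. i < ?n \<Longrightarrow> k < ?n \<Longrightarrow> i \<noteq> k \<Longrightarrow> c i \<bullet> D (c k) = 0"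
    using simultaneous_diagonalisation[OF V[OF j] Apos D] by blast
  have symK: "x \<bullet> K y = y \<bullet> K x" for x y using D(2)[OF lV[OF j] lV[OF j]] by (simp add: Kin)
  obtain w where w: "form_onb UNIV ?M w" and wd: "\<And>i k. i < dim (UNIV :: 'a set) \<Longrightarrow> k < dim (UNIV :: 'a set) \<Longrightarrow> i \<noteq> k \<Longrightarrow> w i \<bullet> K (w k) = 0"
    using simultaneous_diagonalisation[OF subspace_UNIV posM linK symK] by blast
  define \<beta> where "\<beta> i = c i \<bullet> D (c i)" for i
  define \<kappa> where "\<kappa> m = q j * (w m \<bullet> K (w m))" for m
  \<comment> \<open>For small s \<ge> 0 this is the logarithm of the quotient at
    \<open>A j + s *\<^sub>R D\<close> divided by its value at A. Being at most 0 for small s > 0,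
    it cannot have a positive derivative at 0.\<close>
  define \<psi> where "\<psi> s = q j * (\<Sum>i<?n. ln (1 + s * \<beta> i)) - (\<Sum>m<?d. ln (1 + s * \<kappa> m))" for s
  have detA: "0 < det_on (V j) (A j)" by (rule pos_form_det[OF V[OF j] Apos])
  have detM: "0 < det_on UNIV ?M" by (rule pos_form_det[OF subspace_UNIV posM])
  have \<psi>le: "\<psi> s \<le> 0" if s: "0 < s" "s \<le> \<epsilon>" and p1: "\<forall>i<?n. 0 < 1 + s * \<beta> i" and p2: "\<forall>m<?d. 0 < 1 + s * \<kappa> m" for s
  proof -
    let ?B = "A(j := \<lambda>x. A j x + s *\<^sub>R D x)"
    have B: "?B \<in> feasible"
      unfolding feasible_def mem_Collect_eq
    proof
      fix i
      have "A i \<in> (if i \<in> J then form_interval (V i) (R i) else {\<lambda>_. 0})" using A unfolding feasible_def by blast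
      then show "?B i \<in> (if i \<in> J then form_interval (V i) (R i) else {\<lambda>_. 0})"
        using feas[of s] s j by (cases "i = j") simp_all
    qed
    have linB: "linear (\<lambda>x. A j x + s *\<^sub>R D x)"
      by (intro linear_compose_add linear_compose_scale_right linA D(1))
    have dj: "det_on (V j) (?B j) = (\<Prod>i<?n. 1 + s * \<beta> i) * det_on (V j) (A j)"
    proof -
      have "det_on (V j) (\<lambda>x. A j x + s *\<^sub>R D x) = (\<Prod>i<?n. c i \<bullet> (A j (c i) + s *\<^sub>R D (c i))) * det_on (V j) (A j)"
        using c cd by (intro det_on_diag[OF V[OF j] c linA linB]) (auto simp: inner_add_right form_onb_def)
      moreover have "(\<Prod>i<?n. c i \<bullet> (A j (c i) + s *\<^sub>R D (c i))) = (\<Prod>i<?n. 1 + s * \<beta> i)"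
        using c by (intro prod.cong) (auto simp: inner_add_right form_onb_def \<beta>_def)
      ultimately show ?thesis by simp
    qed
    have sumB: "form_sum ?B x = ?M x + (s * q j) *\<^sub>R K x" for x
    proof -
      have "(\<Sum>i\<in>J - {j}. q i *\<^sub>R adjoint (l i) (?B i (l i x))) = (\<Sum>i\<in>J - {j}. q i *\<^sub>R adjoint (l i) (A i (l i x)))"
        by (intro sum.cong) auto
      then show ?thesis
        using adjoint_linear[OF l[OF j]] unfolding form_sum_def sum.remove[OF finJ j]
        by (simp add: K_def linear_add linear_scale scaleR_add_right mult.commute)
    qed
    have dM: "det_on UNIV (form_sum ?B) = (\<Prod>m<?d. 1 + s * \<kappa> m) * det_on UNIV ?M"
    proof -
      have linMK: "linear (\<lambda>x. ?M x + (s * q j) *\<^sub>R K x)"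
        by (intro linear_compose_add linear_compose_scale_right linM linK)
      have "det_on UNIV (\<lambda>x. ?M x + (s * q j) *\<^sub>R K x) = (\<Prod>i<dim (UNIV :: 'a set). w i \<bullet> (?M (w i) + (s * q j) *\<^sub>R K (w i))) * det_on UNIV ?M"
        using w wd by (intro det_on_diag[OF subspace_UNIV w linM linMK]) (auto simp: inner_add_right form_onb_def)
      moreover have "(\<Prod>i<dim (UNIV :: 'a set). w i \<bullet> (?M (w i) + (s * q j) *\<^sub>R K (w i))) = (\<Prod>m<?d. 1 + s * \<kappa> m)"
        using w by (intro prod.cong) (auto simp: inner_add_right form_onb_def \<kappa>_def)
      ultimately show ?thesis unfolding sumB[abs_def] by simp
    qed
    have P1: "0 < (\<Prod>i<?n. 1 + s * \<beta> i)" using p1 by (intro prod_pos) auto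
    have P2: "0 < (\<Prod>m<?d. 1 + s * \<kappa> m)" using p2 by (intro prod_pos) auto
    define rest where "rest = (\<Prod>i\<in>J - {j}. det_on (V i) (A i) powr q i)"
    have rest: "0 < rest"
      unfolding rest_def
    proof (intro prod_pos ballI)
      fix i assume "i \<in> J - {j}"
      then show "0 < det_on (V i) (A i) powr q i" using pos_form_det[OF V pos, of i] by simp
    qed
    have rA: "ratio A = det_on (V j) (A j) powr q j * rest / det_on UNIV ?M"
      unfolding ratio_def rest_def prod.remove[OF finJ j] ..
    have "ratio ?B = det_on (V j) (?B j) powr q j * rest / det_on UNIV (form_sum ?B)"
    proof -
      have "(\<Prod>i\<in>J - {j}. det_on (V i) (?B i) powr q i) = rest" unfolding rest_def by (intro prod.cong) auto
      then show ?thesis unfolding ratio_def prod.remove[OF finJ j] by simp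
    qed
    also have "\<dots> = ratio A * ((\<Prod>i<?n. 1 + s * \<beta> i) powr q j / (\<Prod>m<?d. 1 + s * \<kappa> m))"
      unfolding dj dM rA using P1 detA by (simp add: powr_mult ac_simps)
    finally have "ratio A * ((\<Prod>i<?n. 1 + s * \<beta> i) powr q j / (\<Prod>m<?d. 1 + s * \<kappa> m)) \<le> ratio A * 1"
      using max[OF B] by simp
    moreover have "0 < ratio A" unfolding rA using detA rest detM by simp
    ultimately have "(\<Prod>i<?n. 1 + s * \<beta> i) powr q j / (\<Prod>m<?d. 1 + s * \<kappa> m) \<le> 1" by (simp only: mult_le_cancel_left_pos)
    then have "(\<Prod>i<?n. 1 + s * \<beta> i) powr q j \<le> (\<Prod>m<?d. 1 + s * \<kappa> m)" using P2 by (simp add: divide_le_eq)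
    moreover have "0 < (\<Prod>i<?n. 1 + s * \<beta> i) powr q j" using P1 by (metis powr_gt_zero less_irrefl)
    ultimately have "ln ((\<Prod>i<?n. 1 + s * \<beta> i) powr q j) \<le> ln (\<Prod>m<?d. 1 + s * \<kappa> m)"
      using ln_le_cancel_iff P2 by blast
    moreover have "ln (\<Prod>i<?n. 1 + s * \<beta> i) = (\<Sum>i<?n. ln (1 + s * \<beta> i))" using p1 by (intro ln_prod) (auto simp: less_imp_neq)
    moreover have "ln (\<Prod>m<?d. 1 + s * \<kappa> m) = (\<Sum>m<?d. ln (1 + s * \<kappa> m))" using p2 by (intro ln_prod) (auto simp: less_imp_neq)
    ultimately show ?thesis unfolding \<psi>_def using P1 by (simp add: ln_powr)
  qed
  have der: "(\<psi> has_real_derivative q j * (\<Sum>i<?n. \<beta> i) - (\<Sum>m<?d. \<kappa> m)) (at 0)"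
    unfolding \<psi>_def by (auto intro!: derivative_eq_intros)
  have ev: "\<forall>\<^sub>F s in at_right 0. 0 < 1 + s * x" for x :: real
  proof -
    have "((\<lambda>s. 1 + s * x) \<longlongrightarrow> 1 + 0 * x) (at_right 0)" by (intro tendsto_intros)
    then show ?thesis by (rule order_tendstoD(1)) simp
  qed
  have "q j * (\<Sum>i<?n. \<beta> i) \<le> (\<Sum>m<?d. \<kappa> m)"
  proof (rule ccontr)
    assume "\<not> ?thesis"
    then have "0 < q j * (\<Sum>i<?n. \<beta> i) - (\<Sum>m<?d. \<kappa> m)" by simp
    from DERIV_pos_inc_right[OF der this] obtain \<eta> where \<eta>: "0 < \<eta>" "\<forall>h>0. h < \<eta> \<longrightarrow> \<psi> 0 < \<psi> (0 + h)" by blast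
    have "\<forall>\<^sub>F s in at_right 0. (\<forall>i\<in>{..<?n}. 0 < 1 + s * \<beta> i) \<and> (\<forall>m\<in>{..<?d}. 0 < 1 + s * \<kappa> m)"
      by (intro eventually_conj eventually_ball_finite ballI ev) auto
    moreover have "\<forall>\<^sub>F s in at_right 0. s \<in> {0<..<min \<eta> \<epsilon>}"
      using \<eta>(1) \<epsilon> by (intro eventually_at_right_real) simp
    ultimately have "\<forall>\<^sub>F s in at_right 0. ((\<forall>i\<in>{..<?n}. 0 < 1 + s * \<beta> i) \<and> (\<forall>m\<in>{..<?d}. 0 < 1 + s * \<kappa> m)) \<and> s \<in> {0<..<min \<eta> \<epsilon>}"
      by (rule eventually_conj)
    then obtain s where s: "\<forall>i\<in>{..<?n}. 0 < 1 + s * \<beta> i" "\<forall>m\<in>{..<?d}. 0 < 1 + s * \<kappa> m" "s \<in> {0<..<min \<eta> \<epsilon>}"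
      using eventually_happens'[OF trivial_limit_at_right_real] by blast
    then have "\<psi> s \<le> 0" by (intro \<psi>le) auto
    moreover have "\<psi> 0 < \<psi> (0 + s)" using \<eta>(2) s(3) by auto
    ultimately show False by (simp add: \<psi>_def)
  qed
  moreover have "(\<Sum>i<?n. \<beta> i) = (\<Sum>i<?n. b i \<bullet> D (b i))"
    unfolding \<beta>_def by (rule form_onb_trace[OF V[OF j] Apos c b D(1)])
  moreover have "(\<Sum>m<?d. \<kappa> m) = q j * (\<Sum>m<?d. v m \<bullet> K (v m))"
    using form_onb_trace[OF subspace_UNIV posM w v linK] unfolding \<kappa>_def by (simp flip: sum_distrib_left)
  ultimately have "q j * (\<Sum>i<?n. b i \<bullet> D (b i)) \<le> q j * (\<Sum>m<?d. v m \<bullet> K (v m))" by simp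
  then show ?thesis using q[OF j] unfolding Kin by simp
qed

text \<open>The direction is \<open>R j - A j\<close>: the segment from \<open>A j\<close> to
  \<open>R j\<close> is feasible. The conclusion says that the trace of P_j (R_j - A_j) is at most
  0.\<close>

lemma maximiser_trace_le:
  assumes A: "A \<in> feasible" and pos: "\<And>j. j \<in> J \<Longrightarrow> pos_form (V j) (A j)" and max: "\<And>B. B \<in> feasible \<Longrightarrow> ratio B \<le> ratio A"
    and j: "j \<in> J" and b: "form_onb (V j) (A j) b" and v: "form_onb UNIV (form_sum A) v"
  shows "(\<Sum>i<dim (V j). b i \<bullet> R j (b i) - 1) \<le> (\<Sum>m<DIM('a). l j (v m) \<bullet> R j (l j (v m)) - l j (v m) \<bullet> A j (l j (v m)))"
proof -
  note I = form_intervalD[OF feasibleD[OF A j]] and Z = form_intervalD[OF zero_ext_form_interval[OF j]]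
  define D where "D x = zero_ext j x - A j x" for x
  have lin: "linear D" unfolding D_def by (intro linear_compose_sub I Z)
  have ze: "zero_ext j x = R j x" if "x \<in> V j" for x using j that by (simp add: zero_ext_def proj_on_id V)
  have "(\<Sum>i<dim (V j). b i \<bullet> D (b i)) \<le> (\<Sum>m<DIM('a). l j (v m) \<bullet> D (l j (v m)))"
  proof (rule first_order_condition[OF A pos[OF j] max pos j lin _ _ _ b v])
    show "x \<bullet> D y = y \<bullet> D x" if "x \<in> V j" "y \<in> V j" for x y
      using I(4)[OF that] Z(4)[OF that] by (simp add: D_def inner_diff_right)
    fix s :: real assume s: "0 \<le> s" "s \<le> 1"
    have eq: "A j x + s *\<^sub>R D x = (1 - s) *\<^sub>R A j x + s *\<^sub>R zero_ext j x" for x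
      by (simp add: D_def algebra_simps)
    have quad: "0 \<le> x \<bullet> ((1 - s) *\<^sub>R A j x + s *\<^sub>R zero_ext j x)"
      "x \<bullet> ((1 - s) *\<^sub>R A j x + s *\<^sub>R zero_ext j x) \<le> x \<bullet> R j x" if x: "x \<in> V j" for x
    proof -
      show "0 \<le> x \<bullet> ((1 - s) *\<^sub>R A j x + s *\<^sub>R zero_ext j x)"
        using I(5)[OF x] Z(5)[OF x] s by (simp add: inner_add_right)
      have "(1 - s) * (x \<bullet> A j x) + s * (x \<bullet> zero_ext j x) \<le> (1 - s) * (x \<bullet> R j x) + s * (x \<bullet> R j x)"
        using I(6)[OF x] Z(6)[OF x] s by (intro add_mono mult_left_mono) auto
      then show "x \<bullet> ((1 - s) *\<^sub>R A j x + s *\<^sub>R zero_ext j x) \<le> x \<bullet> R j x"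
        by (simp add: inner_add_right algebra_simps)
    qed
    have sym: "x \<bullet> ((1 - s) *\<^sub>R A j y + s *\<^sub>R zero_ext j y) = y \<bullet> ((1 - s) *\<^sub>R A j x + s *\<^sub>R zero_ext j x)"
      if "x \<in> V j" "y \<in> V j" for x y using I(4)[OF that] Z(4)[OF that] by (simp add: inner_add_right)
    have pr: "(1 - s) *\<^sub>R A j x + s *\<^sub>R zero_ext j x = (1 - s) *\<^sub>R A j (proj_on (V j) x) + s *\<^sub>R zero_ext j (proj_on (V j) x)" for x
      using I(3)[of x] Z(3)[of x] by simp
    show "(\<lambda>x. A j x + s *\<^sub>R D x) \<in> form_interval (V j) (R j)"
      unfolding eq
    proof (rule form_intervalI)
      show "linear (\<lambda>x. (1 - s) *\<^sub>R A j x + s *\<^sub>R zero_ext j x)"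
        by (intro linear_compose_add linear_compose_scale_right I Z)
      show "(1 - s) *\<^sub>R A j x + s *\<^sub>R zero_ext j x \<in> V j" for x
        by (intro subspace_add[OF V[OF j]] subspace_scale[OF V[OF j]] I Z)
    qed (fact pr, fact sym, fact quad(1), fact quad(2))
  qed auto
  moreover have "b i \<bullet> D (b i) = b i \<bullet> R j (b i) - 1" if "i < dim (V j)" for i
    using b that ze by (simp add: D_def inner_diff_right form_onb_def)
  moreover have "l j x \<bullet> D (l j x) = l j x \<bullet> R j (l j x) - l j x \<bullet> A j (l j x)" for x
    by (simp add: D_def inner_diff_right ze lV[OF j])
  ultimately show ?thesis by simp
qed

text \<open>Nonnegativity of P_j, tested on w = \<open>A j z\<close>. The feasible direction lowers
  \<open>A j\<close> by a multiple of the rank-one form \<open>(w \<bullet> x)\<^sup>2\<close>, so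
  the bound by \<open>R j\<close> is preserved.\<close>

lemma maximiser_bessel:
  assumes A: "A \<in> feasible" and pos: "\<And>j. j \<in> J \<Longrightarrow> pos_form (V j) (A j)" and max: "\<And>B. B \<in> feasible \<Longrightarrow> ratio B \<le> ratio A"
    and j: "j \<in> J" and z: "z \<in> V j" and v: "form_onb UNIV (form_sum A) v"
  shows "(\<Sum>m<DIM('a). (l j (v m) \<bullet> A j z)\<^sup>2) \<le> z \<bullet> A j z"
proof -
  note I = form_intervalD[OF feasibleD[OF A j]]
  define w where "w = A j z"
  have wV: "w \<in> V j" unfolding w_def by (rule I(2))
  define D where "D x = - ((w \<bullet> x) *\<^sub>R w)" for x
  have lin: "linear D" unfolding D_def by (rule linearI) (auto simp: inner_add_right algebra_simps)
  obtain b where b: "form_onb (V j) (A j) b"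
    using simultaneous_diagonalisation[OF V[OF j] pos[OF j] I(1) I(4)] by metis
  have zz: "0 \<le> z \<bullet> A j z" by (rule I(5)[OF z])
  have "(\<Sum>i<dim (V j). b i \<bullet> D (b i)) \<le> (\<Sum>m<DIM('a). l j (v m) \<bullet> D (l j (v m)))"
  proof (rule first_order_condition[OF A pos[OF j] max pos j lin _ _ _ b v])
    show "x \<bullet> D y = y \<bullet> D x" for x y by (simp add: D_def inner_commute)
    \<comment> \<open>This range gives \<open>s * (z \<bullet> A j z) \<le> 1\<close>, which by
      Cauchy-Schwarz keeps the lowered form nonnegative; the summand 1 covers z = 0.\<close>
    show "0 < 1 / (1 + z \<bullet> A j z)" using zz by simp
    fix s :: real assume s: "0 \<le> s" "s \<le> 1 / (1 + z \<bullet> A j z)"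
    have sz: "s * (z \<bullet> A j z) \<le> 1"
    proof -
      have "s * (z \<bullet> A j z) \<le> s * (1 + z \<bullet> A j z)" using s by (intro mult_left_mono) auto
      also have "\<dots> \<le> 1" using s zz by (simp add: field_simps)
      finally show ?thesis .
    qed
    have quad: "0 \<le> x \<bullet> (A j x + s *\<^sub>R D x)" "x \<bullet> (A j x + s *\<^sub>R D x) \<le> x \<bullet> R j x" if x: "x \<in> V j" for x
    proof -
      have eq: "x \<bullet> (A j x + s *\<^sub>R D x) = x \<bullet> A j x - s * (x \<bullet> w)\<^sup>2"
        by (simp add: D_def inner_diff_right inner_commute power2_eq_square)
      have "(x \<bullet> w)\<^sup>2 \<le> (x \<bullet> A j x) * (z \<bullet> A j z)"
        unfolding w_def by (rule pos_form_Cauchy_Schwarz[OF V[OF j] pos[OF j] x z])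
      then have "s * (x \<bullet> w)\<^sup>2 \<le> s * ((x \<bullet> A j x) * (z \<bullet> A j z))" using s by (intro mult_left_mono) auto
      also have "\<dots> = (x \<bullet> A j x) * (s * (z \<bullet> A j z))" by simp
      also have "\<dots> \<le> (x \<bullet> A j x) * 1" using sz I(5)[OF x] by (intro mult_left_mono)
      finally show "0 \<le> x \<bullet> (A j x + s *\<^sub>R D x)" unfolding eq by simp
      have "0 \<le> s * (x \<bullet> w)\<^sup>2" using s by simp
      then show "x \<bullet> (A j x + s *\<^sub>R D x) \<le> x \<bullet> R j x" unfolding eq using I(6)[OF x] by linarith
    qed
    have sym: "x \<bullet> (A j y + s *\<^sub>R D y) = y \<bullet> (A j x + s *\<^sub>R D x)" if "x \<in> V j" "y \<in> V j" for x y
      using I(4)[OF that] by (simp add: D_def inner_diff_right inner_commute)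
    have pr: "A j x + s *\<^sub>R D x = A j (proj_on (V j) x) + s *\<^sub>R D (proj_on (V j) x)" for x
      using I(3)[of x] proj_on_inner[OF V[OF j] wV, of x] by (simp add: D_def)
    have DV: "D x \<in> V j" for x using wV V[OF j] by (simp add: D_def subspace_neg subspace_scale)
    show "(\<lambda>x. A j x + s *\<^sub>R D x) \<in> form_interval (V j) (R j)"
    proof (rule form_intervalI)
      show "linear (\<lambda>x. A j x + s *\<^sub>R D x)"
        by (intro linear_compose_add linear_compose_scale_right I lin)
      show "A j x + s *\<^sub>R D x \<in> V j" for x
        by (intro subspace_add[OF V[OF j]] subspace_scale[OF V[OF j]] I DV)
    qed (fact pr, fact sym, fact quad(1), fact quad(2))
  qed
  moreover have "(\<Sum>i<dim (V j). b i \<bullet> D (b i)) = - (z \<bullet> A j z)"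
  proof -
    have "(\<Sum>i<dim (V j). b i \<bullet> D (b i)) = - (\<Sum>i<dim (V j). (b i \<bullet> A j z) * (w \<bullet> b i))"
      unfolding sum_negf[symmetric] by (intro sum.cong) (auto simp: D_def w_def inner_commute)
    also have "(\<Sum>i<dim (V j). (b i \<bullet> A j z) * (w \<bullet> b i)) = w \<bullet> z"
      by (rule form_onb_Parseval[OF V[OF j] pos[OF j] b z, symmetric])
    finally show ?thesis by (simp add: w_def inner_commute)
  qed
  moreover have "(\<Sum>m<DIM('a). l j (v m) \<bullet> D (l j (v m))) = - (\<Sum>m<DIM('a). (l j (v m) \<bullet> A j z)\<^sup>2)"
    unfolding sum_negf[symmetric] by (intro sum.cong) (auto simp: D_def w_def inner_commute power2_eq_square)
  ultimately show ?thesis by simp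
qed

end

section \<open>Gaussian mixtures\<close>

lemma form_onb_parseval2:
  assumes V: "subspace V" and A: "pos_form V A" and b: "form_onb V A b" and x: "x \<in> V"
  shows "x \<bullet> A y = (\<Sum>i<dim V. (b i \<bullet> A x) * (b i \<bullet> A y))"
  using form_onb_Parseval[OF V A b x, of "A y"] by (simp add: inner_commute)

lemma form_onb_quadratic:
  assumes V: "subspace V" and A: "pos_form V A" and b: "form_onb V A b" and B: "linear B" and x: "x \<in> V"
    and diag: "\<And>i k. i < dim V \<Longrightarrow> k < dim V \<Longrightarrow> i \<noteq> k \<Longrightarrow> b i \<bullet> B (b k) = 0"
  shows "x \<bullet> B x = (\<Sum>i<dim V. (b i \<bullet> B (b i)) * (b i \<bullet> A x)\<^sup>2)"
proof -
  define c where "c i = b i \<bullet> A x" for i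
  have ex: "x = (\<Sum>i<dim V. c i *\<^sub>R b i)" unfolding c_def by (rule form_onb_expand[OF V A b x])
  have 1: "x \<bullet> z = (\<Sum>i<dim V. c i * (b i \<bullet> z))" for z by (subst ex) (simp add: inner_sum_left)
  have "B x = (\<Sum>k<dim V. c k *\<^sub>R B (b k))" by (subst ex) (simp add: linear_sum[OF B] linear_scale[OF B])
  then have 2: "z \<bullet> B x = (\<Sum>k<dim V. c k * (z \<bullet> B (b k)))" for z by (simp add: inner_sum_right)
  have "x \<bullet> B x = (\<Sum>i<dim V. c i * (\<Sum>k<dim V. c k * (b i \<bullet> B (b k))))" by (rule trans[OF 1]) (simp only: 2)
  also have "\<dots> = (\<Sum>i<dim V. c i * (\<Sum>k<dim V. if k = i then c i * (b i \<bullet> B (b i)) else 0))"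
    using diag by (intro sum.cong refl arg_cong2[where f = "(*)"]) auto
  finally show ?thesis by (simp add: c_def power2_eq_square ac_simps)
qed

lemma sum_insert_None:
  fixes F :: "'j option \<Rightarrow> real"
  shows "finite J \<Longrightarrow> (\<Sum>p\<in>insert None (Some ` J). F p) = F None + (\<Sum>j\<in>J. F (Some j))"
  by (subst sum.insert) (auto simp: sum.reindex)

lemma powr_half_square: "(x powr (c / 2))\<^sup>2 = x powr c" for x c :: real
  by (simp add: power2_eq_square flip: powr_add)

lemma exp_half_ln: "0 < P \<Longrightarrow> exp (ln P / 2) = sqrt P" for P :: real
  by (simp add: powr_half_sqrt[symmetric] powr_def)

section \<open>The constant and the inequality for finite mixtures\<close>

context lr_datum
begin

definition BL_const :: "('j \<Rightarrow> real) \<Rightarrow> real \<Rightarrow> real" where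
  "BL_const \<alpha> \<beta> = real DIM('a) powr (BL_A J V q / 2) * BL_E J V q * (\<Prod>j\<in>J. \<alpha> j powr (- (q j * real (dim (V j)))))
      * BL_N J l q R T powr ((BL_A J V q - real DIM('a) + \<beta>) / 2) * onorm (inv T) powr (\<beta> / 2)"

lemma BL_const_nonneg: "0 \<le> BL_const \<alpha> \<beta>"
  unfolding BL_const_def BL_E_def by (intro mult_nonneg_nonneg prod_nonneg) auto

lemma BL_const_square: "(BL_const \<alpha> \<beta>)\<^sup>2 = real DIM('a) powr BL_A J V q * (\<Prod>j\<in>J. q j powr (- (q j * dim (V j))))
    * (\<Prod>j\<in>J. \<alpha> j powr (- (2 * (q j * dim (V j))))) * BL_N J l q R T powr (BL_A J V q - DIM('a) + \<beta>) * onorm (inv T) powr \<beta>"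
proof -
  have E: "(BL_E J V q)\<^sup>2 = (\<Prod>j\<in>J. q j powr (- (q j * dim (V j))))"
    unfolding BL_E_def prod_power_distrib using powr_half_square[of "q _" "- (q _ * dim (V _))"] by simp
  have a: "(\<Prod>j\<in>J. \<alpha> j powr (- (q j * real (dim (V j)))))\<^sup>2 = (\<Prod>j\<in>J. \<alpha> j powr (- (2 * (q j * dim (V j)))))"
    unfolding prod_power_distrib by (intro prod.cong) (auto simp: power2_eq_square simp flip: powr_add)
  show ?thesis unfolding BL_const_def power_mult_distrib powr_half_square E a ..
qed

lemma inv_T: "T (inv T x) = x" "bounded_linear (inv T)"
proof -
  have linT: "linear T" using posT by (simp add: pos_form_def)
  have inj: "inj T"
    unfolding linear_injective_0[OF linT]
  proof (intro allI impI)
    fix x assume "T x = 0"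
    then have "\<not> 0 < x \<bullet> T x" by simp
    then show "x = 0" using posT by (auto simp: pos_form_def)
  qed
  then have "surj T" by (rule linear_injective_imp_surjective[OF linT]) (rule refl)
  then have Tinv: "T (inv T x) = x" for x by (rule surj_f_inv_f)
  then show "T (inv T x) = x" .
  have "linear (inv T)"
  proof (rule linearI)
    show "inv T (x + y) = inv T x + inv T y" for x y
      by (rule injD[OF inj]) (simp add: Tinv linear_add[OF linT])
    show "inv T (c *\<^sub>R x) = c *\<^sub>R inv T x" for c x
      by (rule injD[OF inj]) (simp add: Tinv linear_scale[OF linT])
  qed
  then show "bounded_linear (inv T)" by (simp add: linear_conv_bounded_linear)
qed

text \<open>Cauchy-Schwarz for the form T between x and \<open>inv T x\<close>, whose mixed term is
  \<open>x \<bullet> x\<close>.\<close>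

lemma inner_le_inv_T: "x \<bullet> x \<le> onorm (inv T) * (x \<bullet> T x)"
proof (cases "x = 0")
  case False
  have "(x \<bullet> x)\<^sup>2 \<le> (x \<bullet> T x) * (inv T x \<bullet> x)"
    using pos_form_Cauchy_Schwarz[OF subspace_UNIV posT, of x "inv T x"] by (simp add: inv_T)
  also have "\<dots> \<le> (x \<bullet> T x) * (onorm (inv T) * (x \<bullet> x))"
  proof (rule mult_left_mono)
    have "inv T x \<bullet> x \<le> norm (inv T x) * norm x" by (rule norm_cauchy_schwarz)
    also have "\<dots> \<le> (onorm (inv T) * norm x) * norm x" by (intro mult_right_mono onorm[OF inv_T(2)]) simp
    finally show "inv T x \<bullet> x \<le> onorm (inv T) * (x \<bullet> x)" by (simp add: power2_norm_eq_inner[symmetric] power2_eq_square)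
    show "0 \<le> x \<bullet> T x" by (rule pos_form_nonneg[OF posT]) simp
  qed
  finally have "(x \<bullet> x) * (x \<bullet> x) \<le> (x \<bullet> x) * (onorm (inv T) * (x \<bullet> T x))" by (simp add: power2_eq_square ac_simps)
  then show ?thesis using False by simp
qed simp

text \<open>Supplies \<open>det_bound\<close> with its constants: A j \<le> R j bounds M by
  \<open>BL_N\<close>, and M \<ge> T gives t = \<open>onorm (inv T)\<close>. The constant is squared
  because \<open>ratio\<close> is a quotient of determinants.\<close>

lemma ratio_le_BL_const:
  assumes \<alpha>: "\<forall>j\<in>J. 0 < \<alpha> j" and \<beta>: "0 \<le> \<beta>" and perc: "perceptive J l q \<alpha> \<beta>"
    and surj: "\<forall>j\<in>J. ess_rank (\<alpha> j) UNIV (l j) = dim (V j)"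
    and A: "A \<in> feasible" and pos: "\<And>j. j \<in> J \<Longrightarrow> pos_form (V j) (A j)"
  shows "ratio A \<le> (BL_const \<alpha> \<beta>)\<^sup>2"
proof -
  note I = form_intervalD[OF feasibleD[OF A]]
  have M: "pos_form UNIV (form_sum A)" by (rule feasible_pos_form_sum[OF A])
  have dM: "0 < det_on UNIV (form_sum A)" by (rule pos_form_det[OF subspace_UNIV M])
  have lR: "linear (form_sum R)" by (rule linear_form_sum[OF linR])
  have T0: "0 \<le> x \<bullet> T x" for x by (rule pos_form_nonneg[OF posT]) simp
  have Aterm: "0 \<le> q j * (l j x \<bullet> A j (l j x))" if "j \<in> J" for j x
    using q[OF that] I(5)[OF that lV[OF that]] by simp
  have "(\<Prod>j\<in>J. det_on (V j) (A j) powr q j) \<le>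
    real DIM('a) powr BL_A J V q * (\<Prod>j\<in>J. q j powr (- (q j * dim (V j)))) * (\<Prod>j\<in>J. \<alpha> j powr (- (2 * (q j * dim (V j)))))
     * BL_N J l q R T powr (BL_A J V q - DIM('a) + \<beta>) * onorm (inv T) powr \<beta> * det_on UNIV (form_sum A)"
  proof (rule det_bound[OF datum \<alpha> \<beta> perc surj M pos])
    fix j x assume j: "j \<in> J"
    have "q j * (l j x \<bullet> A j (l j x)) \<le> (\<Sum>j\<in>J. q j * (l j x \<bullet> A j (l j x)))"
      using j finJ Aterm by (intro member_le_sum) auto
    then show "q j * (l j x \<bullet> A j (l j x)) \<le> x \<bullet> form_sum A x" unfolding form_sum_inner using T0[of x] by linarith
  next
    fix x
    have "(\<Sum>j\<in>J. q j * (l j x \<bullet> A j (l j x))) \<le> (\<Sum>j\<in>J. q j * (l j x \<bullet> R j (l j x)))"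
      using q I(6)[OF _ lV] by (intro sum_mono mult_left_mono) (auto simp: less_imp_le)
    then have "x \<bullet> form_sum A x \<le> x \<bullet> form_sum R x" unfolding form_sum_inner by simp
    also have "\<dots> \<le> norm x * norm (form_sum R x)" by (rule norm_cauchy_schwarz)
    also have "\<dots> \<le> norm x * (onorm (form_sum R) * norm x)"
      using lR by (intro mult_left_mono onorm) (auto simp: linear_conv_bounded_linear)
    also have "\<dots> = BL_N J l q R T * (x \<bullet> x)"
      unfolding BL_N_def form_sum_def[abs_def] by (simp add: power2_norm_eq_inner[symmetric] power2_eq_square)
    finally show "x \<bullet> form_sum A x \<le> BL_N J l q R T * (x \<bullet> x)" .
  next
    fix x
    have "0 \<le> (\<Sum>j\<in>J. q j * (l j x \<bullet> A j (l j x)))" using Aterm by (intro sum_nonneg)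
    then have "x \<bullet> T x \<le> x \<bullet> form_sum A x" unfolding form_sum_inner by simp
    then have "onorm (inv T) * (x \<bullet> T x) \<le> onorm (inv T) * (x \<bullet> form_sum A x)"
      by (intro mult_left_mono onorm_pos_le inv_T)
    then show "x \<bullet> x \<le> onorm (inv T) * (x \<bullet> form_sum A x)" using inner_le_inv_T[of x] by linarith
  qed
  then show ?thesis unfolding BL_const_square ratio_def using dM by (simp add: divide_le_eq)
qed

text \<open>The dual of T \<le> M, namely T M^-1 T \<le> T. It gives C1 for the factor
  \<open>chi T\<close>, for which no optimality condition is at hand.\<close>

lemma T_bessel:
  assumes M: "pos_form UNIV M" and le: "\<And>x. x \<bullet> T x \<le> x \<bullet> M x" and v: "form_onb UNIV M v"
  shows "(\<Sum>m<DIM('a). (v m \<bullet> T z)\<^sup>2) \<le> z \<bullet> T z"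
proof -
  let ?d = "DIM('a)"
  define c where "c m = v m \<bullet> T z" for m
  \<comment> \<open>This is M^-1 T z, so that \<open>x \<bullet> M x\<close> and
    \<open>x \<bullet> T z\<close> are both S.\<close>
  define x where "x = (\<Sum>m<?d. c m *\<^sub>R v m)"
  define S where "S = (\<Sum>m<?d. (c m)\<^sup>2)"
  have linM: "linear M" using M by (simp add: pos_form_def)
  have vv: "v m \<bullet> M (v k) = (if m = k then 1 else 0)" if "m < ?d" "k < ?d" for m k
    using v that by (simp add: form_onb_def)
  have 1: "x \<bullet> w = (\<Sum>m<?d. c m * (v m \<bullet> w))" for w by (simp add: x_def inner_sum_left)
  have 2: "w \<bullet> M x = (\<Sum>k<?d. c k * (w \<bullet> M (v k)))" for w
    by (simp add: x_def linear_sum[OF linM] linear_scale[OF linM] inner_sum_right)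
  have "x \<bullet> M x = (\<Sum>m<?d. c m * (\<Sum>k<?d. c k * (v m \<bullet> M (v k))))" by (rule trans[OF 1]) (simp only: 2)
  also have "\<dots> = (\<Sum>m<?d. c m * (\<Sum>k<?d. if k = m then c m else 0))"
    using vv by (intro sum.cong refl arg_cong2[where f = "(*)"]) auto
  finally have xMx: "x \<bullet> M x = S" by (simp add: S_def power2_eq_square)
  have xTz: "x \<bullet> T z = S" unfolding 1 S_def c_def by (simp add: power2_eq_square)
  have S0: "0 \<le> S" unfolding S_def by (intro sum_nonneg) auto
  have zz: "0 \<le> z \<bullet> T z" by (rule pos_form_nonneg[OF posT]) simp
  have "S\<^sup>2 \<le> (x \<bullet> T x) * (z \<bullet> T z)"
    using pos_form_Cauchy_Schwarz[OF subspace_UNIV posT, of x z] by (simp add: xTz)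
  also have "\<dots> \<le> S * (z \<bullet> T z)" using le[of x] zz unfolding xMx by (intro mult_right_mono)
  finally have "S * S \<le> S * (z \<bullet> T z)" by (simp add: power2_eq_square)
  then show ?thesis using S0 zz unfolding S_def[symmetric] c_def[symmetric] by (cases "S = 0") auto
qed

text \<open>The weight \<open>chi T\<close> is treated as one more factor (index \<open>None\<close>): exponent 1, identity map, a single
  Gaussian centred at 0, and \<open>A = R = T\<close>.\<close>

lemma mixture_inequality:
  fixes K :: "'j \<Rightarrow> 'b set" and a :: "'j \<Rightarrow> 'b \<Rightarrow> real"
  assumes \<alpha>: "\<forall>j\<in>J. 0 < \<alpha> j" and \<beta>: "0 \<le> \<beta>" and perc: "perceptive J l q \<alpha> \<beta>"
    and surj: "\<forall>j\<in>J. ess_rank (\<alpha> j) UNIV (l j) = dim (V j)"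
    and K: "\<And>j. j \<in> J \<Longrightarrow> finite (K j)" "\<And>j. j \<in> J \<Longrightarrow> K j \<noteq> {}" "\<And>j. j \<in> J \<Longrightarrow> K j \<subseteq> V j"
    and a: "\<And>j k. j \<in> J \<Longrightarrow> k \<in> K j \<Longrightarrow> 0 < a j k"
  shows "(\<integral>\<^sup>+x. ennreal (chi T x * (\<Prod>j\<in>J. (\<Sum>k\<in>K j. a j k * gauss_on (V j) (R j) (l j x - k)) powr q j)) \<partial>lborel)
    \<le> ennreal (BL_const \<alpha> \<beta> * (\<Prod>j\<in>J. (\<Sum>k\<in>K j. a j k) powr q j))"
proof -
  let ?d = "DIM('a)"
  obtain A where A: "A \<in> feasible" and pos: "\<And>j. j \<in> J \<Longrightarrow> pos_form (V j) (A j)" and max: "\<And>B. B \<in> feasible \<Longrightarrow> ratio B \<le> ratio A"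
    using maximiser by blast
  note I = form_intervalD[OF feasibleD[OF A]]
  let ?M = "form_sum A"
  have M: "pos_form UNIV ?M" by (rule feasible_pos_form_sum[OF A])
  have linM: "linear ?M" and linT: "linear T" using M posT by (auto simp: pos_form_def)
  have symT: "x \<bullet> T y = y \<bullet> T x" and symM: "x \<bullet> ?M y = y \<bullet> ?M x" for x y using posT M by (simp_all add: pos_form_def)
  obtain v where v: "form_onb UNIV ?M v"
    using simultaneous_diagonalisation[OF subspace_UNIV M linM symM] by metis
  obtain b0 where b0: "form_onb UNIV T b0"
    using simultaneous_diagonalisation[OF subspace_UNIV posT linT symT] by metis
  have "\<forall>j\<in>J. \<exists>b. form_onb (V j) (A j) b \<and> (\<forall>i<dim (V j). \<forall>k<dim (V j). i \<noteq> k \<longrightarrow> b i \<bullet> R j (b k) = 0)"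
  proof
    fix j assume j: "j \<in> J"
    have "\<forall>x\<in>V j. \<forall>y\<in>V j. x \<bullet> R j y = y \<bullet> R j x" using posR[OF j] by (simp add: pos_form_def)
    then show "\<exists>b. form_onb (V j) (A j) b \<and> (\<forall>i<dim (V j). \<forall>k<dim (V j). i \<noteq> k \<longrightarrow> b i \<bullet> R j (b k) = 0)"
      by (rule simultaneous_diagonalisation_aux[OF linR[OF j] V[OF j] refl pos[OF j]])
  qed
  from bchoice[OF this] obtain b where "\<forall>j\<in>J. form_onb (V j) (A j) (b j) \<and> (\<forall>i<dim (V j). \<forall>k<dim (V j). i \<noteq> k \<longrightarrow> b j i \<bullet> R j (b j k) = 0)" ..
  then have b: "\<And>j. j \<in> J \<Longrightarrow> form_onb (V j) (A j) (b j)"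
    and diag: "\<And>j i k. j \<in> J \<Longrightarrow> i < dim (V j) \<Longrightarrow> k < dim (V j) \<Longrightarrow> i \<noteq> k \<Longrightarrow> b j i \<bullet> R j (b j k) = 0" by blast+
  have bV: "b j i \<in> V j" if "j \<in> J" "i < dim (V j)" for j i using b that by (simp add: form_onb_def)
  define r where "r j i = b j i \<bullet> R j (b j i)" for j i
  have r1: "1 \<le> r j i" if "j \<in> J" "i < dim (V j)" for j i
    using I(6)[OF that(1) bV[OF that]] b[OF that(1)] that by (simp add: r_def form_onb_def)
  \<comment> \<open>Then \<open>\<theta> j i \<bullet> x\<close> is the i-th coordinate of
    \<open>l j x\<close> in the basis \<open>b j\<close>.\<close>
  define \<theta> where "\<theta> j i = adjoint (l j) (A j (b j i))" for j i
  have \<theta>: "\<theta> j i \<bullet> x = b j i \<bullet> A j (l j x)" if "j \<in> J" "i < dim (V j)" for j i x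
  proof -
    have "\<theta> j i \<bullet> x = l j x \<bullet> A j (b j i)" by (simp add: \<theta>_def adjoint_works[OF l[OF that(1)]] inner_commute[of _ x])
    then show ?thesis using I(4)[OF that(1) lV[OF that(1)] bV[OF that]] by simp
  qed
  define J' where "J' = insert None (Some ` J)"
  define q' where "q' = case_option 1 q"
  define n' where "n' = case_option ?d (\<lambda>j. dim (V j))"
  define \<theta>' where "\<theta>' = case_option (\<lambda>i. T (b0 i)) \<theta>"
  \<comment> \<open>With r = 1 and centre 0 the factor for T is constant along the flow, and C2 is
    trivial for it.\<close>
  define r' where "r' = case_option (\<lambda>i. 1) r"
  define K' where "K' = case_option {0} K"
  define a' where "a' = case_option (\<lambda>k. 1) a"
  define y' where "y' = case_option (\<lambda>k i. 0) (\<lambda>j k i. b j i \<bullet> A j k)"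
  note defs = q'_def n'_def \<theta>'_def r'_def K'_def a'_def y'_def
  have sumJ: "(\<Sum>p\<in>J'. F p) = F None + (\<Sum>j\<in>J. F (Some j))" for F :: "'j option \<Rightarrow> real"
    unfolding J'_def by (rule sum_insert_None[OF finJ])
  have frame: "(\<Sum>p\<in>J'. q' p * (\<Sum>i<n' p. (\<theta>' p i \<bullet> x) * (\<theta>' p i \<bullet> y))) = x \<bullet> ?M y" for x y
  proof -
    have "x \<bullet> T y = (\<Sum>i<?d. (T (b0 i) \<bullet> x) * (T (b0 i) \<bullet> y))"
      using form_onb_parseval2[OF subspace_UNIV posT b0, of x y] symT[of "b0 _"] by (simp add: inner_commute)
    moreover have "l j x \<bullet> A j (l j y) = (\<Sum>i<dim (V j). (\<theta> j i \<bullet> x) * (\<theta> j i \<bullet> y))" if j: "j \<in> J" for j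
      using form_onb_parseval2[OF V[OF j] pos[OF j] b[OF j] lV[OF j], of x "l j y"] \<theta>[OF j] by simp
    ultimately show ?thesis unfolding sumJ form_sum_inner by (simp add: defs)
  qed
  have bessel: "(\<Sum>m<?d. (\<Sum>i<dim (V j). c i * (\<theta> j i \<bullet> v m))\<^sup>2) \<le> (\<Sum>i<dim (V j). (c i)\<^sup>2)" if j: "j \<in> J" for j c
  proof -
    define z where "z = (\<Sum>i<dim (V j). c i *\<^sub>R b j i)"
    have zV: "z \<in> V j" unfolding z_def using bV[OF j] V[OF j] by (intro subspace_sum subspace_scale) auto
    have bb: "b j i \<bullet> A j (b j k) = (if i = k then 1 else 0)" if "i < dim (V j)" "k < dim (V j)" for i k
      using b[OF j] that by (simp add: form_onb_def)
    have Az: "A j z = (\<Sum>k<dim (V j). c k *\<^sub>R A j (b j k))"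
      unfolding z_def by (simp add: linear_sum[OF I(1)[OF j]] linear_scale[OF I(1)[OF j]])
    have "b j i \<bullet> A j z = c i" if "i < dim (V j)" for i
      using that by (simp add: Az inner_sum_right bb if_distrib[of "\<lambda>u. _ * u"] cong: if_cong)
    then have "z \<bullet> A j z = (\<Sum>i<dim (V j). (c i)\<^sup>2)"
      using form_onb_parseval2[OF V[OF j] pos[OF j] b[OF j] zV, of z] by (simp add: power2_eq_square)
    moreover have "l j x \<bullet> A j z = (\<Sum>i<dim (V j). c i * (\<theta> j i \<bullet> x))" for x
      unfolding Az inner_sum_right using I(4)[OF j lV[OF j] bV[OF j]] \<theta>[OF j] by simp
    ultimately show ?thesis using maximiser_bessel[OF A pos max j zV v] by simp
  qed
  have bessel0: "(\<Sum>m<?d. (\<Sum>i<?d. c i * (T (b0 i) \<bullet> v m))\<^sup>2) \<le> (\<Sum>i<?d. (c i)\<^sup>2)" for c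
  proof -
    define z where "z = (\<Sum>i<?d. c i *\<^sub>R b0 i)"
    have bb: "b0 i \<bullet> T (b0 k) = (if i = k then 1 else 0)" if "i < ?d" "k < ?d" for i k
      using b0 that by (simp add: form_onb_def)
    have Tz: "T z = (\<Sum>k<?d. c k *\<^sub>R T (b0 k))"
      unfolding z_def by (simp add: linear_sum[OF linT] linear_scale[OF linT])
    have "b0 i \<bullet> T z = c i" if "i < ?d" for i
      using that by (simp add: Tz inner_sum_right bb if_distrib[of "\<lambda>u. _ * u"] cong: if_cong)
    then have "z \<bullet> T z = (\<Sum>i<?d. (c i)\<^sup>2)"
      using form_onb_parseval2[OF subspace_UNIV posT b0, of z z] by (simp add: power2_eq_square)
    moreover have "v m \<bullet> T z = (\<Sum>i<?d. c i * (T (b0 i) \<bullet> v m))" for m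
      unfolding Tz inner_sum_right by (simp add: inner_commute)
    moreover have "x \<bullet> T x \<le> x \<bullet> ?M x" for x
    proof -
      have "0 \<le> (\<Sum>j\<in>J. q j * (l j x \<bullet> A j (l j x)))"
        using q I(5)[OF _ lV] by (intro sum_nonneg mult_nonneg_nonneg) (auto simp: less_imp_le)
      then show ?thesis unfolding form_sum_inner by simp
    qed
    ultimately show ?thesis using T_bessel[OF M _ v, of z] by simp
  qed
  \<comment> \<open>Complementary slackness: every term is nonnegative because r \<ge> 1 and
    \<kappa> \<le> 1, and the trace inequality makes their sum at most 0.\<close>
  have kkt: "(r j i - 1) * (1 - (\<Sum>m<?d. (\<theta> j i \<bullet> v m)\<^sup>2)) = 0" if j: "j \<in> J" and i: "i < dim (V j)" for j i
  proof -
    let ?\<kappa> = "\<lambda>i. \<Sum>m<?d. (\<theta> j i \<bullet> v m)\<^sup>2"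
    have \<kappa>1: "?\<kappa> i \<le> 1" if "i < dim (V j)" for i
      using bessel[OF j, of "\<lambda>k. if k = i then 1 else 0"] that
      by (simp add: if_distrib[of "\<lambda>u. u * _"] if_distrib[of "\<lambda>u. u\<^sup>2"] cong: if_cong)
    have nn: "0 \<le> (r j i - 1) * (1 - ?\<kappa> i)" if "i < dim (V j)" for i
      using r1[OF j that] \<kappa>1[OF that] by simp
    have "l j x \<bullet> R j (l j x) - l j x \<bullet> A j (l j x) = (\<Sum>i<dim (V j). (r j i - 1) * (\<theta> j i \<bullet> x)\<^sup>2)" for x
    proof -
      have "l j x \<bullet> R j (l j x) = (\<Sum>i<dim (V j). r j i * (\<theta> j i \<bullet> x)\<^sup>2)"
        using form_onb_quadratic[OF V[OF j] pos[OF j] b[OF j] linR[OF j] lV[OF j] diag[OF j]] \<theta>[OF j] by (simp add: r_def)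
      moreover have "l j x \<bullet> A j (l j x) = (\<Sum>i<dim (V j). (\<theta> j i \<bullet> x)\<^sup>2)"
        using form_onb_parseval2[OF V[OF j] pos[OF j] b[OF j] lV[OF j], of x "l j x"] \<theta>[OF j] by (simp add: power2_eq_square)
      ultimately show ?thesis by (simp add: left_diff_distrib sum_subtractf)
    qed
    then have "(\<Sum>i<dim (V j). r j i - 1) \<le> (\<Sum>m<?d. \<Sum>i<dim (V j). (r j i - 1) * (\<theta> j i \<bullet> v m)\<^sup>2)"
      using maximiser_trace_le[OF A pos max j b[OF j] v] by (simp add: r_def)
    also have "\<dots> = (\<Sum>i<dim (V j). (r j i - 1) * ?\<kappa> i)" by (subst sum.swap) (simp add: sum_distrib_left)
    finally have "(\<Sum>i<dim (V j). (r j i - 1) * (1 - ?\<kappa> i)) \<le> 0" by (simp add: right_diff_distrib sum_subtractf)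
    moreover have "0 \<le> (\<Sum>i<dim (V j). (r j i - 1) * (1 - ?\<kappa> i))" using nn by (intro sum_nonneg) auto
    ultimately have "(\<Sum>i<dim (V j). (r j i - 1) * (1 - ?\<kappa> i)) = 0" by linarith
    then have "\<forall>i\<in>{..<dim (V j)}. (r j i - 1) * (1 - ?\<kappa> i) = 0"
      by (subst (asm) sum_nonneg_eq_0_iff) (use nn in auto)
    then show ?thesis using i by blast
  qed
  interpret G: gaussian_flow J' q' n' \<theta>' r' K' a' y' v ?d
  proof
    show "finite J'" unfolding J'_def using finJ by simp
    fix p assume "p \<in> J'"
    then consider "p = None" | j where "j \<in> J" "p = Some j" unfolding J'_def by blast
    note cs = this
    show "0 < q' p" using cs by cases (auto simp: defs q)
    show "1 \<le> r' p i" if "i < n' p" for i using cs that by cases (auto simp: defs r1)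
    show "finite (K' p)" "K' p \<noteq> {}" using cs by (cases; auto simp: defs K)+
    show "0 < a' p k" if "k \<in> K' p" for k using cs that by cases (auto simp: defs a)
    show "(\<Sum>m<?d. (\<Sum>i<n' p. c i * (\<theta>' p i \<bullet> v m))\<^sup>2) \<le> (\<Sum>i<n' p. (c i)\<^sup>2)" for c
      using cs by cases (use bessel bessel0 in \<open>auto simp: defs\<close>)
    show "(r' p i - 1) * (1 - (\<Sum>m<?d. (\<theta>' p i \<bullet> v m)\<^sup>2)) = 0" if "i < n' p" for i
      using cs that by cases (use kkt in \<open>auto simp: defs\<close>)
  next
    fix m m' assume "m < ?d" "m' < ?d"
    then show "(\<Sum>p\<in>J'. q' p * (\<Sum>i<n' p. (\<theta>' p i \<bullet> v m) * (\<theta>' p i \<bullet> v m'))) = (if m = m' then 1 else 0)"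
      unfolding frame using v by (simp add: form_onb_def)
  next
    fix x
    have "x = (\<Sum>m<?d. (v m \<bullet> ?M x) *\<^sub>R v m)"
      using form_onb_expand[OF subspace_UNIV M v, of x] by simp
    then show "x = (\<Sum>m<?d. (\<Sum>p\<in>J'. q' p * (\<Sum>i<n' p. (\<theta>' p i \<bullet> x) * (\<theta>' p i \<bullet> v m))) *\<^sub>R v m)"
      unfolding frame symM[of x] .
  qed
  let ?mass = "\<Prod>j\<in>J. (\<Sum>k\<in>K j. a j k) powr q j"
  \<comment> \<open>Compensates the normalisation: \<open>gauss_on\<close> carries the root of det R
    j, while \<open>mix\<close> at s = 1 carries that of the product of the r j i, which is det R j
    / det A j.\<close>
  define \<Delta> where "\<Delta> = (\<Prod>j\<in>J. det_on (V j) (A j) powr (q j / 2))"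
  have massp: "0 < (\<Sum>k\<in>K j. a j k)" if "j \<in> J" for j using that K a by (intro sum_pos) auto
  \<comment> \<open>At s = 0 all centres are 0 and all den are 1, so each mixture collapses to its
    mass times a single Gaussian.\<close>
  have W0: "G.W 0 x = ?mass * exp (- pi * (x \<bullet> ?M x))" for x
  proof -
    have "ln (G.U p 0 x) = ln (\<Sum>k\<in>K' p. a' p k) - pi * (\<Sum>i<n' p. (\<theta>' p i \<bullet> x) * (\<theta>' p i \<bullet> x))" if p: "p \<in> J'" for p
    proof -
      have "G.U p 0 x = (\<Sum>k\<in>K' p. a' p k) * exp (- pi * (\<Sum>i<n' p. (\<theta>' p i \<bullet> x) * (\<theta>' p i \<bullet> x)))"
        by (simp add: G.U_def G.mix_def G.den_def sum_distrib_left sum_distrib_right power2_eq_square sum_negf)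
      moreover have "0 < (\<Sum>k\<in>K' p. a' p k)" using G.K[OF p] G.a[OF p] by (intro sum_pos) auto
      ultimately show ?thesis by (simp add: ln_mult)
    qed
    then have "(\<Sum>p\<in>J'. q' p * ln (G.U p 0 x)) = (\<Sum>p\<in>J'. q' p * ln (\<Sum>k\<in>K' p. a' p k)) - pi * (x \<bullet> ?M x)"
      unfolding frame[symmetric] by (simp add: right_diff_distrib sum_subtractf sum_distrib_left mult.left_commute)
    also have "(\<Sum>p\<in>J'. q' p * ln (\<Sum>k\<in>K' p. a' p k)) = (\<Sum>j\<in>J. q j * ln (\<Sum>k\<in>K j. a j k))"
      unfolding sumJ by (simp add: defs)
    finally have "G.W 0 x = exp (\<Sum>j\<in>J. q j * ln (\<Sum>k\<in>K j. a j k)) * exp (- pi * (x \<bullet> ?M x))"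
      unfolding G.W_def exp_add[symmetric] by simp
    also have "exp (\<Sum>j\<in>J. q j * ln (\<Sum>k\<in>K j. a j k)) = ?mass"
      unfolding exp_sum[OF finJ] by (intro prod.cong) (auto simp: powr_def dest: massp)
    finally show ?thesis .
  qed
  have f: "(\<Sum>k\<in>K j. a j k * gauss_on (V j) (R j) (l j x - k)) = sqrt (det_on (V j) (A j)) * G.U (Some j) 1 x" if j: "j \<in> J" for j x
  proof -
    have dR: "det_on (V j) (R j) = (\<Prod>i<dim (V j). r j i) * det_on (V j) (A j)"
      unfolding r_def by (rule det_on_diag[OF V[OF j] b[OF j] I(1)[OF j] linR[OF j] diag[OF j]])
    have rp: "0 < r j i" if "i < dim (V j)" for i using r1[OF j that] by simp
    have "G.mix (Some j) k 1 x = a j k * (sqrt (\<Prod>i<dim (V j). r j i) * chi (R j) (l j x - k))" if k: "k \<in> K j" for k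
    proof -
      have kV: "k \<in> V j" using K(3)[OF j] k by blast
      have dV: "l j x - k \<in> V j" using subspace_diff[OF V[OF j] lV[OF j] kV] .
      have quad: "(l j x - k) \<bullet> R j (l j x - k) = (\<Sum>i<dim (V j). r j i * (\<theta> j i \<bullet> x - b j i \<bullet> A j k)\<^sup>2)"
        using form_onb_quadratic[OF V[OF j] pos[OF j] b[OF j] linR[OF j] dV diag[OF j]] \<theta>[OF j]
        by (simp add: r_def linear_diff[OF I(1)[OF j]] inner_diff_right)
      have "(\<Sum>i<dim (V j). - ln (1 / r j i) / 2 - pi * (\<theta> j i \<bullet> x - b j i \<bullet> A j k)\<^sup>2 / (1 / r j i))
          = (\<Sum>i<dim (V j). ln (r j i)) / 2 - pi * ((l j x - k) \<bullet> R j (l j x - k))"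
        unfolding quad sum_distrib_left sum_divide_distrib sum_subtractf[symmetric]
        using rp by (intro sum.cong) (auto simp: ln_div)
      then have "G.mix (Some j) k 1 x = a j k * (exp ((\<Sum>i<dim (V j). ln (r j i)) / 2) * chi (R j) (l j x - k))"
        unfolding G.mix_def G.den_def chi_def exp_add[symmetric] by (simp add: defs)
      also have "(\<Sum>i<dim (V j). ln (r j i)) = ln (\<Prod>i<dim (V j). r j i)"
        by (rule ln_prod[symmetric]) (use rp in \<open>simp_all add: less_imp_neq[THEN not_sym]\<close>)
      also have "exp (ln (\<Prod>i<dim (V j). r j i) / 2) = sqrt (\<Prod>i<dim (V j). r j i)"
      proof -
        have "0 < (\<Prod>i<dim (V j). r j i)" using rp by (intro prod_pos) auto
        then show ?thesis by (rule exp_half_ln)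
      qed
      finally show ?thesis .
    qed
    then have "G.U (Some j) 1 x = (\<Sum>k\<in>K j. a j k * (sqrt (\<Prod>i<dim (V j). r j i) * chi (R j) (l j x - k)))"
      unfolding G.U_def by (simp add: K'_def)
    then show ?thesis
      unfolding gauss_on_def dR by (simp add: sum_distrib_left real_sqrt_mult ac_simps)
  qed
  have W1: "chi T x * (\<Prod>j\<in>J. (\<Sum>k\<in>K j. a j k * gauss_on (V j) (R j) (l j x - k)) powr q j) = \<Delta> * G.W 1 x" for x
  proof -
    have "x \<bullet> T x = (\<Sum>i<?d. (T (b0 i) \<bullet> x)\<^sup>2)"
      using form_onb_parseval2[OF subspace_UNIV posT b0, of x x] symT[of "b0 _" x]
      by (simp add: power2_eq_square inner_commute)
    then have "G.U None 1 x = chi T x"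
      unfolding G.U_def G.mix_def G.den_def by (simp add: defs chi_def sum_negf sum_distrib_left)
    then have "G.W 1 x = chi T x * exp (\<Sum>j\<in>J. q j * ln (G.U (Some j) 1 x))"
      unfolding G.W_def sumJ exp_add by (simp add: q'_def chi_def)
    also have "exp (\<Sum>j\<in>J. q j * ln (G.U (Some j) 1 x)) = (\<Prod>j\<in>J. G.U (Some j) 1 x powr q j)"
    proof -
      have "G.U (Some j) 1 x \<noteq> 0" if "j \<in> J" for j using G.U_pos[of "Some j" 1 x] that by (simp add: J'_def)
      then show ?thesis unfolding exp_sum[OF finJ] by (intro prod.cong) (auto simp: powr_def)
    qed
    finally have W: "G.W 1 x = chi T x * (\<Prod>j\<in>J. G.U (Some j) 1 x powr q j)" .
    have "(\<Prod>j\<in>J. (\<Sum>k\<in>K j. a j k * gauss_on (V j) (R j) (l j x - k)) powr q j)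
        = (\<Prod>j\<in>J. det_on (V j) (A j) powr (q j / 2) * G.U (Some j) 1 x powr q j)"
    proof (rule prod.cong)
      fix j assume j: "j \<in> J"
      have "0 < det_on (V j) (A j)" by (rule pos_form_det[OF V[OF j] pos[OF j]])
      moreover have "0 < G.U (Some j) 1 x" using j by (intro G.U_pos) (simp add: J'_def)
      ultimately show "(\<Sum>k\<in>K j. a j k * gauss_on (V j) (R j) (l j x - k)) powr q j
          = det_on (V j) (A j) powr (q j / 2) * G.U (Some j) 1 x powr q j"
        unfolding f[OF j] by (simp add: powr_mult powr_half_sqrt[symmetric] powr_powr)
    qed simp
    then show ?thesis unfolding W \<Delta>_def prod.distrib by simp
  qed
  have \<Delta>0: "0 \<le> \<Delta>" unfolding \<Delta>_def by (intro prod_nonneg) auto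
  have mass0: "0 \<le> ?mass" by (intro prod_nonneg) auto
  have dM: "0 < det_on UNIV ?M" by (rule pos_form_det[OF subspace_UNIV M])
  have int0: "(\<integral>x. G.W 0 x \<partial>lborel) = ?mass / sqrt (det_on UNIV ?M)"
  proof -
    have "ennreal (\<integral>x. G.W 0 x \<partial>lborel) = (\<integral>\<^sup>+x. ennreal (G.W 0 x) \<partial>lborel)"
      by (rule nn_integral_eq_integral[symmetric, OF G.integrable_W]) (auto simp: less_imp_le G.W_pos)
    also have "\<dots> = (\<integral>\<^sup>+x. ennreal ?mass * ennreal (exp (- pi * (x \<bullet> ?M x))) \<partial>lborel)"
      unfolding W0 using mass0 by (simp add: ennreal_mult)
    also have "\<dots> = ennreal ?mass * ennreal (1 / sqrt (det_on UNIV ?M))"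
      using nn_integral_gauss_lborel[OF M] borel_measurable_exp_form[OF linM, of 0]
      by (subst nn_integral_cmult) auto
    also have "\<dots> = ennreal (?mass / sqrt (det_on UNIV ?M))"
      using mass0 dM by (simp add: ennreal_mult[symmetric])
    finally show ?thesis
      using mass0 dM G.W_pos by (subst (asm) ennreal_inj) (auto intro!: integral_nonneg_AE simp: less_imp_le)
  qed
  have "(\<integral>\<^sup>+x. ennreal (chi T x * (\<Prod>j\<in>J. (\<Sum>k\<in>K j. a j k * gauss_on (V j) (R j) (l j x - k)) powr q j)) \<partial>lborel)
      = (\<integral>\<^sup>+x. ennreal (\<Delta> * G.W 1 x) \<partial>lborel)" unfolding W1 ..
  also have "\<dots> = ennreal (\<integral>x. \<Delta> * G.W 1 x \<partial>lborel)"
    using \<Delta>0 G.integrable_W[of 1] by (intro nn_integral_eq_integral) (auto simp: less_imp_le G.W_pos)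
  also have "(\<integral>x. \<Delta> * G.W 1 x \<partial>lborel) = \<Delta> * (\<integral>x. G.W 1 x \<partial>lborel)" by simp
  also have "ennreal (\<Delta> * (\<integral>x. G.W 1 x \<partial>lborel)) \<le> ennreal (BL_const \<alpha> \<beta> * ?mass)"
  proof (rule ennreal_leI)
    have "\<Delta> * (\<integral>x. G.W 1 x \<partial>lborel) \<le> \<Delta> * (?mass / sqrt (det_on UNIV ?M))"
      using G.integral_W_le \<Delta>0 unfolding int0 by (rule mult_left_mono)
    also have "\<dots> = (\<Delta> / sqrt (det_on UNIV ?M)) * ?mass" by simp
    also have "\<dots> \<le> BL_const \<alpha> \<beta> * ?mass"
    proof (rule mult_right_mono[OF _ mass0])
      have "\<Delta>\<^sup>2 = (\<Prod>j\<in>J. det_on (V j) (A j) powr q j)"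
        unfolding \<Delta>_def prod_power_distrib powr_half_square ..
      then have "(\<Delta> / sqrt (det_on UNIV ?M))\<^sup>2 = ratio A" using dM by (simp add: power_divide ratio_def)
      also have "\<dots> \<le> (BL_const \<alpha> \<beta>)\<^sup>2" by (rule ratio_le_BL_const[OF \<alpha> \<beta> perc surj A pos])
      finally show "\<Delta> / sqrt (det_on UNIV ?M) \<le> BL_const \<alpha> \<beta>"
        by (rule power2_le_imp_le) (rule BL_const_nonneg)
    qed
    finally show "\<Delta> * (\<integral>x. G.W 1 x \<partial>lborel) \<le> BL_const \<alpha> \<beta> * ?mass" .
  qed
  finally show ?thesis .
qed

end

section \<open>Functions of Gaussian type\<close>

lemma gauss_on_measurable:
  assumes "linear R"
  shows "gauss_on V R \<in> borel_measurable borel"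
proof -
  have [measurable]: "R \<in> borel_measurable borel"
    using assms by (intro borel_measurable_continuous_onI linear_continuous_on) (simp add: linear_conv_bounded_linear)
  show ?thesis unfolding gauss_on_def[abs_def] chi_def by measurable
qed

lemma continuous_gauss_on:
  assumes "linear R"
  shows "continuous_on UNIV (gauss_on V R)"
proof -
  have "continuous_on UNIV R" using assms by (intro linear_continuous_on) (simp add: linear_conv_bounded_linear)
  then show ?thesis unfolding gauss_on_def[abs_def] chi_def by (intro continuous_intros)
qed

lemma gauss_on_bounds:
  assumes V: "subspace V" and R: "pos_form V R" and x: "x \<in> V"
  shows "0 \<le> gauss_on V R x" "gauss_on V R x \<le> sqrt (det_on V R)"
proof -
  have "0 < det_on V R" by (rule pos_form_det[OF V R])
  moreover have "0 \<le> pi * (x \<bullet> R x)" using pos_form_nonneg[OF R x] by simp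
  then have "chi R x \<le> 1" unfolding chi_def by simp
  ultimately show "0 \<le> gauss_on V R x" "gauss_on V R x \<le> sqrt (det_on V R)"
    unfolding gauss_on_def by (auto simp: chi_def intro: mult_left_le)
qed

locale gauss_type = finite_measure \<mu> for \<mu> :: "'b::euclidean_space measure" +
  fixes V :: "'b set" and R :: "'b \<Rightarrow> 'b"
  assumes sets_\<mu>: "sets \<mu> = sets (restrict_space borel V)" and V: "subspace V" and R: "pos_form V R"
begin

lemma space_\<mu>: "space \<mu> = V"
  using sets_eq_imp_space_eq[OF sets_\<mu>] by (simp add: space_restrict_space)

lemma linR: "linear R"
  using R by (simp add: pos_form_def)

lemma id_measurable: "(\<lambda>x. x) \<in> \<mu> \<rightarrow>\<^sub>M borel"
  unfolding measurable_cong_sets[OF sets_\<mu> refl] by (intro measurable_restrict_space1) simp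

lemma gauss_measurable [measurable]:
  assumes "G \<in> \<mu> \<rightarrow>\<^sub>M borel"
  shows "(\<lambda>y. gauss_on V R (x - G y)) \<in> borel_measurable \<mu>"
  using measurable_compose[OF borel_measurable_diff[OF borel_measurable_const assms] gauss_on_measurable[OF linR]] .

lemma gauss_integrable:
  assumes G: "G \<in> \<mu> \<rightarrow>\<^sub>M borel" and GV: "\<And>y. y \<in> V \<Longrightarrow> G y \<in> V" and x: "x \<in> V"
  shows "integrable \<mu> (\<lambda>y. gauss_on V R (x - G y))"
proof (rule integrable_const_bound[OF _ gauss_measurable[OF G]])
  show "AE y in \<mu>. norm (gauss_on V R (x - G y)) \<le> sqrt (det_on V R)"
    using gauss_on_bounds[OF V R subspace_diff[OF V x GV]] by (intro AE_I2) (auto simp: space_\<mu>)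
qed

text \<open>Approximating the identity of \<open>V\<close> by simple functions replaces \<open>\<mu>\<close> by finite sums of point masses.\<close>

lemma mixture_approximation:
  assumes pos: "0 < measure \<mu> V"
  shows "\<exists>K a. \<forall>i :: nat. finite (K i) \<and> K i \<noteq> {} \<and> K i \<subseteq> V \<and> (\<forall>k\<in>K i. 0 < a i k) \<and> (\<Sum>k\<in>K i. a i k) = measure \<mu> V \<and>
     (\<forall>x\<in>V. (\<lambda>i. \<Sum>k\<in>K i. a i k * gauss_on V R (x - k)) \<longlonglongrightarrow> (\<integral>y. gauss_on V R (x - y) \<partial>\<mu>))"
proof -
  obtain F where F: "\<And>i. simple_function \<mu> (F i)" "\<And>y. y \<in> space \<mu> \<Longrightarrow> (\<lambda>i. F i y) \<longlonglongrightarrow> y"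
    using borel_measurable_implies_sequence_metric[OF id_measurable, of 0] by metis
  \<comment> \<open>The simple functions converge in the ambient space; projecting brings their
    values into V and does not move the limit.\<close>
  define G where "G i y = proj_on V (F i y)" for i y
  have Gs: "simple_function \<mu> (G i)" for i
    using simple_function_compose1[OF F(1)] unfolding G_def .
  have Gm: "G i \<in> \<mu> \<rightarrow>\<^sub>M borel" for i
    by (rule borel_measurable_simple_function[OF Gs])
  have GV: "G i y \<in> V" for i y unfolding G_def by (rule proj_on_in[OF V])
  have cp: "continuous_on UNIV (proj_on V)"
    using linear_proj_on[of V] by (intro linear_continuous_on) (simp add: linear_conv_bounded_linear)
  have Glim: "(\<lambda>i. G i y) \<longlonglongrightarrow> y" if "y \<in> V" for y
  proof -
    have "(\<lambda>i. proj_on V (F i y)) \<longlonglongrightarrow> proj_on V y"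
      using F(2)[of y] that by (intro continuous_on_tendsto_compose[OF cp]) (auto simp: space_\<mu>)
    then show ?thesis using proj_on_id[OF V that] by (simp add: G_def)
  qed
  have fin: "finite (G i ` V)" for i using Gs[of i] by (simp add: simple_function_def space_\<mu>)
  define a where "a i k = measure \<mu> (G i -` {k} \<inter> V)" for i k
  \<comment> \<open>Values of mass 0 are discarded because the mixture inequality requires positive
    weights.\<close>
  define K where "K i = {k \<in> G i ` V. a i k \<noteq> 0}" for i
  have finK: "finite (K i)" for i using fin by (simp add: K_def)
  have sets: "G i -` {k} \<inter> V \<in> sets \<mu>" for i k
    using simple_functionD(2)[OF Gs, of i "{k}"] by (simp add: space_\<mu>)
  have sumK: "(\<Sum>k\<in>K i. a i k * h k) = (\<integral>y. h (G i y) \<partial>\<mu>)" for i and h :: "'b \<Rightarrow> real"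
  proof -
    have "(\<integral>y. h (G i y) \<partial>\<mu>) = (\<integral>y. (\<Sum>k\<in>G i ` V. h k * indicator (G i -` {k} \<inter> V) y) \<partial>\<mu>)"
    proof (rule Bochner_Integration.integral_cong)
      fix y assume y: "y \<in> space \<mu>"
      have "(\<Sum>k\<in>G i ` V. h k * indicator (G i -` {k} \<inter> V) y) = (\<Sum>k\<in>G i ` V. if k = G i y then h (G i y) else 0)"
        using y by (intro sum.cong) (auto simp: space_\<mu> indicator_def)
      then show "h (G i y) = (\<Sum>k\<in>G i ` V. h k * indicator (G i -` {k} \<inter> V) y)"
        using y fin by (simp add: space_\<mu>)
    qed simp
    also have "\<dots> = (\<Sum>k\<in>G i ` V. h k * measure \<mu> (G i -` {k} \<inter> V))"
      using sets by (subst Bochner_Integration.integral_sum) (auto simp: less_top[symmetric])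
    also have "\<dots> = (\<Sum>k\<in>K i. a i k * h k)"
      using fin by (intro sum.mono_neutral_cong_right) (auto simp: K_def a_def)
    finally show ?thesis ..
  qed
  have mass: "(\<Sum>k\<in>K i. a i k) = measure \<mu> V" for i
    using sumK[of i "\<lambda>_. 1"] by (simp add: space_\<mu>)
  have lim: "(\<lambda>i. \<Sum>k\<in>K i. a i k * gauss_on V R (x - k)) \<longlonglongrightarrow> (\<integral>y. gauss_on V R (x - y) \<partial>\<mu>)" if x: "x \<in> V" for x
    unfolding sumK
  proof (rule integral_dominated_convergence)
    show "(\<lambda>y. gauss_on V R (x - y)) \<in> borel_measurable \<mu>" by (rule gauss_measurable[OF id_measurable])
    show "(\<lambda>y. gauss_on V R (x - G i y)) \<in> borel_measurable \<mu>" for i by (rule gauss_measurable[OF Gm])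
    show "integrable \<mu> (\<lambda>_. sqrt (det_on V R))" by simp
    show "AE y in \<mu>. (\<lambda>i. gauss_on V R (x - G i y)) \<longlonglongrightarrow> gauss_on V R (x - y)"
    proof (rule AE_I2)
      fix y assume "y \<in> space \<mu>"
      then have "(\<lambda>i. x - G i y) \<longlonglongrightarrow> x - y" by (intro tendsto_intros Glim) (simp add: space_\<mu>)
      then show "(\<lambda>i. gauss_on V R (x - G i y)) \<longlonglongrightarrow> gauss_on V R (x - y)"
        by (intro continuous_on_tendsto_compose[OF continuous_gauss_on[OF linR]]) auto
    qed
    show "AE y in \<mu>. norm (gauss_on V R (x - G i y)) \<le> sqrt (det_on V R)" for i
      using gauss_on_bounds[OF V R subspace_diff[OF V x GV]] by (intro AE_I2) auto
  qed
  have "K i \<noteq> {}" for i using mass[of i] pos by auto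
  moreover have "K i \<subseteq> V" for i using GV by (auto simp: K_def)
  moreover have "0 < a i k" if "k \<in> K i" for i k
    using that by (auto simp: K_def a_def zero_less_measure_iff measure_nonneg less_le)
  ultimately show ?thesis using finK mass lim by (intro exI[of _ K] exI[of _ a]) simp
qed

text \<open>Translates of the normalised Gaussian have integral 1. Tonelli is applied in the
  coordinates of \<open>onb V\<close>, where the product measure is sigma-finite.\<close>

lemma integral_convolution: "(\<integral>x. (\<integral>y. gauss_on V R (x - y) \<partial>\<mu>) \<partial>lborel_on V) = measure \<mu> V"
proof -
  interpret product_sigma_finite "\<lambda>_. lborel::real measure" by standard
  let ?P = "\<Pi>\<^sub>M b\<in>onb V. lborel :: real measure"
  have "finite (onb V)" using onset_onb[OF V] by (simp add: onset_def)
  then interpret P: sigma_finite_measure ?P by (rule sigma_finite)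
  interpret PM: pair_sigma_finite ?P \<mu> ..
  have det: "0 < det_on V R" by (rule pos_form_det[OF V R])
  have [measurable]: "gauss_on V R \<in> borel_measurable borel" by (rule gauss_on_measurable[OF linR])
  have [measurable]: "(\<lambda>x. x) \<in> \<mu> \<rightarrow>\<^sub>M borel" by (rule id_measurable)
  define h where "h x = (\<integral>\<^sup>+y. ennreal (gauss_on V R (x - y)) \<partial>\<mu>)" for x
  have h_meas: "h \<in> borel_measurable borel" unfolding h_def[abs_def] by measurable
  have hV: "ennreal (\<integral>y. gauss_on V R (x - y) \<partial>\<mu>) = h x" if x: "x \<in> V" for x
    unfolding h_def using gauss_on_bounds(1)[OF V R subspace_diff[OF V x]]
    by (intro nn_integral_eq_integral[symmetric] gauss_integrable[OF id_measurable _ x] AE_I2) (auto simp: space_\<mu>)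
  have sV: "synth (onb V) f \<in> V" for f using synth_in_span span_onb[OF V] by blast
  have one: "(\<integral>\<^sup>+x. ennreal (gauss_on V R (x - y)) \<partial>lborel_on V) = 1" if y: "y \<in> V" for y
  proof -
    have "(\<integral>\<^sup>+x. ennreal (gauss_on V R (x - y)) \<partial>lborel_on V)
        = (\<integral>\<^sup>+x. ennreal (sqrt (det_on V R)) * ennreal (exp (- pi * ((x - y) \<bullet> R (x - y)))) \<partial>lborel_on V)"
      using det by (simp add: gauss_on_def chi_def ennreal_mult')
    also have "\<dots> = ennreal (sqrt (det_on V R)) * ennreal (1 / sqrt (det_on V R))"
      unfolding nn_integral_gauss_lborel_on[OF V R y, symmetric] using borel_measurable_exp_form[OF linR]
      by (intro nn_integral_cmult) (simp add: measurable_cong_sets[OF sets_lborel_on refl] measurable_restrict_space1)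
    also have "\<dots> = 1" using det by (simp add: ennreal_mult[symmetric])
    finally show ?thesis .
  qed
  have gm: "(\<lambda>x. ennreal (gauss_on V R (x - y))) \<in> borel_measurable borel" for y by measurable
  have "(\<integral>\<^sup>+x. ennreal (\<integral>y. gauss_on V R (x - y) \<partial>\<mu>) \<partial>lborel_on V) = (\<integral>\<^sup>+x. h x \<partial>lborel_on V)"
    by (rule nn_integral_cong) (simp add: hV)
  also have "\<dots> = (\<integral>\<^sup>+f. (\<integral>\<^sup>+y. ennreal (gauss_on V R (synth (onb V) f - y)) \<partial>\<mu>) \<partial>?P)"
    using nn_integral_lborel_on[OF V h_meas] by (simp only: h_def)
  also have "\<dots> = (\<integral>\<^sup>+y. (\<integral>\<^sup>+f. ennreal (gauss_on V R (synth (onb V) f - y)) \<partial>?P) \<partial>\<mu>)"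
    by (rule PM.Fubini'[symmetric]) measurable
  also have "\<dots> = (\<integral>\<^sup>+y. 1 \<partial>\<mu>)"
    by (rule nn_integral_cong) (simp add: nn_integral_lborel_on[OF V gm, symmetric] one space_\<mu>)
  also have "\<dots> = ennreal (measure \<mu> V)" by (simp add: emeasure_eq_measure space_\<mu>)
  finally have "(\<integral>\<^sup>+x. ennreal (\<integral>y. gauss_on V R (x - y) \<partial>\<mu>) \<partial>lborel_on V) = ennreal (measure \<mu> V)" .
  moreover have "(\<lambda>x. \<integral>y. gauss_on V R (x - y) \<partial>\<mu>) \<in> borel_measurable (lborel_on V)"
    unfolding measurable_cong_sets[OF sets_lborel_on refl] by (intro measurable_restrict_space1) measurable
  moreover have "AE x in lborel_on V. 0 \<le> (\<integral>y. gauss_on V R (x - y) \<partial>\<mu>)"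
    using gauss_on_bounds(1)[OF V R subspace_diff[OF V]] by (intro AE_I2 integral_nonneg_AE) (auto simp: space_\<mu>)
  ultimately show ?thesis by (simp add: integral_eq_nn_integral)
qed

end

section \<open>Passage from finite mixtures to functions of Gaussian type\<close>

context lr_datum
begin

lemma of_type_inequality:
  assumes \<alpha>: "\<forall>j\<in>J. 0 < \<alpha> j" and \<beta>: "0 \<le> \<beta>" and perc: "perceptive J l q \<alpha> \<beta>"
    and surj: "\<forall>j\<in>J. ess_rank (\<alpha> j) UNIV (l j) = dim (V j)"
    and f: "\<forall>j\<in>J. of_type (V j) (R j) (f j)"
  shows "(\<integral>\<^sup>+x. ennreal (chi T x * (\<Prod>j\<in>J. f j (l j x) powr q j)) \<partial>lborel)
    \<le> ennreal (BL_const \<alpha> \<beta>) * ennreal (\<Prod>j\<in>J. (\<integral>y. f j y \<partial>lborel_on (V j)) powr q j)"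
proof -
  obtain \<mu> where \<mu>: "\<forall>j\<in>J. finite_measure (\<mu> j) \<and> sets (\<mu> j) = sets (restrict_space borel (V j)) \<and>
      (\<forall>x\<in>V j. f j x = (\<integral>y. gauss_on (V j) (R j) (x - y) \<partial>\<mu> j))"
    using bchoice[OF f[unfolded of_type_def]] by blast
  have gt: "gauss_type (\<mu> j) (V j) (R j)" if "j \<in> J" for j
    using \<mu> that V posR by (simp add: gauss_type_def gauss_type_axioms_def)
  have fx: "f j x = (\<integral>y. gauss_on (V j) (R j) (x - y) \<partial>\<mu> j)" if "j \<in> J" "x \<in> V j" for j x using \<mu> that by blast
  have mass: "(\<integral>y. f j y \<partial>lborel_on (V j)) = measure (\<mu> j) (V j)" if j: "j \<in> J" for j
    unfolding gauss_type.integral_convolution[OF gt[OF j], symmetric]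
    by (rule Bochner_Integration.integral_cong) (auto simp: fx[OF j])
  show ?thesis
  \<comment> \<open>A zero measure has no mixture with positive weights; but then f j vanishes on V
    j and, since \<open>0 powr q j = 0\<close>, so does the integrand.\<close>
  proof (cases "\<exists>j\<in>J. measure (\<mu> j) (V j) = 0")
    case True
    then obtain j where j: "j \<in> J" "measure (\<mu> j) (V j) = 0" by blast
    interpret gauss_type "\<mu> j" "V j" "R j" by (rule gt[OF j(1)])
    have "AE y in \<mu> j. False"
      using j(2) by (intro AE_I'[of "V j"]) (auto simp: null_sets_def emeasure_eq_measure space_\<mu>[symmetric])
    then have "f j (l j x) = 0" for x
      unfolding fx[OF j(1) lV[OF j(1)]] by (intro integral_eq_zero_AE) auto
    then have "(\<Prod>j\<in>J. f j (l j x) powr q j) = 0" for x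
      using j(1) finJ by (intro prod_zero) (auto intro!: bexI[of _ j])
    then show ?thesis by simp
  next
    case False
    then have "0 < measure (\<mu> j) (V j)" if "j \<in> J" for j using that by (auto simp: less_le)
    then have "\<forall>j\<in>J. \<exists>Ka. \<forall>i :: nat. finite (fst Ka i) \<and> fst Ka i \<noteq> {} \<and> fst Ka i \<subseteq> V j \<and> (\<forall>k\<in>fst Ka i. 0 < snd Ka i k) \<and>
       (\<Sum>k\<in>fst Ka i. snd Ka i k) = measure (\<mu> j) (V j) \<and>
       (\<forall>x\<in>V j. (\<lambda>i. \<Sum>k\<in>fst Ka i. snd Ka i k * gauss_on (V j) (R j) (x - k)) \<longlonglongrightarrow> (\<integral>y. gauss_on (V j) (R j) (x - y) \<partial>\<mu> j))"
      using gauss_type.mixture_approximation[OF gt] by (simp add: split_paired_Ex)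
    from bchoice[OF this] obtain Ka where Ka: "\<forall>j\<in>J. \<forall>i :: nat. finite (fst (Ka j) i) \<and> fst (Ka j) i \<noteq> {} \<and> fst (Ka j) i \<subseteq> V j \<and> (\<forall>k\<in>fst (Ka j) i. 0 < snd (Ka j) i k) \<and>
       (\<Sum>k\<in>fst (Ka j) i. snd (Ka j) i k) = measure (\<mu> j) (V j) \<and>
       (\<forall>x\<in>V j. (\<lambda>i. \<Sum>k\<in>fst (Ka j) i. snd (Ka j) i k * gauss_on (V j) (R j) (x - k)) \<longlonglongrightarrow> (\<integral>y. gauss_on (V j) (R j) (x - y) \<partial>\<mu> j))" ..
    define K where "K i j = fst (Ka j) i" for i j
    define a where "a i j = snd (Ka j) i" for i j
    note Ka = Ka[folded K_def a_def, rule_format]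
    define g where "g i j x = (\<Sum>k\<in>K i j. a i j k * gauss_on (V j) (R j) (x - k))" for i j x
    have lim: "(\<lambda>i. g i j (l j x)) \<longlonglongrightarrow> f j (l j x)" if j: "j \<in> J" for j x
      unfolding g_def fx[OF j lV[OF j]] using Ka[OF j] lV[OF j] by blast
    have gnn: "0 \<le> g i j (l j x)" if j: "j \<in> J" for i j x
      unfolding g_def
    proof (intro sum_nonneg mult_nonneg_nonneg)
      fix k assume k: "k \<in> K i j"
      then show "0 \<le> a i j k" using Ka[OF j, of i] by (simp add: less_imp_le)
      have "k \<in> V j" using Ka[OF j, of i] k by blast
      then show "0 \<le> gauss_on (V j) (R j) (l j x - k)"
        by (intro gauss_on_bounds(1)[OF V[OF j] posR[OF j]] subspace_diff[OF V[OF j] lV[OF j]])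
    qed
    let ?F = "\<lambda>i x. ennreal (chi T x * (\<Prod>j\<in>J. g i j (l j x) powr q j))"
    have meas: "?F i \<in> borel_measurable lborel" for i
    proof -
      have T_meas: "T \<in> borel_measurable borel"
        using posT by (intro borel_measurable_continuous_onI linear_continuous_on) (simp add: linear_conv_bounded_linear pos_form_def)
      have l_meas: "l j \<in> borel_measurable borel" if "j \<in> J" for j
        using l[OF that] by (intro borel_measurable_continuous_onI linear_continuous_on) (simp add: linear_conv_bounded_linear)
      have "(\<lambda>x. g i j (l j x) powr q j) \<in> borel_measurable borel" if j: "j \<in> J" for j
        unfolding g_def using gauss_on_measurable[OF linR[OF j], measurable] l_meas[OF j, measurable] by measurable
      then have "(\<lambda>x. chi T x * (\<Prod>j\<in>J. g i j (l j x) powr q j)) \<in> borel_measurable borel"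
        using T_meas unfolding chi_def by (intro borel_measurable_times borel_measurable_prod) measurable
      then show ?thesis by simp
    qed
    \<comment> \<open>Pointwise convergence is enough: Fatou's lemma acts in the right direction,
      and the approximating mixtures have the same masses for all i.\<close>
    have liminf: "ennreal (chi T x * (\<Prod>j\<in>J. f j (l j x) powr q j)) = liminf (\<lambda>i. ?F i x)" for x
    proof -
      have "(\<lambda>i. g i j (l j x) powr q j) \<longlonglongrightarrow> f j (l j x) powr q j" if j: "j \<in> J" for j
        using gnn[OF j] q[OF j] by (intro tendsto_powr' lim[OF j] tendsto_const) auto
      then have "(\<lambda>i. ?F i x) \<longlonglongrightarrow> ennreal (chi T x * (\<Prod>j\<in>J. f j (l j x) powr q j))"
        by (intro tendsto_ennrealI tendsto_mult tendsto_const tendsto_prod)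
      then show ?thesis by (intro lim_imp_Liminf[symmetric]) auto
    qed
    have "(\<integral>\<^sup>+x. ennreal (chi T x * (\<Prod>j\<in>J. f j (l j x) powr q j)) \<partial>lborel) \<le> liminf (\<lambda>i. \<integral>\<^sup>+x. ?F i x \<partial>lborel)"
      unfolding liminf by (rule nn_integral_liminf[OF meas])
    also have "\<dots> \<le> liminf (\<lambda>i::nat. ennreal (BL_const \<alpha> \<beta> * (\<Prod>j\<in>J. measure (\<mu> j) (V j) powr q j)))"
    proof (intro Liminf_mono always_eventually allI)
      fix i
      have "(\<integral>\<^sup>+x. ?F i x \<partial>lborel) \<le> ennreal (BL_const \<alpha> \<beta> * (\<Prod>j\<in>J. (\<Sum>k\<in>K i j. a i j k) powr q j))"
        unfolding g_def using Ka by (intro mixture_inequality[OF \<alpha> \<beta> perc surj]) auto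
      also have "(\<Prod>j\<in>J. (\<Sum>k\<in>K i j. a i j k) powr q j) = (\<Prod>j\<in>J. measure (\<mu> j) (V j) powr q j)"
        using Ka by (intro prod.cong) auto
      finally show "(\<integral>\<^sup>+x. ?F i x \<partial>lborel) \<le> ennreal (BL_const \<alpha> \<beta> * (\<Prod>j\<in>J. measure (\<mu> j) (V j) powr q j))" .
    qed
    also have "\<dots> = ennreal (BL_const \<alpha> \<beta> * (\<Prod>j\<in>J. measure (\<mu> j) (V j) powr q j))"
      by (rule Liminf_const) simp
    also have "\<dots> = ennreal (BL_const \<alpha> \<beta>) * ennreal (\<Prod>j\<in>J. (\<integral>y. f j y \<partial>lborel_on (V j)) powr q j)"
      using BL_const_nonneg mass by (simp add: ennreal_mult prod_nonneg)
    finally show ?thesis .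
  qed
qed

end

theorem theorem1p4:
  fixes J :: "'j set"
    and V :: "'j \<Rightarrow> 'b::euclidean_space set"
    and l :: "'j \<Rightarrow> 'a::euclidean_space \<Rightarrow> 'b"
    and q :: "'j \<Rightarrow> real"
    and R :: "'j \<Rightarrow> 'b \<Rightarrow> 'b"
    and T :: "'a \<Rightarrow> 'a"
    and \<alpha> :: "'j \<Rightarrow> real"
    and \<beta> :: real
  assumes "localised_regularised_BL_datum J V l q R T"
    and "\<forall>j\<in>J. 0 < \<alpha> j"
    and "0 \<le> \<beta>"
    and "perceptive J l q \<alpha> \<beta>"
    and "\<forall>j\<in>J. ess_rank (\<alpha> j) UNIV (l j) = dim (V j)"
  shows "BL J V l q R T \<le> ennreal (
      real DIM('a) powr (BL_A J V q / 2)
      * BL_E J V q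
      * (\<Prod>j\<in>J. \<alpha> j powr (- (q j * real (dim (V j)))))
      * BL_N J l q R T powr ((BL_A J V q - real DIM('a) + \<beta>) / 2)
      * onorm (inv T) powr (\<beta> / 2))"
proof -
  interpret lr_datum J V l q R T by standard (rule assms(1))
  have "BL J V l q R T \<le> ennreal (BL_const \<alpha> \<beta>)"
    unfolding BL_def using of_type_inequality[OF assms(2-5)] by (intro Inf_lower) blast
  then show ?thesis unfolding BL_const_def .
qed

end
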